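(* Let $G=G_1\ast_A G_2$ be an amalgam of finite groups, let $Y$ be a finite subset of $G$ and let $H=\langle Y\rangle$ be the subgroup of $G$ generated by $Y$. Then the graph $(\Gamma(H),v_0)$ constructed from $Y$ by the generalized Stallings' folding algorithm is (canonically isomorphic, as a pointed labelled graph, to) the normal core of $Cayley(G,H)$.
   Context: Amalgam. $G_1=gp\langle X_1|R_1\rangle$, $G_2=gp\langle X_2|R_2\rangle$ are finite groups given by fixed finite presentations with $X_1^{\pm}\cap X_2^{\pm}=\emptyset$; $A$ is a (finite) group with monomorphisms $\phi_i:A\to G_i$; $G=G_1\ast_A G_2=gp\langle X_1,X_2\mid R_1,R_2,\phi_1(A)=\phi_2(A)\rangle$, $X=X_1\cup X_2$. $A$ is identified with its images in $G_1,G_2,G$. All Cayley graphs and relative Cayley graphs of $G_1,G_2$ are given. Graphs. Graphs have directed edges $e$ with inverse edges $\overline e\ne e$, initial vertex $\iota(e)$, terminal vertex $\tau(e)=\iota(\overline e)$; labels satisfy $lab(\overline e)=lab(e)^{-1}\in X^{\pm}$. The label of a path is the word read along it. $Cayley(G,S)$ (relative Cayley graph) has vertices the right cosets $Sg$ and an edge $(Sg,x)$ labelled $x$ from $Sg$ to $Sgx$ for each $x\in X^{\pm}$; basepoint $S\cdot1$; similarly $Cayley(G_i,S)$ with $X_i$. $Cayley(G_i)$ is the Cayley graph of $G_i$. Two pointed labelled graphs that are isomorphic (by an isomorphism preserving labels and basepoint) are identified; for well-labelled connected graphs the isomorphism is unique. An $X_i$-monochromatic component is a maximal connected subgraph labelled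 with $X_i^{\pm}$ having at least one edge. $VB(\Gamma)$ is the set of bichromatic vertices (those at which both $X_1^{\pm}$-labelled and $X_2^{\pm}$-labelled edges start), $VM_i(\Gamma)$ the set of vertices at which only $X_i^{\pm}$-labelled edges start; $VB(C)$, $VM_i(C)$ are the vertices of $C$ in these sets. A folding identifies two distinct edges with the same initial vertex and the same label; cutting hairs removes edges whose terminal vertex has degree 1. Normal core. A word $g_1\cdots g_n$ is in normal form if each $g_k\neq_G1$ lies in one factor, consecutive $g_k$ lie in different factors, and if $n\ne1$ no $g_k$ is in $A$. A path with decomposition $p_1\cdots p_n$ into maximal monochromatic subpaths is normal if $lab(p_1)\cdots lab(p_n)$ is in normal form. A vertex of $Cayley(G,H)$ is essential if some normal path closed at $H\cdot1$ goes through it. The normal core is the restriction of $Cayley(G,H)$ to the essential vertices, understood as the union of all normal paths closed at $H\cdot1$ (the single vertex $H\cdot1$ if $H=\{1\}$). Generalized Stallings' folding algorithm. Input: $\{g_1,\dots,g_n\}\subseteq G$ (words in $X^{\pm}$), $H=\langle g_1,\dots,g_n\rangle$. $\Gamma_k$ denotes the graph after step $k$. Step 1: construct $n$ loops around a common basepoint $v_0$, each labelled by one of the $g_k$. Step 2: iteratively fold edges and cut hairs. Step 3: for each $X_i$-monochromatic component $C$ of $\Gamma_2$ ($i=1,2$), pick $e\in E(C)$ and glue a copy of $Cayley(G_i)$ on $e$ by identifying $1_{G_i}$ with $\iota(e)$ and identifying the two copies of $e$ in $Cayley(G_i)$ and $\Gamma_2$; if necessary, iteratively fold edges. Step 4: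 for each $v\in VB(\Gamma_3)$, if there are paths $p_1,p_2$ with $\iota(p_1)=\iota(p_2)=v$, $\tau(p_1)\neq\tau(p_2)$, $lab(p_i)\in G_i\cap A$ ($i=1,2$) and $lab(p_1)=_Glab(p_2)$, then identify $\tau(p_1)$ with $\tau(p_2)$; if necessary, iteratively fold edges. Step 5: iteratively remove from $\Gamma_4$ all $X_i$-monochromatic components $C$ such that: $(C,\vartheta)\cong(Cayley(G_i,K),K\cdot1)$ with $K\le A$, $\vartheta\in VB(C)$; $|VB(C)|=[A:K]$; and either $K=\{1\}$ and $v_0\notin VM_i(C)$, or $K\ne\{1\}$ and $v_0\notin V(C)$. (Removing $C$ means deleting all edges and all monochromatic vertices of $C$, keeping its bichromatic vertices.) Let $\Gamma$ be the result. If $VB(\Gamma)=\emptyset$ and $(\Gamma,v_0)$ is isomorphic to $(Cayley(G_i),1_{G_i})$, set $V(\Gamma_5)=\{v_0\}$, $E(\Gamma_5)=\emptyset$; else $\Gamma_5=\Gamma$. Step 6: if $v_0\in VM_i(\Gamma_5)$ and $(C,v_0)\cong(Cayley(G_i,K),K\cdot1)$ with $L=K\cap A\ne\{1\}$, where $C$ is the $X_i$-monochromatic component of $\Gamma_5$ with $v_0\in V(C)$, then glue to $\Gamma_5$ a copy of $Cayley(G_j,L)$ ($1\le i\ne j\le2$) by identifying $L\cdot1$ with $v_0$ and identifying the vertices $L\cdot a$ with the vertices $v_0\cdot a$ of $C$ for all $a\in A\setminus L$ (where $v_0\cdot a$ is the endpoint of the path in $C$ from $v_0$ labelled by a word representing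 $a$). Output: $\Gamma(H)=\Gamma_6$ with basepoint $v_0$. *)

theory Defs
  imports "HOL-Algebra.Coset" "HOL-Algebra.Generated_Groups"
begin

section \<open>Words and groups given by presentations\<close>

text \<open>The letter \<open>(x, True)\<close> is the generator \<open>x\<close>, and \<open>(x, False)\<close> is its formal inverse.\<close>

type_synonym 'x letter = "'x \<times> bool"
type_synonym 'x word = "'x letter list"

definition letters :: "'x set \<Rightarrow> 'x letter set" where
  "letters X = X \<times> UNIV"

definition linv :: "'x letter \<Rightarrow> 'x letter" where
  "linv a = (fst a, \<not> snd a)"

definition winv :: "'x word \<Rightarrow> 'x word" where
  "winv w = rev (map linv w)"

definition words :: "'x set \<Rightarrow> 'x word set" where
  "words X = lists (letters X)"

inductive_set pres_rel :: "'x set \<Rightarrow> 'x word set \<Rightarrow> ('x word \<times> 'x word) set"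
  for X :: "'x set" and R :: "'x word set" where
  refl: "u \<in> words X \<Longrightarrow> (u, u) \<in> pres_rel X R"
| sym: "(u, v) \<in> pres_rel X R \<Longrightarrow> (v, u) \<in> pres_rel X R"
| trans: "(u, v) \<in> pres_rel X R \<Longrightarrow> (v, w) \<in> pres_rel X R \<Longrightarrow> (u, w) \<in> pres_rel X R"
| cancel: "u \<in> words X \<Longrightarrow> v \<in> words X \<Longrightarrow> a \<in> letters X \<Longrightarrow>
    (u @ [a, linv a] @ v, u @ v) \<in> pres_rel X R"
| relator: "u \<in> words X \<Longrightarrow> v \<in> words X \<Longrightarrow> r \<in> R \<Longrightarrow>
    (u @ r @ v, u @ v) \<in> pres_rel X R"

text \<open>The group element represented by a word is the class of all words representing it.\<close>

definition pres_elt :: "'x set \<Rightarrow> 'x word set \<Rightarrow> 'x word \<Rightarrow> 'x word set" where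
  "pres_elt X R w = pres_rel X R `` {w}"

definition pres_group :: "'x set \<Rightarrow> 'x word set \<Rightarrow> 'x word set monoid" where
  "pres_group X R =
    \<lparr>carrier = words X // pres_rel X R,
     mult = (\<lambda>P Q. \<Union>p\<in>P. \<Union>q\<in>Q. pres_elt X R (p @ q)),
     one = pres_elt X R []\<rparr>"


section \<open>Labelled graphs\<close>

text \<open>
  An edge is a triple (initial vertex, label, terminal vertex), and the inverse of
  \<open>(u, a, v)\<close> is \<open>(v, linv a, u)\<close>, which is always a different triple. Two edges with the same
  ends and the same label are therefore one edge. Such edges can only arise in the folding
  algorithm below at places where they would immediately be folded together.
\<close>

type_synonym ('v, 'x) edge = "'v \<times> 'x letter \<times> 'v"

record ('v, 'x) lgraph =
  verts :: "'v set"
  edges :: "('v, 'x) edge set"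

type_synonym ('v, 'x) pgraph = "('v, 'x) lgraph \<times> 'v"

abbreviation ini :: "('v, 'x) edge \<Rightarrow> 'v" where "ini e \<equiv> fst e"
abbreviation lab :: "('v, 'x) edge \<Rightarrow> 'x letter" where "lab e \<equiv> fst (snd e)"
abbreviation ter :: "('v, 'x) edge \<Rightarrow> 'v" where "ter e \<equiv> snd (snd e)"

definition einv :: "('v, 'x) edge \<Rightarrow> ('v, 'x) edge" where
  "einv e = (ter e, linv (lab e), ini e)"

definition wf_graph :: "('v, 'x) lgraph \<Rightarrow> bool" where
  "wf_graph \<Gamma> \<longleftrightarrow> (\<forall>e\<in>edges \<Gamma>. ini e \<in> verts \<Gamma> \<and> ter e \<in> verts \<Gamma> \<and> einv e \<in> edges \<Gamma>)"

fun path :: "('v, 'x) lgraph \<Rightarrow> 'v \<Rightarrow> ('v, 'x) edge list \<Rightarrow> 'v \<Rightarrow> bool" where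
  "path \<Gamma> u [] v \<longleftrightarrow> u \<in> verts \<Gamma> \<and> u = v"
| "path \<Gamma> u (e # p) v \<longleftrightarrow> e \<in> edges \<Gamma> \<and> ini e = u \<and> path \<Gamma> (ter e) p v"

definition label :: "('v, 'x) edge list \<Rightarrow> 'x word" where
  "label p = map lab p"

definition connected_graph :: "('v, 'x) lgraph \<Rightarrow> bool" where
  "connected_graph \<Gamma> \<longleftrightarrow> (\<forall>u\<in>verts \<Gamma>. \<forall>v\<in>verts \<Gamma>. \<exists>p. path \<Gamma> u p v)"

definition subgraph :: "('v, 'x) lgraph \<Rightarrow> ('v, 'x) lgraph \<Rightarrow> bool" where
  "subgraph C \<Gamma> \<longleftrightarrow> wf_graph C \<and> verts C \<subseteq> verts \<Gamma> \<and> edges C \<subseteq> edges \<Gamma>"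

text \<open>\<open>mono_component X \<Gamma> C\<close>: the graph \<open>C\<close> is an \<open>X\<close>-monochromatic component of \<open>\<Gamma>\<close>.\<close>

definition mono_connected :: "'x set \<Rightarrow> ('v, 'x) lgraph \<Rightarrow> ('v, 'x) lgraph \<Rightarrow> bool" where
  "mono_connected X \<Gamma> C \<longleftrightarrow>
    subgraph C \<Gamma> \<and> connected_graph C \<and> edges C \<noteq> {} \<and> lab ` edges C \<subseteq> letters X"

definition mono_component :: "'x set \<Rightarrow> ('v, 'x) lgraph \<Rightarrow> ('v, 'x) lgraph \<Rightarrow> bool" where
  "mono_component X \<Gamma> C \<longleftrightarrow> mono_connected X \<Gamma> C \<and>
    (\<forall>D. mono_connected X \<Gamma> D \<and> subgraph C D \<longrightarrow> D = C)"

text \<open>Image of a pointed graph under a map of vertices; this is how vertices are identified.\<close>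

definition map_pgraph :: "('v \<Rightarrow> 'w) \<Rightarrow> ('v, 'x) pgraph \<Rightarrow> ('w, 'x) pgraph" where
  "map_pgraph f \<Gamma> =
    (\<lparr>verts = f ` verts (fst \<Gamma>),
      edges = (\<lambda>e. (f (ini e), lab e, f (ter e))) ` edges (fst \<Gamma>)\<rparr>, f (snd \<Gamma>))"

definition pgraph_iso :: "('v, 'x) pgraph \<Rightarrow> ('w, 'x) pgraph \<Rightarrow> bool" (infix "\<cong>\<^sub>p" 50) where
  "\<Gamma> \<cong>\<^sub>p \<Delta> \<longleftrightarrow> (\<exists>f. inj_on f (verts (fst \<Gamma>)) \<and> map_pgraph f \<Gamma> = \<Delta>)"

text \<open>Identify all pairs of vertices in \<open>P\<close>; new vertices are the classes of old ones under the
  equivalence relation generated by \<open>P\<close>.\<close>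

definition quot_pgraph :: "('v \<times> 'v) set \<Rightarrow> ('v, 'x) pgraph \<Rightarrow> ('v set, 'x) pgraph" where
  "quot_pgraph P \<Gamma> = map_pgraph (\<lambda>v. (P \<union> P\<inverse>)\<^sup>* `` {v}) \<Gamma>"

text \<open>Disjoint union of \<open>\<Gamma>\<close> with the graphs \<open>\<Delta> k\<close>, \<open>k \<in> I\<close>, with the vertices identified along
  \<open>P\<close>.\<close>

definition glue ::
  "('v + 'k \<times> 'w) rel \<Rightarrow> ('v, 'x) pgraph \<Rightarrow> 'k set \<Rightarrow> ('k \<Rightarrow> ('w, 'x) lgraph)
    \<Rightarrow> (('v + 'k \<times> 'w) set, 'x) pgraph" where
  "glue P \<Gamma> I \<Delta> = quot_pgraph P
    (\<lparr>verts = Inl ` verts (fst \<Gamma>) \<union> {Inr (k, g) |k g. k \<in> I \<and> g \<in> verts (\<Delta> k)},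
      edges = {(Inl u, a, Inl v) |u a v. (u, a, v) \<in> edges (fst \<Gamma>)} \<union>
        {(Inr (k, g), a, Inr (k, h)) |k g a h. k \<in> I \<and> (g, a, h) \<in> edges (\<Delta> k)}\<rparr>,
     Inl (snd \<Gamma>))"

text \<open>The relative Cayley graph of \<open>pres_group X R\<close> with respect to the subgroup \<open>S\<close>. The Cayley
  graph itself is the case of the trivial subgroup, with \<open>{g}\<close> in place of \<open>g\<close>.\<close>

definition cayley :: "'x set \<Rightarrow> 'x word set \<Rightarrow> 'x word set set \<Rightarrow> ('x word set set, 'x) pgraph" where
  "cayley X R S = (let G = pres_group X R in
    (\<lparr>verts = rcosets\<^bsub>G\<^esub> S,
      edges = {(S #>\<^bsub>G\<^esub> g, a, S #>\<^bsub>G\<^esub> (g \<otimes>\<^bsub>G\<^esub> pres_elt X R [a])) |g a.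
        g \<in> carrier G \<and> a \<in> letters X}\<rparr>, S #>\<^bsub>G\<^esub> \<one>\<^bsub>G\<^esub>))"


section \<open>Amalgams of finite groups\<close>

datatype factor = First | Second

fun other :: "factor \<Rightarrow> factor" where
  "other First = Second"
| "other Second = First"

text \<open>The factor \<open>G\<^sub>i\<close> is presented by \<open>gens i\<close>, \<open>rels i\<close>; \<open>amalgamated\<close> is the group \<open>A\<close> and
  \<open>emb i\<close> its embedding into \<open>G\<^sub>i\<close>.\<close>

record ('a, 'x) amalgam =
  gens :: "factor \<Rightarrow> 'x set"
  rels :: "factor \<Rightarrow> 'x word set"
  amalgamated :: "'a monoid"
  emb :: "factor \<Rightarrow> 'a \<Rightarrow> 'x word set"

definition factor_group :: "('a, 'x) amalgam \<Rightarrow> factor \<Rightarrow> 'x word set monoid" where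
  "factor_group \<A> i = pres_group (gens \<A> i) (rels \<A> i)"

definition finite_amalgam :: "('a, 'x) amalgam \<Rightarrow> bool" where
  "finite_amalgam \<A> \<longleftrightarrow>
    gens \<A> First \<inter> gens \<A> Second = {} \<and> group (amalgamated \<A>) \<and>
    (\<forall>i. finite (gens \<A> i) \<and> finite (rels \<A> i) \<and> rels \<A> i \<subseteq> words (gens \<A> i) \<and>
      finite (carrier (factor_group \<A> i)) \<and>
      emb \<A> i \<in> hom (amalgamated \<A>) (factor_group \<A> i) \<and>
      inj_on (emb \<A> i) (carrier (amalgamated \<A>)))"

definition all_gens :: "('a, 'x) amalgam \<Rightarrow> 'x set" where
  "all_gens \<A> = gens \<A> First \<union> gens \<A> Second"

text \<open>An element of \<open>G\<^sub>i\<close> is a set of words, so the relations \<open>\<phi>\<^sub>1(a) = \<phi>\<^sub>2(a)\<close> are imposed for all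
  words representing the two sides.\<close>

definition all_rels :: "('a, 'x) amalgam \<Rightarrow> 'x word set" where
  "all_rels \<A> = rels \<A> First \<union> rels \<A> Second \<union>
    {u @ winv v |u v a. a \<in> carrier (amalgamated \<A>) \<and> u \<in> emb \<A> First a \<and> v \<in> emb \<A> Second a}"

definition amalgam_group :: "('a, 'x) amalgam \<Rightarrow> 'x word set monoid" where
  "amalgam_group \<A> = pres_group (all_gens \<A>) (all_rels \<A>)"

definition elt :: "('a, 'x) amalgam \<Rightarrow> 'x word \<Rightarrow> 'x word set" where
  "elt \<A> w = pres_elt (all_gens \<A>) (all_rels \<A>) w"

text \<open>The images of \<open>A\<close> in \<open>G\<^sub>i\<close>, of \<open>G\<^sub>i\<close> in \<open>G\<close> and of \<open>A\<close> in \<open>G\<close>.\<close>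

definition A_in_factor :: "('a, 'x) amalgam \<Rightarrow> factor \<Rightarrow> 'x word set set" where
  "A_in_factor \<A> i = emb \<A> i ` carrier (amalgamated \<A>)"

definition factor_in_G :: "('a, 'x) amalgam \<Rightarrow> factor \<Rightarrow> 'x word set set" where
  "factor_in_G \<A> i = elt \<A> ` words (gens \<A> i)"

definition A_in_G :: "('a, 'x) amalgam \<Rightarrow> 'x word set set" where
  "A_in_G \<A> = {elt \<A> w |w a. a \<in> carrier (amalgamated \<A>) \<and> w \<in> emb \<A> First a}"

definition factor_cayley ::
  "('a, 'x) amalgam \<Rightarrow> factor \<Rightarrow> 'x word set set \<Rightarrow> ('x word set set, 'x) pgraph" where
  "factor_cayley \<A> i K = cayley (gens \<A> i) (rels \<A> i) K"

definition amalgam_cayley ::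
  "('a, 'x) amalgam \<Rightarrow> 'x word set set \<Rightarrow> ('x word set set, 'x) pgraph" where
  "amalgam_cayley \<A> H = cayley (all_gens \<A>) (all_rels \<A>) H"


section \<open>The normal core\<close>

definition normal_form :: "('a, 'x) amalgam \<Rightarrow> 'x word set list \<Rightarrow> bool" where
  "normal_form \<A> gs \<longleftrightarrow>
    (\<forall>g\<in>set gs. g \<noteq> \<one>\<^bsub>amalgam_group \<A>\<^esub> \<and> (\<exists>i. g \<in> factor_in_G \<A> i)) \<and>
    (\<forall>k. Suc k < length gs \<longrightarrow>
      (\<exists>i. gs ! k \<in> factor_in_G \<A> i \<and> gs ! Suc k \<in> factor_in_G \<A> (other i))) \<and>
    (length gs \<noteq> 1 \<longrightarrow> (\<forall>g\<in>set gs. g \<notin> A_in_G \<A>))"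

text \<open>\<open>ps\<close> is the decomposition of the path \<open>p\<close> into maximal monochromatic subpaths.\<close>

definition mono_decomposition ::
  "('a, 'x) amalgam \<Rightarrow> ('v, 'x) edge list \<Rightarrow> ('v, 'x) edge list list \<Rightarrow> bool" where
  "mono_decomposition \<A> p ps \<longleftrightarrow> concat ps = p \<and>
    (\<forall>q\<in>set ps. q \<noteq> [] \<and> (\<exists>i. label q \<in> words (gens \<A> i))) \<and>
    (\<forall>k. Suc k < length ps \<longrightarrow>
      (\<exists>i. label (ps ! k) \<in> words (gens \<A> i) \<and> label (ps ! Suc k) \<in> words (gens \<A> (other i))))"

definition normal_path :: "('a, 'x) amalgam \<Rightarrow> ('v, 'x) edge list \<Rightarrow> bool" where
  "normal_path \<A> p \<longleftrightarrow>
    (\<exists>ps. mono_decomposition \<A> p ps \<and> normal_form \<A> (map (\<lambda>q. elt \<A> (label q)) ps))"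

definition normal_loops ::
  "('a, 'x) amalgam \<Rightarrow> 'x word set set \<Rightarrow> ('x word set set, 'x) edge list set" where
  "normal_loops \<A> H = {p. normal_path \<A> p \<and>
    path (fst (amalgam_cayley \<A> H)) (snd (amalgam_cayley \<A> H)) p (snd (amalgam_cayley \<A> H))}"

text \<open>The union of all normal paths closed at the base point. The base point is always included,
  as the empty path; for trivial \<open>H\<close> it is the only vertex.\<close>

definition normal_core ::
  "('a, 'x) amalgam \<Rightarrow> 'x word set set \<Rightarrow> ('x word set set, 'x) pgraph" where
  "normal_core \<A> H =
    (\<lparr>verts = {snd (amalgam_cayley \<A> H)} \<union>
        (\<Union>p\<in>normal_loops \<A> H. ini ` set p \<union> ter ` set p),
      edges = (\<Union>p\<in>normal_loops \<A> H. set p \<union> einv ` set p)\<rparr>,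
     snd (amalgam_cayley \<A> H))"


section \<open>The generalized Stallings folding algorithm\<close>

definition bichromatic :: "('a, 'x) amalgam \<Rightarrow> ('v, 'x) lgraph \<Rightarrow> 'v set" where
  "bichromatic \<A> \<Gamma> =
    {v \<in> verts \<Gamma>. \<forall>i. \<exists>e\<in>edges \<Gamma>. ini e = v \<and> lab e \<in> letters (gens \<A> i)}"

definition monochromatic :: "('a, 'x) amalgam \<Rightarrow> factor \<Rightarrow> ('v, 'x) lgraph \<Rightarrow> 'v set" where
  "monochromatic \<A> i \<Gamma> =
    {v \<in> verts \<Gamma>. \<forall>e\<in>edges \<Gamma>. ini e = v \<longrightarrow> lab e \<in> letters (gens \<A> i)}"

text \<open>\<open>exhausts r x y\<close>: applying \<open>r\<close> iteratively to \<open>x\<close>, as long as possible, can result in \<open>y\<close>.\<close>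

definition exhausts :: "('s \<Rightarrow> 's \<Rightarrow> bool) \<Rightarrow> 's \<Rightarrow> 's \<Rightarrow> bool" where
  "exhausts r x y \<longleftrightarrow> r\<^sup>*\<^sup>* x y \<and> (\<nexists>z. r y z)"

definition fold_step :: "('v, 'x) pgraph \<Rightarrow> ('v, 'x) pgraph \<Rightarrow> bool" where
  "fold_step \<Gamma> \<Gamma>' \<longleftrightarrow>
    (\<exists>e\<in>edges (fst \<Gamma>). \<exists>f\<in>edges (fst \<Gamma>). e \<noteq> f \<and> ini e = ini f \<and> lab e = lab f \<and>
      \<Gamma>' = map_pgraph (\<lambda>v. if v = ter f then ter e else v) \<Gamma>)"

text \<open>The base point is never cut off.\<close>

definition hair_step :: "('v, 'x) pgraph \<Rightarrow> ('v, 'x) pgraph \<Rightarrow> bool" where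
  "hair_step \<Gamma> \<Gamma>' \<longleftrightarrow>
    (\<exists>e\<in>edges (fst \<Gamma>). ter e \<noteq> snd \<Gamma> \<and> card {f \<in> edges (fst \<Gamma>). ini f = ter e} = 1 \<and>
      \<Gamma>' = (\<lparr>verts = verts (fst \<Gamma>) - {ter e}, edges = edges (fst \<Gamma>) - {e, einv e}\<rparr>, snd \<Gamma>))"

text \<open>\<open>loop_vertex ws k j\<close> is the vertex reached after \<open>j\<close> letters on the loop labelled \<open>ws ! k\<close>;
  the common base point is \<open>None\<close>.\<close>

definition loop_vertex :: "'x word list \<Rightarrow> nat \<Rightarrow> nat \<Rightarrow> (nat \<times> nat) option" where
  "loop_vertex ws k j = (if j = 0 \<or> j = length (ws ! k) then None else Some (k, j))"

definition step1 :: "'x word list \<Rightarrow> ((nat \<times> nat) option, 'x) pgraph" where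
  "step1 ws = (let E = {(loop_vertex ws k j, ws ! k ! j, loop_vertex ws k (Suc j)) |k j.
        k < length ws \<and> j < length (ws ! k)} in
    (\<lparr>verts = {None} \<union> {loop_vertex ws k j |k j. k < length ws \<and> j < length (ws ! k)},
      edges = E \<union> einv ` E\<rparr>, None))"

definition step2 :: "('v, 'x) pgraph \<Rightarrow> ('v, 'x) pgraph \<Rightarrow> bool" where
  "step2 = exhausts (\<lambda>\<Gamma> \<Gamma>'. fold_step \<Gamma> \<Gamma>' \<or> hair_step \<Gamma> \<Gamma>')"

definition factor_of_letter :: "('a, 'x) amalgam \<Rightarrow> 'x letter \<Rightarrow> factor" where
  "factor_of_letter \<A> a = (if a \<in> letters (gens \<A> First) then First else Second)"

text \<open>\<open>T\<close> is the set of the picked edges, one for each monochromatic component; the copy of a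
  Cayley graph glued on the edge \<open>e\<close> is indexed by \<open>e\<close>. Identifying both ends of the copies of
  \<open>e\<close> identifies the edges themselves.\<close>

definition step3 :: "('a, 'x) amalgam \<Rightarrow> ('v, 'x) pgraph \<Rightarrow>
    (('v + ('v, 'x) edge \<times> 'x word set set) set, 'x) pgraph \<Rightarrow> bool" where
  "step3 \<A> \<Gamma> \<Gamma>' \<longleftrightarrow>
    (\<exists>T \<subseteq> edges (fst \<Gamma>).
      (\<forall>i C. mono_component (gens \<A> i) (fst \<Gamma>) C \<longrightarrow> (\<exists>!e. e \<in> T \<and> e \<in> edges C)) \<and>
      exhausts fold_step
        (glue
          (\<Union>e\<in>T. let i = factor_of_letter \<A> (lab e); (Cay, c) = factor_cayley \<A> i {\<one>\<^bsub>factor_group \<A> i\<^esub>} in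
            {(Inl (ini e), Inr (e, c))} \<union>
            {(Inl (ter e), Inr (e, d)) |d. (c, lab e, d) \<in> edges Cay})
          \<Gamma> T
          (\<lambda>e. let i = factor_of_letter \<A> (lab e) in fst (factor_cayley \<A> i {\<one>\<^bsub>factor_group \<A> i\<^esub>})))
        \<Gamma>')"

definition step4 :: "('a, 'x) amalgam \<Rightarrow> ('v, 'x) pgraph \<Rightarrow> ('v set, 'x) pgraph \<Rightarrow> bool" where
  "step4 \<A> \<Gamma> \<Gamma>' \<longleftrightarrow>
    exhausts fold_step
      (quot_pgraph
        {(t1, t2) |t1 t2 v p1 p2. v \<in> bichromatic \<A> (fst \<Gamma>) \<and>
          path (fst \<Gamma>) v p1 t1 \<and> path (fst \<Gamma>) v p2 t2 \<and> t1 \<noteq> t2 \<and>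
          label p1 \<in> words (gens \<A> First) \<and> label p2 \<in> words (gens \<A> Second) \<and>
          elt \<A> (label p1) \<in> A_in_G \<A> \<and> elt \<A> (label p2) \<in> A_in_G \<A> \<and>
          elt \<A> (label p1) = elt \<A> (label p2)}
        \<Gamma>)
      \<Gamma>'"

definition redundant ::
  "('a, 'x) amalgam \<Rightarrow> ('v, 'x) pgraph \<Rightarrow> factor \<Rightarrow> ('v, 'x) lgraph \<Rightarrow> bool" where
  "redundant \<A> \<Gamma> i C \<longleftrightarrow> mono_component (gens \<A> i) (fst \<Gamma>) C \<and>
    (\<exists>K \<theta>. subgroup K (factor_group \<A> i) \<and> K \<subseteq> A_in_factor \<A> i \<and>
      \<theta> \<in> bichromatic \<A> (fst \<Gamma>) \<inter> verts C \<and>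
      (C, \<theta>) \<cong>\<^sub>p factor_cayley \<A> i K \<and>
      card (bichromatic \<A> (fst \<Gamma>) \<inter> verts C) =
        card (rcosets\<^bsub>(factor_group \<A> i)\<lparr>carrier := A_in_factor \<A> i\<rparr>\<^esub> K) \<and>
      (K = {\<one>\<^bsub>factor_group \<A> i\<^esub>} \<and> snd \<Gamma> \<notin> monochromatic \<A> i (fst \<Gamma>) \<inter> verts C \<or>
       K \<noteq> {\<one>\<^bsub>factor_group \<A> i\<^esub>} \<and> snd \<Gamma> \<notin> verts C))"

definition removal_step :: "('a, 'x) amalgam \<Rightarrow> ('v, 'x) pgraph \<Rightarrow> ('v, 'x) pgraph \<Rightarrow> bool" where
  "removal_step \<A> \<Gamma> \<Gamma>' \<longleftrightarrow>
    (\<exists>i C. redundant \<A> \<Gamma> i C \<and>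
      \<Gamma>' = (\<lparr>verts = verts (fst \<Gamma>) - (verts C - bichromatic \<A> (fst \<Gamma>)),
              edges = edges (fst \<Gamma>) - edges C\<rparr>, snd \<Gamma>))"

definition step5 :: "('a, 'x) amalgam \<Rightarrow> ('v, 'x) pgraph \<Rightarrow> ('v, 'x) pgraph \<Rightarrow> bool" where
  "step5 \<A> \<Gamma> \<Gamma>' \<longleftrightarrow>
    (\<exists>\<Delta>. exhausts (removal_step \<A>) \<Gamma> \<Delta> \<and>
      \<Gamma>' = (if bichromatic \<A> (fst \<Delta>) = {} \<and>
                (\<exists>i. \<Delta> \<cong>\<^sub>p factor_cayley \<A> i {\<one>\<^bsub>factor_group \<A> i\<^esub>})
             then (\<lparr>verts = {snd \<Delta>}, edges = {}\<rparr>, snd \<Delta>) else \<Delta>))"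

text \<open>In the following, \<open>L\<close> is \<open>K \<inter> A\<close> as a subgroup of \<open>A\<close>.\<close>

definition needs_completion ::
  "('a, 'x) amalgam \<Rightarrow> ('v, 'x) pgraph \<Rightarrow> factor \<Rightarrow> ('v, 'x) lgraph \<Rightarrow> 'a set \<Rightarrow> bool" where
  "needs_completion \<A> \<Gamma> i C L \<longleftrightarrow>
    snd \<Gamma> \<in> monochromatic \<A> i (fst \<Gamma>) \<and> mono_component (gens \<A> i) (fst \<Gamma>) C \<and>
    snd \<Gamma> \<in> verts C \<and>
    (\<exists>K. subgroup K (factor_group \<A> i) \<and> (C, snd \<Gamma>) \<cong>\<^sub>p factor_cayley \<A> i K \<and>
      L = {a \<in> carrier (amalgamated \<A>). emb \<A> i a \<in> K}) \<and>
    L \<noteq> {\<one>\<^bsub>amalgamated \<A>\<^esub>}"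

text \<open>If there is nothing to glue, the result is a copy of \<open>\<Gamma>\<close>, with vertices \<open>{Inl v}\<close> in
  place of \<open>v\<close>.\<close>

definition step6 :: "('a, 'x) amalgam \<Rightarrow> ('v, 'x) pgraph \<Rightarrow>
    (('v + factor \<times> 'x word set set) set, 'x) pgraph \<Rightarrow> bool" where
  "step6 \<A> \<Gamma> \<Gamma>' \<longleftrightarrow>
    (\<exists>i C L. needs_completion \<A> \<Gamma> i C L \<and>
      (let j = other i; Gj = factor_group \<A> j; Lj = emb \<A> j ` L in
        \<Gamma>' = glue
          ({(Inl (snd \<Gamma>), Inr (j, Lj #>\<^bsub>Gj\<^esub> \<one>\<^bsub>Gj\<^esub>))} \<union>
           {(Inl t, Inr (j, Lj #>\<^bsub>Gj\<^esub> emb \<A> j a)) |a t p. a \<in> carrier (amalgamated \<A>) - L \<and>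
             path C (snd \<Gamma>) p t \<and> label p \<in> emb \<A> i a})
          \<Gamma> {j} (\<lambda>j. fst (factor_cayley \<A> j Lj)))) \<or>
    (\<nexists>i C L. needs_completion \<A> \<Gamma> i C L) \<and> \<Gamma>' = map_pgraph (\<lambda>v. {Inl v}) \<Gamma>"

text \<open>\<open>stallings_output \<A> ws \<Gamma>\<close>: some run of the algorithm on the input \<open>ws\<close> returns \<open>\<Gamma>\<close>.\<close>

definition stallings_output where
  "stallings_output \<A> ws \<Gamma> \<longleftrightarrow>
    (\<exists>\<Gamma>2 \<Gamma>3 \<Gamma>4 \<Gamma>5. step2 (step1 ws) \<Gamma>2 \<and> step3 \<A> \<Gamma>2 \<Gamma>3 \<and> step4 \<A> \<Gamma>3 \<Gamma>4 \<and>
      step5 \<A> \<Gamma>4 \<Gamma>5 \<and> step6 \<A> \<Gamma>5 \<Gamma>)"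

end

theory Submission
  imports Defs
begin

text \<open>
  Why the theorem holds. Every graph that occurs before the last step carries a label-preserving
  map to the relative Cayley graph of \<open>H\<close> that sends the base point to \<open>H\<close>, and every generator of
  \<open>H\<close> is represented by a closed walk at its base point; these two facts (\<open>good\<close>) survive folding,
  gluing and cutting hairs. After step 4 the graph is moreover a pre-cover: no two edges fold, every
  component is a full relative Cayley graph of its factor, and at bichromatic vertices both factors
  induce the same action of \<open>A\<close> (\<open>step4_pre\<close>). So the vertices at which factor \<open>i\<close> can be read
  form a set on which \<open>G\<^sub>i\<close> acts, and the two actions agree on \<open>A\<close>.

  The central tool is van der Waerden's construction (locale \<open>precover\<close>). Such a pair of partial
  actions extends to an action of the whole amalgam on the vertices together with stacks of coset
  representatives: a syllable outside \<open>A\<close> that cannot be read in the graph is pushed on the stack,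
  and the following syllables of a normal form only make the stack longer. The normal form
  theorem and the embedding of the factors follow (\<open>alternating_nontrivial\<close>, \<open>elt_factor_inj\<close>). For
  a pre-cover of \<open>H\<close> the base point is fixed by \<open>H\<close>, which has two consequences: the graph embeds in
  the relative Cayley graph (\<open>coset_map_inj\<close>), and a normal closed path of the relative Cayley graph
  can never leave the image of the graph (\<open>run_alternating_reads\<close>). Hence the normal core is
  contained in the image, up to a component of one syllable at the base point. That component is
  the one that step 6 adds.

  Step 5 keeps all of this, since a walk through a removed component enters and leaves it at
  vertices that differ by an element of \<open>A\<close>, and that element can be read in the other factor
  (\<open>\<Gamma>'_retract\<close>). Conversely, when nothing more can be removed, every edge lies on a normal
  closed path (\<open>all_essential\<close>). If a component is entered by a reduced walk from the base point
  but no reduced walk returns from it, then the states reached beyond it contain no cycle, because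
  one could run around a cycle and come back (\<open>lollipop\<close>). So there is a last component beyond it.
  All bichromatic vertices of that component lie in one orbit of \<open>A\<close> and its group lies in \<open>A\<close>,
  so it is redundant, unless it is the whole graph, which is the exceptional case of step 5. The two
  inclusions give the isomorphism (\<open>step6_core\<close>).
\<close>

section \<open>Words and presented groups\<close>

lemma linv_linv [simp]: "linv (linv a) = a"
  by (simp add: linv_def)

lemma linv_neq [simp]: "linv a \<noteq> a" "a \<noteq> linv a"
  by (auto simp: linv_def prod_eq_iff)

lemma linv_letters [simp]: "linv a \<in> letters X \<longleftrightarrow> a \<in> letters X"
  by (cases a) (auto simp: linv_def letters_def)

lemma words_simps [simp]:
  "[] \<in> words X"
  "a # w \<in> words X \<longleftrightarrow> a \<in> letters X \<and> w \<in> words X"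
  "u @ w \<in> words X \<longleftrightarrow> u \<in> words X \<and> w \<in> words X"
  by (auto simp: words_def)

lemma winv_simps [simp]:
  "winv [] = []"
  "winv (a # w) = winv w @ [linv a]"
  "winv (u @ w) = winv w @ winv u"
  by (auto simp: winv_def)

lemma winv_winv [simp]: "winv (winv w) = w"
  by (induction w) auto

lemma winv_words [simp]: "winv w \<in> words X \<longleftrightarrow> w \<in> words X"
  by (induction w) auto

lemma words_mono: "X \<subseteq> X' \<Longrightarrow> w \<in> words X \<Longrightarrow> w \<in> words X'"
  by (auto simp: words_def letters_def)

lemma pres_rel_mono:
  assumes "(u, v) \<in> pres_rel X R" "X \<subseteq> X'" "R \<subseteq> R'"
  shows "(u, v) \<in> pres_rel X' R'"
  using assms(1)
proof (induction rule: pres_rel.induct)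
  case (cancel u v a)
  then show ?case
    using assms words_mono by (intro pres_rel.cancel) (auto simp: letters_def)
next
  case (relator u v r)
  then show ?case
    using assms words_mono by (intro pres_rel.relator) auto
qed (use assms words_mono in \<open>blast intro: pres_rel.intros\<close>)+

locale presentation =
  fixes X :: "'x set" and R :: "'x word set"
  assumes rels_words: "R \<subseteq> words X"
begin

abbreviation "cl \<equiv> pres_elt X R"

lemma pres_rel_words: "(u, v) \<in> pres_rel X R \<Longrightarrow> u \<in> words X \<and> v \<in> words X"
  by (induction rule: pres_rel.induct) (use rels_words in auto)

lemma equiv_pres_rel: "equiv (words X) (pres_rel X R)"
  by (rule equivI)
    (auto intro!: refl_onI symI transI dest: pres_rel_words intro: pres_rel.intros)

lemma pres_rel_context:
  assumes "(u, v) \<in> pres_rel X R" "p \<in> words X" "q \<in> words X"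
  shows "(p @ u @ q, p @ v @ q) \<in> pres_rel X R"
  using assms(1)
proof (induction rule: pres_rel.induct)
  case (cancel u v a)
  then show ?case
    using pres_rel.cancel[of "p @ u" X "v @ q" a R] assms by simp
next
  case (relator u v r)
  then show ?case
    using pres_rel.relator[of "p @ u" X "v @ q" r R] assms by simp
qed (use assms in \<open>auto intro: pres_rel.intros\<close>)

lemma pres_rel_append:
  assumes "(u, u') \<in> pres_rel X R" "(v, v') \<in> pres_rel X R"
  shows "(u @ v, u' @ v') \<in> pres_rel X R"
proof -
  have "(u @ v, u' @ v) \<in> pres_rel X R"
    using pres_rel_context[OF assms(1), of "[]" v] pres_rel_words[OF assms(2)] by simp
  moreover have "(u' @ v, u' @ v') \<in> pres_rel X R"
    using pres_rel_context[OF assms(2), of u' "[]"] pres_rel_words[OF assms(1)] by simp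
  ultimately show ?thesis by (rule pres_rel.trans)
qed

lemma pres_rel_winv: "w \<in> words X \<Longrightarrow> (w @ winv w, []) \<in> pres_rel X R"
proof (induction w)
  case (Cons a w)
  then have "([a] @ (w @ winv w) @ [linv a], [a] @ [] @ [linv a]) \<in> pres_rel X R"
    by (intro pres_rel_context) auto
  moreover have "([] @ [a, linv a] @ [], [] @ []) \<in> pres_rel X R"
    using Cons.prems by (intro pres_rel.cancel) auto
  ultimately show ?case
    by (auto intro: pres_rel.trans)
qed (auto intro: pres_rel.intros)

lemma cl_eq_iff: "u \<in> words X \<Longrightarrow> v \<in> words X \<Longrightarrow> cl u = cl v \<longleftrightarrow> (u, v) \<in> pres_rel X R"
  unfolding pres_elt_def by (rule eq_equiv_class_iff[OF equiv_pres_rel])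

lemma cl_eqI: "(u, v) \<in> pres_rel X R \<Longrightarrow> cl u = cl v"
  using cl_eq_iff pres_rel_words by blast

lemma mem_cl_iff: "v \<in> cl u \<longleftrightarrow> (u, v) \<in> pres_rel X R"
  by (simp add: pres_elt_def)

lemma self_mem_cl: "w \<in> words X \<Longrightarrow> w \<in> cl w"
  by (simp add: mem_cl_iff pres_rel.refl)

lemma carrier_pres: "carrier (pres_group X R) = cl ` words X"
  by (auto simp: pres_group_def quotient_def pres_elt_def)

lemma one_pres: "\<one>\<^bsub>pres_group X R\<^esub> = cl []"
  by (simp add: pres_group_def)

lemma mult_cl:
  assumes "u \<in> words X" "v \<in> words X"
  shows "cl u \<otimes>\<^bsub>pres_group X R\<^esub> cl v = cl (u @ v)"
proof -
  have "cl (p @ q) = cl (u @ v)" if "p \<in> cl u" "q \<in> cl v" for p q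
    using that by (intro cl_eqI) (auto simp: mem_cl_iff intro: pres_rel_append pres_rel.sym)
  moreover have "u \<in> cl u" "v \<in> cl v"
    using assms by (auto intro: self_mem_cl)
  ultimately have "(\<Union>p\<in>cl u. \<Union>q\<in>cl v. cl (p @ q)) = cl (u @ v)"
    by blast
  then show ?thesis
    by (simp add: pres_group_def)
qed

lemma cl_of_mem: "g \<in> carrier (pres_group X R) \<Longrightarrow> w \<in> g \<Longrightarrow> w \<in> words X \<and> g = cl w"
  unfolding carrier_pres by (metis cl_eqI imageE mem_cl_iff pres_rel_words)

lemma ex_word: "g \<in> carrier (pres_group X R) \<Longrightarrow> \<exists>w. w \<in> g \<and> w \<in> words X \<and> g = cl w"
  by (auto simp: carrier_pres intro: self_mem_cl)

lemma group_pres: "group (pres_group X R)"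
proof (rule groupI)
  fix x assume "x \<in> carrier (pres_group X R)"
  then obtain u where u: "u \<in> words X" "x = cl u" by (auto simp: carrier_pres)
  then have "cl (winv u) \<otimes>\<^bsub>pres_group X R\<^esub> x = cl (winv u @ u)"
    by (simp add: mult_cl)
  also have "\<dots> = cl []"
    using pres_rel_winv[of "winv u"] u by (intro cl_eqI) simp
  finally show "\<exists>y\<in>carrier (pres_group X R). y \<otimes>\<^bsub>pres_group X R\<^esub> x = \<one>\<^bsub>pres_group X R\<^esub>"
    using u by (auto simp: carrier_pres one_pres)
qed (auto simp: carrier_pres one_pres mult_cl)

lemma cl_winv: "u \<in> words X \<Longrightarrow> cl (winv u) = inv\<^bsub>pres_group X R\<^esub> (cl u)"
proof -
  assume u: "u \<in> words X"
  interpret group "pres_group X R" by (rule group_pres)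
  have "cl (winv u) \<otimes>\<^bsub>pres_group X R\<^esub> cl u = \<one>\<^bsub>pres_group X R\<^esub>"
    using pres_rel_winv[of "winv u"] u by (auto simp: mult_cl one_pres intro!: cl_eqI)
  then show ?thesis
    using u by (intro inv_equality[symmetric]) (auto simp: carrier_pres)
qed

text \<open>Von Dyck's principle for actions. The extended action below is defined letter by letter, and
  this lemma turns it into an action of the amalgam.\<close>

lemma pres_rel_action:
  assumes "(u, v) \<in> pres_rel X R" "s \<in> S"
    and closed: "\<And>a s. a \<in> letters X \<Longrightarrow> s \<in> S \<Longrightarrow> f a s \<in> S"
    and cancel: "\<And>a s. a \<in> letters X \<Longrightarrow> s \<in> S \<Longrightarrow> f (linv a) (f a s) = s"
    and relator: "\<And>r s. r \<in> R \<Longrightarrow> s \<in> S \<Longrightarrow> fold f r s = s"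
  shows "fold f u s = fold f v s"
proof -
  have fold_closed: "fold f w s \<in> S" if "w \<in> words X" "s \<in> S" for w s
    using that by (induction w arbitrary: s) (auto intro: closed)
  show ?thesis
    using assms(1,2)
    by (induction arbitrary: s rule: pres_rel.induct) (auto simp: fold_closed cancel relator)
qed

end


section \<open>The amalgam and its factors\<close>

lemma factor_exhaust_other: "k = i \<or> k = other i"
  by (cases i; cases k) auto

lemma other_other [simp]: "other (other i) = i"
  by (cases i) auto

lemma other_neq [simp]: "other i \<noteq> i" "i \<noteq> other i"
  by (cases i; simp)+

locale amalgam =
  fixes \<A> :: "('a, 'x) amalgam"
  assumes finite_amalgam: "finite_amalgam \<A>"
begin

abbreviation "X \<equiv> gens \<A>"
abbreviation "XX \<equiv> all_gens \<A>"
abbreviation "F \<equiv> factor_group \<A>"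
abbreviation "G \<equiv> amalgam_group \<A>"
abbreviation "AA \<equiv> amalgamated \<A>"
abbreviation "\<phi> \<equiv> emb \<A>"
abbreviation fcl :: "factor \<Rightarrow> 'x word \<Rightarrow> 'x word set" where
  "fcl i \<equiv> pres_elt (X i) (rels \<A> i)"
abbreviation "el \<equiv> elt \<A>"

sublocale fp: presentation "X i" "rels \<A> i" for i
  using finite_amalgam by unfold_locales (auto simp: finite_amalgam_def)

lemma group_factor: "group (F i)"
  unfolding factor_group_def by (rule fp.group_pres)

sublocale F: group "F i" for i
  by (rule group_factor)

sublocale A: group AA
  using finite_amalgam by (simp add: finite_amalgam_def)

lemma finite_F: "finite (carrier (F i))"
  using finite_amalgam by (auto simp: finite_amalgam_def)

lemma finite_gens: "finite (X i)"
  using finite_amalgam by (auto simp: finite_amalgam_def)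

lemma gens_disjoint: "x \<in> X i \<Longrightarrow> x \<notin> X (other i)"
  using finite_amalgam by (cases i) (auto simp: finite_amalgam_def)

lemma letters_disjoint: "x \<in> letters (X i) \<Longrightarrow> x \<notin> letters (X (other i))"
  using gens_disjoint by (auto simp: letters_def)

lemma hom_\<phi>: "\<phi> i \<in> hom AA (F i)"
  using finite_amalgam by (auto simp: finite_amalgam_def)

lemma inj_\<phi>: "inj_on (\<phi> i) (carrier AA)"
  using finite_amalgam by (auto simp: finite_amalgam_def)

sublocale \<phi>: group_hom AA "F i" "\<phi> i" for i
  by (simp add: group_hom_def group_hom_axioms_def hom_\<phi> A.is_group F.is_group)

lemma gens_subset: "X i \<subseteq> XX"
  by (cases i) (auto simp: all_gens_def)

lemma XX_letters: "x \<in> letters XX \<longleftrightarrow> (\<exists>i. x \<in> letters (X i))"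
  by (auto simp: letters_def all_gens_def) (metis factor.exhaust)

lemma words_XX: "w \<in> words (X i) \<Longrightarrow> w \<in> words XX"
  using gens_subset words_mono by blast

lemma fcarrier: "carrier (F i) = fcl i ` words (X i)"
  unfolding factor_group_def by (rule fp.carrier_pres)

lemma fone: "\<one>\<^bsub>F i\<^esub> = fcl i []"
  unfolding factor_group_def by (rule fp.one_pres)

lemma fmult: "u \<in> words (X i) \<Longrightarrow> v \<in> words (X i) \<Longrightarrow> fcl i u \<otimes>\<^bsub>F i\<^esub> fcl i v = fcl i (u @ v)"
  unfolding factor_group_def by (rule fp.mult_cl)

lemma finv: "u \<in> words (X i) \<Longrightarrow> fcl i (winv u) = inv\<^bsub>F i\<^esub> (fcl i u)"
  unfolding factor_group_def by (rule fp.cl_winv)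

lemma fcl_closed [simp]: "w \<in> words (X i) \<Longrightarrow> fcl i w \<in> carrier (F i)"
  by (auto simp: fcarrier)

lemma fcl_of_mem: "g \<in> carrier (F i) \<Longrightarrow> w \<in> g \<Longrightarrow> w \<in> words (X i) \<and> g = fcl i w"
  unfolding factor_group_def by (rule fp.cl_of_mem)

lemma fmem_self: "w \<in> words (X i) \<Longrightarrow> w \<in> fcl i w"
  by (rule fp.self_mem_cl)

lemma ex_fword: "g \<in> carrier (F i) \<Longrightarrow> \<exists>w. w \<in> g \<and> w \<in> words (X i) \<and> g = fcl i w"
  unfolding factor_group_def by (rule fp.ex_word)

lemma \<phi>_word: "a \<in> carrier AA \<Longrightarrow> w \<in> \<phi> i a \<Longrightarrow> w \<in> words (X i) \<and> fcl i w = \<phi> i a"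
  using fcl_of_mem \<phi>.hom_closed by metis

lemma ex_\<phi>_word: "a \<in> carrier AA \<Longrightarrow> \<exists>w. w \<in> \<phi> i a"
  using ex_fword \<phi>.hom_closed by metis

sublocale gp: presentation XX "all_rels \<A>"
proof
  have "u @ winv v \<in> words XX"
    if "a \<in> carrier AA" "u \<in> \<phi> First a" "v \<in> \<phi> Second a" for u v a
    using that \<phi>_word words_XX by (metis words_simps(3) winv_words)
  moreover have "rels \<A> i \<subseteq> words XX" for i
    using fp.rels_words words_XX by blast
  ultimately show "all_rels \<A> \<subseteq> words XX"
    unfolding all_rels_def by blast
qed

sublocale G: group G
  unfolding amalgam_group_def by (rule gp.group_pres)

lemma rels_subset: "rels \<A> i \<subseteq> all_rels \<A>"
  by (cases i) (auto simp: all_rels_def)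

lemma elt_mult: "u \<in> words XX \<Longrightarrow> v \<in> words XX \<Longrightarrow> el u \<otimes>\<^bsub>G\<^esub> el v = el (u @ v)"
  unfolding amalgam_group_def elt_def by (rule gp.mult_cl)

lemma elt_one: "\<one>\<^bsub>G\<^esub> = el []"
  unfolding amalgam_group_def elt_def by (rule gp.one_pres)

lemma elt_inv: "u \<in> words XX \<Longrightarrow> el (winv u) = inv\<^bsub>G\<^esub> (el u)"
  unfolding amalgam_group_def elt_def by (rule gp.cl_winv)

lemma gcarrier: "carrier G = el ` words XX"
  unfolding amalgam_group_def elt_def by (rule gp.carrier_pres)

lemma elt_closed [simp]: "w \<in> words XX \<Longrightarrow> el w \<in> carrier G"
  by (auto simp: gcarrier)

lemma elt_factor_eq:
  assumes "u \<in> words (X i)" "v \<in> words (X i)" "fcl i u = fcl i v"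
  shows "el u = el v"
proof -
  have "(u, v) \<in> pres_rel (X i) (rels \<A> i)"
    using assms fp.cl_eq_iff by blast
  then show ?thesis
    unfolding elt_def
    using pres_rel_mono[OF _ gens_subset rels_subset] by (intro gp.cl_eqI) blast
qed

lemma elt_winv_cancel [simp]: "w \<in> words XX \<Longrightarrow> el (w @ winv w) = \<one>\<^bsub>G\<^esub>"
  unfolding elt_one elt_def by (intro gp.cl_eqI gp.pres_rel_winv)

lemma elt_\<phi>_First_Second:
  assumes "a \<in> carrier AA" "u \<in> \<phi> First a" "v \<in> \<phi> Second a"
  shows "el u = el v"
proof -
  have w: "u \<in> words XX" "v \<in> words XX"
    using assms \<phi>_word words_XX by blast+
  have "([] @ (u @ winv v) @ [], [] @ []) \<in> pres_rel XX (all_rels \<A>)"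
    using assms by (intro pres_rel.relator) (auto simp: all_rels_def)
  then have "el (u @ winv v) = \<one>\<^bsub>G\<^esub>"
    unfolding elt_one elt_def by (intro gp.cl_eqI) simp
  then have "el u \<otimes>\<^bsub>G\<^esub> inv\<^bsub>G\<^esub> (el v) = \<one>\<^bsub>G\<^esub>"
    using w by (simp add: elt_mult[symmetric] elt_inv)
  then have "inv\<^bsub>G\<^esub> (inv\<^bsub>G\<^esub> (el v)) = el u"
    using w by (intro G.inv_equality) auto
  then show ?thesis
    using w by simp
qed

lemma elt_\<phi>:
  assumes "a \<in> carrier AA" "u \<in> \<phi> i a" "v \<in> \<phi> k a"
  shows "el u = el v"
proof (cases "i = k")
  case True
  then show ?thesis
    using assms \<phi>_word elt_factor_eq by metis
next
  case False
  then show ?thesis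
    using assms elt_\<phi>_First_Second by (cases i; cases k) force+
qed

lemma A_in_G_iff: "g \<in> A_in_G \<A> \<longleftrightarrow> (\<exists>a w. a \<in> carrier AA \<and> w \<in> \<phi> i a \<and> g = el w)"
proof
  assume "g \<in> A_in_G \<A>"
  then obtain a w where a: "a \<in> carrier AA" "w \<in> \<phi> First a" "g = el w"
    by (auto simp: A_in_G_def)
  obtain v where "v \<in> \<phi> i a"
    using ex_\<phi>_word a(1) by blast
  then show "\<exists>a w. a \<in> carrier AA \<and> w \<in> \<phi> i a \<and> g = el w"
    using elt_\<phi>[OF a(1,2)] a by metis
next
  assume "\<exists>a w. a \<in> carrier AA \<and> w \<in> \<phi> i a \<and> g = el w"
  then obtain a w where a: "a \<in> carrier AA" "w \<in> \<phi> i a" "g = el w"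
    by blast
  obtain v where "v \<in> \<phi> First a"
    using ex_\<phi>_word a(1) by blast
  then show "g \<in> A_in_G \<A>"
    using elt_\<phi>[OF a(1,2)] a unfolding A_in_G_def by blast
qed

text \<open>The natural homomorphism from the factor \<open>i\<close> into the amalgam. Elements of a factor are sets of
  words, and by \<open>gel_eq\<close> the choice of the word does not matter.\<close>

definition gel :: "factor \<Rightarrow> 'x word set \<Rightarrow> 'x word set" where
  "gel i g = el (SOME w. w \<in> g)"

lemma gel_eq: "g \<in> carrier (F i) \<Longrightarrow> w \<in> g \<Longrightarrow> gel i g = el w"
  unfolding gel_def using fcl_of_mem elt_factor_eq by (metis someI)

lemma gel_fcl: "w \<in> words (X i) \<Longrightarrow> gel i (fcl i w) = el w"
  by (rule gel_eq) (auto intro: fmem_self)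

lemma gel_hom: "group_hom (F i) G (gel i)"
proof -
  have "gel i \<in> hom (F i) G"
    by (rule homI) (auto simp: fcarrier gel_fcl fmult words_XX elt_mult)
  then show ?thesis
    by (simp add: group_hom_def group_hom_axioms_def F.is_group G.is_group)
qed

sublocale gel: group_hom "F i" G "gel i" for i
  by (rule gel_hom)

lemma gel_\<phi>: "a \<in> carrier AA \<Longrightarrow> gel i (\<phi> i a) = gel k (\<phi> k a)"
  using ex_\<phi>_word elt_\<phi> gel_eq \<phi>.hom_closed by metis

end

section \<open>Extending partial actions of the factors to the amalgam\<close>

context amalgam
begin

abbreviation AF :: "factor \<Rightarrow> 'x word set set" where
  "AF i \<equiv> A_in_factor \<A> i"

lemma AF_image: "AF i = \<phi> i ` carrier AA"
  by (simp add: A_in_factor_def)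

lemma subgroup_AF: "subgroup (AF i) (F i)"
  unfolding AF_image by (rule \<phi>.img_is_subgroup)

lemma \<phi>_mem_AF [simp]: "a \<in> carrier AA \<Longrightarrow> \<phi> i a \<in> AF i"
  by (auto simp: AF_image)

lemma AF_carrier: "g \<in> AF i \<Longrightarrow> g \<in> carrier (F i)"
  by (auto simp: AF_image)

text \<open>Every element of a factor is written uniquely as \<open>\<phi> i a \<otimes> t\<close> with \<open>a\<close> in \<open>A\<close> and \<open>t\<close> in a
  fixed right transversal of \<open>A\<close> that contains the unit. Here \<open>tr i\<close> picks \<open>t\<close> and \<open>ap i\<close> picks
  \<open>a\<close>.\<close>

definition tr :: "factor \<Rightarrow> 'x word set \<Rightarrow> 'x word set" where
  "tr i g = (if g \<in> AF i then \<one>\<^bsub>F i\<^esub> else (SOME t. t \<in> AF i #>\<^bsub>F i\<^esub> g))"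

definition ap :: "factor \<Rightarrow> 'x word set \<Rightarrow> 'a" where
  "ap i g = inv_into (carrier AA) (\<phi> i) (g \<otimes>\<^bsub>F i\<^esub> inv\<^bsub>F i\<^esub> tr i g)"

lemma AF_mult_iff:
  assumes "a \<in> carrier AA" "g \<in> carrier (F i)"
  shows "\<phi> i a \<otimes>\<^bsub>F i\<^esub> g \<in> AF i \<longleftrightarrow> g \<in> AF i"
proof
  assume "\<phi> i a \<otimes>\<^bsub>F i\<^esub> g \<in> AF i"
  then have "inv\<^bsub>F i\<^esub> (\<phi> i a) \<otimes>\<^bsub>F i\<^esub> (\<phi> i a \<otimes>\<^bsub>F i\<^esub> g) \<in> AF i"
    using assms subgroup_AF by (meson \<phi>_mem_AF subgroup.m_closed subgroup.m_inv_closed)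
  then show "g \<in> AF i"
    using assms by (simp add: F.m_assoc[symmetric])
qed (use assms subgroup_AF in \<open>simp add: subgroup.m_closed\<close>)

lemma coset_AF_mult:
  assumes "a \<in> carrier AA" "g \<in> carrier (F i)"
  shows "AF i #>\<^bsub>F i\<^esub> (\<phi> i a \<otimes>\<^bsub>F i\<^esub> g) = AF i #>\<^bsub>F i\<^esub> g"
  using assms subgroup_AF
  by (metis F.coset_join2 F.coset_mult_assoc \<phi>.hom_closed \<phi>_mem_AF subgroup.subset)

lemma tr_mem_coset:
  assumes "g \<in> carrier (F i)"
  shows "tr i g \<in> AF i #>\<^bsub>F i\<^esub> g"
proof (cases "g \<in> AF i")
  case True
  then have "AF i #>\<^bsub>F i\<^esub> g = AF i"
    using assms subgroup_AF F.coset_join2 by blast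
  then show ?thesis
    using True subgroup_AF by (simp add: tr_def subgroup.one_closed)
next
  case False
  then show ?thesis
    using F.rcos_self[OF assms subgroup_AF] by (auto simp: tr_def intro: someI)
qed

lemma tr_ap:
  assumes "g \<in> carrier (F i)"
  shows "tr i g \<in> carrier (F i)" "ap i g \<in> carrier AA" "g = \<phi> i (ap i g) \<otimes>\<^bsub>F i\<^esub> tr i g"
proof -
  obtain a where a: "a \<in> carrier AA" "tr i g = \<phi> i a \<otimes>\<^bsub>F i\<^esub> g"
    using tr_mem_coset[OF assms] by (auto simp: r_coset_def AF_image)
  then have t: "tr i g \<in> carrier (F i)"
    using assms by simp
  have "g \<otimes>\<^bsub>F i\<^esub> inv\<^bsub>F i\<^esub> tr i g = inv\<^bsub>F i\<^esub> \<phi> i a"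
    using a assms by (simp add: F.inv_mult_group F.m_assoc[symmetric])
  also have "\<dots> = \<phi> i (inv\<^bsub>AA\<^esub> a)"
    using a by simp
  finally have eq: "g \<otimes>\<^bsub>F i\<^esub> inv\<^bsub>F i\<^esub> tr i g = \<phi> i (inv\<^bsub>AA\<^esub> a)" .
  then have ap: "ap i g = inv\<^bsub>AA\<^esub> a"
    unfolding ap_def eq using a inj_\<phi> by (intro inv_into_f_f) auto
  show "tr i g \<in> carrier (F i)" "ap i g \<in> carrier AA"
    using t ap a by auto
  show "g = \<phi> i (ap i g) \<otimes>\<^bsub>F i\<^esub> tr i g"
    unfolding ap eq[symmetric] using t assms by (simp add: F.m_assoc)
qed

lemmas tr_closed [simp] = tr_ap(1)
lemmas ap_closed [simp] = tr_ap(2)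
lemmas tr_ap_eq = tr_ap(3)

lemma tr_mult [simp]:
  assumes "a \<in> carrier AA" "g \<in> carrier (F i)"
  shows "tr i (\<phi> i a \<otimes>\<^bsub>F i\<^esub> g) = tr i g"
  using assms by (simp add: tr_def AF_mult_iff coset_AF_mult)

lemma ap_unique:
  assumes "a \<in> carrier AA" "b \<in> carrier AA" "t \<in> carrier (F i)"
    and "\<phi> i a \<otimes>\<^bsub>F i\<^esub> t = \<phi> i b \<otimes>\<^bsub>F i\<^esub> t"
  shows "a = b"
proof -
  have "\<phi> i a = \<phi> i b"
    using assms by simp
  then show ?thesis
    using inj_\<phi> assms inj_onD by metis
qed

lemma ap_mult [simp]:
  assumes "a \<in> carrier AA" "g \<in> carrier (F i)"
  shows "ap i (\<phi> i a \<otimes>\<^bsub>F i\<^esub> g) = a \<otimes>\<^bsub>AA\<^esub> ap i g"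
proof (rule ap_unique[of _ _ "tr i g"])
  have "\<phi> i (ap i (\<phi> i a \<otimes>\<^bsub>F i\<^esub> g)) \<otimes>\<^bsub>F i\<^esub> tr i g = \<phi> i a \<otimes>\<^bsub>F i\<^esub> g"
    using tr_ap_eq[of "\<phi> i a \<otimes>\<^bsub>F i\<^esub> g" i] assms by simp
  also have "\<dots> = \<phi> i a \<otimes>\<^bsub>F i\<^esub> (\<phi> i (ap i g) \<otimes>\<^bsub>F i\<^esub> tr i g)"
    using tr_ap_eq assms by metis
  also have "\<dots> = \<phi> i (a \<otimes>\<^bsub>AA\<^esub> ap i g) \<otimes>\<^bsub>F i\<^esub> tr i g"
    using assms by (simp add: F.m_assoc)
  finally show "\<phi> i (ap i (\<phi> i a \<otimes>\<^bsub>F i\<^esub> g)) \<otimes>\<^bsub>F i\<^esub> tr i g = \<phi> i (a \<otimes>\<^bsub>AA\<^esub> ap i g) \<otimes>\<^bsub>F i\<^esub> tr i g" .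
qed (use assms in auto)

lemma tr_tr [simp]: "g \<in> carrier (F i) \<Longrightarrow> tr i (tr i g) = tr i g"
  by (metis ap_closed tr_ap_eq tr_closed tr_mult)

lemma ap_eq_one:
  assumes "t \<in> carrier (F i)" "tr i t = t"
  shows "ap i t = \<one>\<^bsub>AA\<^esub>"
proof -
  have "\<phi> i (ap i t) \<otimes>\<^bsub>F i\<^esub> t = \<phi> i \<one>\<^bsub>AA\<^esub> \<otimes>\<^bsub>F i\<^esub> t"
    using tr_ap_eq[OF assms(1)] assms by simp
  then show ?thesis
    using ap_unique assms by (metis A.one_closed ap_closed)
qed

lemma tr_one_iff: "g \<in> carrier (F i) \<Longrightarrow> tr i g = \<one>\<^bsub>F i\<^esub> \<longleftrightarrow> g \<in> AF i"
  using tr_ap_eq[of g i] by (metis \<phi>_mem_AF ap_closed F.r_one \<phi>.hom_closed tr_def)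

lemma tr_\<phi> [simp]: "a \<in> carrier AA \<Longrightarrow> tr i (\<phi> i a) = \<one>\<^bsub>F i\<^esub>"
  by (simp add: tr_one_iff)

lemma tr_one [simp]: "tr i \<one>\<^bsub>F i\<^esub> = \<one>\<^bsub>F i\<^esub>"
  using tr_\<phi>[of "\<one>\<^bsub>AA\<^esub>" i] by simp

lemma ap_\<phi> [simp]: "a \<in> carrier AA \<Longrightarrow> ap i (\<phi> i a) = a"
  using ap_mult[of a "\<one>\<^bsub>F i\<^esub>" i] by (simp add: ap_eq_one)

lemma tr_assoc:
  assumes "h \<in> carrier (F i)" "g \<in> carrier (F i)"
  shows "tr i (tr i h \<otimes>\<^bsub>F i\<^esub> g) = tr i (h \<otimes>\<^bsub>F i\<^esub> g)"
    and "ap i h \<otimes>\<^bsub>AA\<^esub> ap i (tr i h \<otimes>\<^bsub>F i\<^esub> g) = ap i (h \<otimes>\<^bsub>F i\<^esub> g)"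
proof -
  have "h \<otimes>\<^bsub>F i\<^esub> g = (\<phi> i (ap i h) \<otimes>\<^bsub>F i\<^esub> tr i h) \<otimes>\<^bsub>F i\<^esub> g"
    using tr_ap_eq[OF assms(1)] by simp
  then have eq: "h \<otimes>\<^bsub>F i\<^esub> g = \<phi> i (ap i h) \<otimes>\<^bsub>F i\<^esub> (tr i h \<otimes>\<^bsub>F i\<^esub> g)"
    using assms by (simp add: F.m_assoc)
  show "tr i (tr i h \<otimes>\<^bsub>F i\<^esub> g) = tr i (h \<otimes>\<^bsub>F i\<^esub> g)"
    "ap i h \<otimes>\<^bsub>AA\<^esub> ap i (tr i h \<otimes>\<^bsub>F i\<^esub> g) = ap i (h \<otimes>\<^bsub>F i\<^esub> g)"
    unfolding eq using assms by simp_all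
qed

text \<open>The words that represent the syllables of a normal form, with the factor of the first one as
  parameter. Normal forms of a single syllable in \<open>A\<close> are treated separately throughout.\<close>

fun alternating :: "factor \<Rightarrow> 'x word list \<Rightarrow> bool" where
  "alternating i [] \<longleftrightarrow> True"
| "alternating i (w # ws) \<longleftrightarrow>
    w \<in> words (X i) \<and> fcl i w \<notin> AF i \<and> alternating (other i) ws"

end

type_synonym ('v, 'x) state = "'v \<times> (factor \<times> 'x word set) list"

text \<open>What remains of a graph with complete components when only the endpoints of walks are kept:
  \<open>V i\<close> is the set of vertices at which factor \<open>i\<close> can be read, and the factor acts on it from the
  right.\<close>

locale precover = amalgam \<A> for \<A> :: "('a, 'x) amalgam" +
  fixes V :: "factor \<Rightarrow> 'v set"
    and act :: "factor \<Rightarrow> 'v \<Rightarrow> 'x word set \<Rightarrow> 'v"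
  assumes act_closed [simp]: "v \<in> V i \<Longrightarrow> g \<in> carrier (F i) \<Longrightarrow> act i v g \<in> V i"
    and act_one [simp]: "v \<in> V i \<Longrightarrow> act i v \<one>\<^bsub>F i\<^esub> = v"
    and act_mult: "v \<in> V i \<Longrightarrow> g \<in> carrier (F i) \<Longrightarrow> h \<in> carrier (F i) \<Longrightarrow>
      act i v (g \<otimes>\<^bsub>F i\<^esub> h) = act i (act i v g) h"
    and act_compat: "v \<in> V First \<Longrightarrow> v \<in> V Second \<Longrightarrow> a \<in> carrier AA \<Longrightarrow>
      act First v (\<phi> First a) = act Second v (\<phi> Second a)"
begin

definition aact :: "'v \<Rightarrow> 'a \<Rightarrow> 'v" where
  "aact v a = (if v \<in> V First then act First v (\<phi> First a) else act Second v (\<phi> Second a))"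

lemma aact_eq: "v \<in> V i \<Longrightarrow> a \<in> carrier AA \<Longrightarrow> aact v a = act i v (\<phi> i a)"
  by (cases i) (auto simp: aact_def act_compat)

lemma aact_closed: "v \<in> V i \<Longrightarrow> a \<in> carrier AA \<Longrightarrow> aact v a \<in> V i"
  by (simp add: aact_eq)

lemma aact_mult:
  "v \<in> V i \<Longrightarrow> a \<in> carrier AA \<Longrightarrow> b \<in> carrier AA \<Longrightarrow> aact v (a \<otimes>\<^bsub>AA\<^esub> b) = aact (aact v a) b"
  by (simp add: aact_eq[of _ i] act_mult)

lemma aact_one: "v \<in> V i \<Longrightarrow> aact v \<one>\<^bsub>AA\<^esub> = v"
  by (simp add: aact_eq[of _ i])

lemma aact_mem_iff:
  assumes "v \<in> V k" "a \<in> carrier AA"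
  shows "aact v a \<in> V i \<longleftrightarrow> v \<in> V i"
proof
  assume "aact v a \<in> V i"
  then have "aact (aact v a) (inv\<^bsub>AA\<^esub> a) \<in> V i"
    using assms by (intro aact_closed[of "aact v a"]) auto
  moreover have "aact (aact v a) (inv\<^bsub>AA\<^esub> a) = v"
    using assms by (simp add: aact_mult[of v k, symmetric] aact_one[of v k])
  ultimately show "v \<in> V i"
    by simp
qed (use assms aact_closed in auto)

text \<open>
  Van der Waerden's construction of an action of the whole amalgam. A state \<open>(v, s)\<close> consists of
  a vertex \<open>v\<close> and a stack \<open>s\<close> of transversal elements, the last one on top, that alternate
  between the factors; the stack records how far a word has left the pre-cover at \<open>v\<close>.
  If factor \<open>i\<close> is free at a state, an element of it outside \<open>A\<close> pushes its transversal part.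
\<close>

fun free :: "factor \<Rightarrow> ('v, 'x) state \<Rightarrow> bool" where
  "free i (v, []) \<longleftrightarrow> v \<notin> V i"
| "free i (v, (k, t) # s) \<longleftrightarrow> k \<noteq> i"

fun valid :: "('v, 'x) state \<Rightarrow> bool" where
  "valid (v, []) \<longleftrightarrow> (\<exists>k. v \<in> V k)"
| "valid (v, (i, t) # s) \<longleftrightarrow>
    valid (v, s) \<and> free i (v, s) \<and> t \<in> carrier (F i) \<and> tr i t = t \<and> t \<noteq> \<one>\<^bsub>F i\<^esub>"

definition push :: "factor \<Rightarrow> 'x word set \<Rightarrow> ('v, 'x) state \<Rightarrow> ('v, 'x) state" where
  "push i t \<omega> = (if t = \<one>\<^bsub>F i\<^esub> then \<omega> else (fst \<omega>, (i, t) # snd \<omega>))"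

text \<open>\<open>A\<close> acts on a state by moving an element of \<open>A\<close> down the stack. Behind each transversal element
  \<open>t\<close> it is replaced by the \<open>A\<close>-part of \<open>t \<otimes> \<phi> i a\<close>, until it reaches the vertex.\<close>

fun sact :: "('v, 'x) state \<Rightarrow> 'a \<Rightarrow> ('v, 'x) state" where
  "sact (v, []) a = (aact v a, [])"
| "sact (v, (i, t) # s) a =
    (let g = t \<otimes>\<^bsub>F i\<^esub> \<phi> i a; \<omega> = sact (v, s) (ap i g) in (fst \<omega>, (i, tr i g) # snd \<omega>))"

text \<open>The action of factor \<open>i\<close> is an induced one: the states on which it does not act already in the
  pre-cover are the pairs of a state at which \<open>i\<close> is free and a transversal element.\<close>

fun state_act :: "factor \<Rightarrow> ('v, 'x) state \<Rightarrow> 'x word set \<Rightarrow> ('v, 'x) state" where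
  "state_act i (v, []) g =
    (if v \<in> V i then (act i v g, []) else push i (tr i g) (sact (v, []) (ap i g)))"
| "state_act i (v, (k, t) # s) g =
    (if k = i then push i (tr i (t \<otimes>\<^bsub>F i\<^esub> g)) (sact (v, s) (ap i (t \<otimes>\<^bsub>F i\<^esub> g)))
     else push i (tr i g) (sact (v, (k, t) # s) (ap i g)))"

lemma free_sact:
  assumes "valid \<omega>" "a \<in> carrier AA"
  shows "free i (sact \<omega> a) = free i \<omega>"
proof (cases "(i, \<omega>)" rule: free.cases)
  case (1 i v)
  then show ?thesis
    using assms aact_mem_iff by auto
qed (auto simp: Let_def)

lemma length_sact [simp]: "length (snd (sact \<omega> a)) = length (snd \<omega>)"
  by (induction \<omega> a rule: sact.induct) (auto simp: Let_def)

lemma sact_valid: "valid \<omega> \<Longrightarrow> a \<in> carrier AA \<Longrightarrow> valid (sact \<omega> a)"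
proof (induction \<omega> a rule: sact.induct)
  case (1 v a)
  then show ?case
    using aact_closed by auto
next
  case (2 v i t s a)
  define g where "g = t \<otimes>\<^bsub>F i\<^esub> \<phi> i a"
  have g: "g \<in> carrier (F i)" "t \<in> carrier (F i)"
    using 2 by (auto simp: g_def)
  have valid: "valid (sact (v, s) (ap i g))" "free i (sact (v, s) (ap i g))"
    using 2 g free_sact by (auto simp: g_def)
  have "tr i g \<noteq> \<one>\<^bsub>F i\<^esub>"
  proof
    assume "tr i g = \<one>\<^bsub>F i\<^esub>"
    then obtain b where b: "b \<in> carrier AA" "g = \<phi> i b"
      using g by (auto simp: tr_one_iff AF_image)
    have "t = g \<otimes>\<^bsub>F i\<^esub> inv\<^bsub>F i\<^esub> \<phi> i a"
      using g 2(3) by (simp add: g_def F.m_assoc)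
    then have "t = \<phi> i (b \<otimes>\<^bsub>AA\<^esub> inv\<^bsub>AA\<^esub> a)"
      using b 2(3) by simp
    then have "tr i t = \<one>\<^bsub>F i\<^esub>"
      using b 2(3) by (simp only: tr_\<phi> A.m_closed A.inv_closed)
    then show False
      using 2(2) by (metis valid.simps(2))
  qed
  then show ?case
    using valid g by (auto simp: Let_def g_def[symmetric])
qed

lemma sact_one: "valid \<omega> \<Longrightarrow> sact \<omega> \<one>\<^bsub>AA\<^esub> = \<omega>"
proof (induction \<omega> "\<one>\<^bsub>AA\<^esub>" rule: sact.induct)
  case (1 v)
  then show ?case
    using aact_one by auto
next
  case (2 v i t s)
  then show ?case
    by (auto simp: Let_def ap_eq_one)
qed

lemma sact_mult:
  "valid \<omega> \<Longrightarrow> a \<in> carrier AA \<Longrightarrow> b \<in> carrier AA \<Longrightarrow> sact (sact \<omega> a) b = sact \<omega> (a \<otimes>\<^bsub>AA\<^esub> b)"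
proof (induction \<omega> a arbitrary: b rule: sact.induct)
  case (1 v a)
  then show ?case
    using aact_mult by auto
next
  case (2 v i t s a)
  define g where "g = t \<otimes>\<^bsub>F i\<^esub> \<phi> i a"
  have g: "g \<in> carrier (F i)" "t \<in> carrier (F i)"
    using 2 by (auto simp: g_def)
  have gb: "t \<otimes>\<^bsub>F i\<^esub> \<phi> i (a \<otimes>\<^bsub>AA\<^esub> b) = g \<otimes>\<^bsub>F i\<^esub> \<phi> i b"
    using g 2 by (simp add: g_def F.m_assoc)
  show ?case
    using 2 g tr_assoc[of g i "\<phi> i b"]
    by (simp add: Let_def gb g_def[symmetric] del: \<phi>.hom_mult)
qed

lemma push_valid:
  "valid \<omega> \<Longrightarrow> free i \<omega> \<Longrightarrow> t \<in> carrier (F i) \<Longrightarrow> tr i t = t \<Longrightarrow> valid (push i t \<omega>)"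
  by (cases \<omega>) (auto simp: push_def)

text \<open>The defining property of the induced action. Together with \<open>valid_cases\<close> it reduces all laws to
  computations with \<open>tr\<close> and \<open>ap\<close>.\<close>

lemma state_act_push:
  assumes "valid \<omega>" "free i \<omega>" "t \<in> carrier (F i)" "tr i t = t" "g \<in> carrier (F i)"
  shows "state_act i (push i t \<omega>) g = push i (tr i (t \<otimes>\<^bsub>F i\<^esub> g)) (sact \<omega> (ap i (t \<otimes>\<^bsub>F i\<^esub> g)))"
  using assms by (cases "(i, \<omega>)" rule: free.cases) (auto simp: push_def)

lemma valid_cases:
  assumes "valid \<omega>"
  obtains v where "\<omega> = (v, [])" "v \<in> V i"
  | \<omega>' t where "\<omega> = push i t \<omega>'" "valid \<omega>'" "free i \<omega>'" "t \<in> carrier (F i)" "tr i t = t"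
proof (cases "(i, \<omega>)" rule: free.cases)
  case (1 k v)
  then show ?thesis
    using assms that(1)[of v] that(2)[of "\<one>\<^bsub>F i\<^esub>" \<omega>] by (auto simp: push_def)
next
  case (2 j v k t s)
  then show ?thesis
    using assms that(2)[of t "(v, s)"] that(2)[of "\<one>\<^bsub>F i\<^esub>" \<omega>] by (cases "k = i") (auto simp: push_def)
qed

lemma state_act_valid: "valid \<omega> \<Longrightarrow> g \<in> carrier (F i) \<Longrightarrow> valid (state_act i \<omega> g)"
proof (erule valid_cases[of _ i], goal_cases)
  case (1 v)
  then show ?case
    by (auto intro!: exI[of _ i])
next
  case (2 \<omega>' t)
  then show ?case
    by (auto simp: state_act_push sact_valid free_sact intro!: push_valid)
qed

lemma state_act_one: "valid \<omega> \<Longrightarrow> state_act i \<omega> \<one>\<^bsub>F i\<^esub> = \<omega>"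
  by (erule valid_cases[of _ i]) (auto simp: state_act_push sact_one ap_eq_one)

lemma state_act_mult:
  "valid \<omega> \<Longrightarrow> g \<in> carrier (F i) \<Longrightarrow> h \<in> carrier (F i) \<Longrightarrow>
    state_act i (state_act i \<omega> g) h = state_act i \<omega> (g \<otimes>\<^bsub>F i\<^esub> h)"
  by (erule valid_cases[of _ i])
    (auto simp: state_act_push sact_valid free_sact act_mult sact_mult tr_assoc F.m_assoc[symmetric])

lemma state_act_\<phi>: "valid \<omega> \<Longrightarrow> a \<in> carrier AA \<Longrightarrow> state_act i \<omega> (\<phi> i a) = sact \<omega> a"
proof (erule valid_cases[of _ i], goal_cases)
  case (1 v)
  then show ?case
    by (simp add: aact_eq)
next
  case (2 \<omega>' t)
  then show ?case
  proof (cases "t = \<one>\<^bsub>F i\<^esub>")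
    case False
    then have "valid (push i t \<omega>')"
      using 2 push_valid by blast
    then have "valid (sact (push i t \<omega>') a)"
      using 2 sact_valid by blast
    then have "tr i (t \<otimes>\<^bsub>F i\<^esub> \<phi> i a) \<noteq> \<one>\<^bsub>F i\<^esub>"
      using False by (cases \<omega>') (auto simp: push_def Let_def)
    then show ?thesis
      using 2 False state_act_push[of \<omega>' i t "\<phi> i a"] by (cases \<omega>') (auto simp: push_def Let_def)
  qed (simp add: push_def, use state_act_push[of \<omega>' i "\<one>\<^bsub>F i\<^esub>" "\<phi> i a"] in \<open>simp add: push_def\<close>)
qed

definition step :: "'x letter \<Rightarrow> ('v, 'x) state \<Rightarrow> ('v, 'x) state" where
  "step x \<omega> = state_act (factor_of_letter \<A> x) \<omega> (fcl (factor_of_letter \<A> x) [x])"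

abbreviation run :: "'x word \<Rightarrow> ('v, 'x) state \<Rightarrow> ('v, 'x) state" where
  "run \<equiv> fold step"

lemma factor_of_letter_eq: "x \<in> letters (X i) \<Longrightarrow> factor_of_letter \<A> x = i"
  using letters_disjoint[of x Second] by (cases i) (auto simp: factor_of_letter_def)

lemma run_factor: "w \<in> words (X i) \<Longrightarrow> valid \<omega> \<Longrightarrow> run w \<omega> = state_act i \<omega> (fcl i w)"
proof (induction w arbitrary: \<omega>)
  case Nil
  then show ?case
    by (simp add: fone[symmetric] state_act_one)
next
  case (Cons x w)
  then have x: "fcl i [x] \<in> carrier (F i)" "fcl i w \<in> carrier (F i)"
    by auto
  have "run (x # w) \<omega> = state_act i (state_act i \<omega> (fcl i [x])) (fcl i w)"
    using Cons.prems Cons.IH[of "state_act i \<omega> (fcl i [x])"] x state_act_valid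
    by (simp add: step_def[of x] factor_of_letter_eq[of x i])
  also have "\<dots> = state_act i \<omega> (fcl i ([x] @ w))"
    using Cons x by (simp add: state_act_mult fmult)
  finally show ?case by simp
qed

text \<open>The action respects the relations of the amalgam: those of the factors because each factor acts,
  the identification of the two copies of \<open>A\<close> because both act as \<open>sact\<close> (\<open>state_act_\<phi>\<close>).\<close>

lemma run_eqI:
  assumes "el u = el v" "u \<in> words XX" "v \<in> words XX" "valid \<omega>"
  shows "run u \<omega> = run v \<omega>"
proof (rule gp.pres_rel_action[where S = "{\<omega>. valid \<omega>}"])
  show "(u, v) \<in> pres_rel XX (all_rels \<A>)"
    using assms gp.cl_eq_iff by (simp add: elt_def)
next
  fix x \<omega> assume x: "x \<in> letters XX" and "\<omega> \<in> {\<omega>. valid \<omega>}"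
  then have \<omega>: "valid \<omega>" by simp
  obtain i where i: "x \<in> letters (X i)"
    using x XX_letters by blast
  show "step x \<omega> \<in> {\<omega>. valid \<omega>}"
    using i \<omega> state_act_valid by (simp add: step_def factor_of_letter_eq[of x i])
  have "step (linv x) (step x \<omega>) = run ([x] @ winv [x]) \<omega>"
    by simp
  also have "\<dots> = state_act i \<omega> (fcl i ([x] @ winv [x]))"
    using i \<omega> by (subst run_factor) auto
  also have "fcl i ([x] @ winv [x]) = \<one>\<^bsub>F i\<^esub>"
    unfolding fone using i by (intro fp.cl_eqI fp.pres_rel_winv) auto
  finally show "step (linv x) (step x \<omega>) = \<omega>"
    using \<omega> by (simp add: state_act_one)
next
  fix r \<omega> assume r: "r \<in> all_rels \<A>" and "\<omega> \<in> {\<omega>. valid \<omega>}"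
  then have \<omega>: "valid \<omega>" by simp
  have rel: "run r \<omega> = \<omega>" if "r \<in> rels \<A> i" for i
  proof -
    have w: "r \<in> words (X i)"
      using that fp.rels_words by blast
    have "fcl i r = \<one>\<^bsub>F i\<^esub>"
      unfolding fone using pres_rel.relator[of "[]" "X i" "[]" r "rels \<A> i"] that
      by (intro fp.cl_eqI) simp
    then show ?thesis
      using w \<omega> by (simp add: run_factor state_act_one)
  qed
  have am: "run (u @ winv v) \<omega> = \<omega>"
    if "a \<in> carrier AA" "u \<in> \<phi> First a" "v \<in> \<phi> Second a" for u v a
  proof -
    have u: "u \<in> words (X First)" "fcl First u = \<phi> First a"
      and v: "v \<in> words (X Second)" "fcl Second v = \<phi> Second a"
      using that \<phi>_word by blast+
    have "run u \<omega> = sact \<omega> a"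
      using u \<omega> that by (simp add: run_factor state_act_\<phi>)
    moreover have "run (winv v) (sact \<omega> a) = state_act Second (sact \<omega> a) (\<phi> Second (inv\<^bsub>AA\<^esub> a))"
      using v \<omega> that sact_valid by (simp add: run_factor finv)
    moreover have "\<dots> = sact (sact \<omega> a) (inv\<^bsub>AA\<^esub> a)"
      using \<omega> that by (intro state_act_\<phi> sact_valid) auto
    ultimately show ?thesis
      using \<omega> that by (simp add: sact_mult sact_one)
  qed
  show "run r \<omega> = \<omega>"
    using r rel am unfolding all_rels_def by blast
qed (use assms in auto)

lemma run_valid: "w \<in> words (X i) \<Longrightarrow> valid \<omega> \<Longrightarrow> valid (run w \<omega>)"
  by (simp add: run_factor state_act_valid)

text \<open>Once a word in normal form has left the pre-cover it never comes back, since each syllable is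
  pushed and thereby makes the other factor free.\<close>

lemma run_alternating_free:
  assumes "valid \<omega>" "free i \<omega>" "alternating i ws"
  shows "length (snd (run (concat ws) \<omega>)) = length (snd \<omega>) + length ws"
  using assms
proof (induction ws arbitrary: \<omega> i)
  case (Cons w ws)
  define g where "g = fcl i w"
  have g: "g \<in> carrier (F i)" "tr i g \<noteq> \<one>\<^bsub>F i\<^esub>"
    using Cons by (auto simp: g_def tr_one_iff)
  have "run w \<omega> = push i (tr i g) (sact \<omega> (ap i g))"
    using state_act_push[of \<omega> i "\<one>\<^bsub>F i\<^esub>" g] Cons.prems g by (simp add: push_def run_factor[of w i] g_def[symmetric])
  then have eq: "run w \<omega> = (fst (sact \<omega> (ap i g)), (i, tr i g) # snd (sact \<omega> (ap i g)))"
    using g by (simp add: push_def)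
  have "length (snd (run (concat ws) (run w \<omega>))) = length (snd (run w \<omega>)) + length ws"
  proof (rule Cons.IH)
    show "valid (run w \<omega>)"
      using Cons.prems run_valid[of w i \<omega>] by simp
    show "free (other i) (run w \<omega>)"
      unfolding eq by simp
  qed (use Cons in auto)
  then show ?case
    by (simp add: eq)
qed simp

fun reads :: "'v \<Rightarrow> factor \<Rightarrow> 'x word list \<Rightarrow> bool" where
  "reads v i [] \<longleftrightarrow> True"
| "reads v i (w # ws) \<longleftrightarrow> v \<in> V i \<and> reads (act i v (fcl i w)) (other i) ws"

text \<open>Applied to elements that fix a vertex. If the word left the pre-cover at some syllable, then by
  \<open>run_alternating_free\<close> the stack would not be empty at the end.\<close>

lemma run_alternating_reads:
  assumes "v \<in> V k" "alternating i ws" "snd (run (concat ws) (v, [])) = []"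
  shows "reads v i ws"
  using assms
proof (induction ws arbitrary: v i k)
  case (Cons w ws)
  have v: "v \<in> V i"
  proof (rule ccontr)
    assume "v \<notin> V i"
    then have "length (snd (run (concat (w # ws)) (v, []))) = length (w # ws)"
      using Cons.prems run_alternating_free[of "(v, [])" i "w # ws"] by auto
    then show False
      using Cons.prems by simp
  qed
  then have "run w (v, []) = (act i v (fcl i w), [])"
    using Cons.prems run_factor[of w i "(v, [])"] by auto
  then show ?case
    using Cons.prems Cons.IH[of "act i v (fcl i w)" i "other i"] v by auto
qed simp

end

context amalgam
begin

text \<open>The factors embed in the amalgam: let the amalgam act on the extension of the regular action
  of a factor.\<close>

lemma elt_factor_inj:
  assumes "u \<in> words (X i)" "v \<in> words (X i)" "el u = el v"
  shows "fcl i u = fcl i v"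
proof -
  interpret P: precover \<A> "\<lambda>k. if k = i then carrier (F i) else {}" "\<lambda>k v g. v \<otimes>\<^bsub>F k\<^esub> g"
    by unfold_locales (auto simp: F.m_assoc split: if_splits)
  have run: "P.run w (\<one>\<^bsub>F i\<^esub>, []) = (fcl i w, [])" if "w \<in> words (X i)" for w
    using that P.run_factor[of w i "(\<one>\<^bsub>F i\<^esub>, [])"] by (auto split: if_splits)
  have "P.run u (\<one>\<^bsub>F i\<^esub>, []) = P.run v (\<one>\<^bsub>F i\<^esub>, [])"
    using assms words_XX by (intro P.run_eqI) auto
  then show ?thesis
    using assms run by simp
qed

lemma elt_one_iff: "w \<in> words (X i) \<Longrightarrow> el w = \<one>\<^bsub>G\<^esub> \<longleftrightarrow> fcl i w = \<one>\<^bsub>F i\<^esub>"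
  unfolding fone elt_one using elt_factor_inj[of w i "[]"] elt_factor_eq[of w i "[]"] by auto

lemma elt_in_A_iff:
  assumes "w \<in> words (X i)"
  shows "el w \<in> A_in_G \<A> \<longleftrightarrow> fcl i w \<in> AF i"
proof
  assume "el w \<in> A_in_G \<A>"
  then obtain a u where u: "a \<in> carrier AA" "u \<in> \<phi> i a" "el w = el u"
    unfolding A_in_G_iff[of _ i] by blast
  then have "fcl i w = \<phi> i a"
    using elt_factor_inj[of w i u] \<phi>_word[of a u i] assms by auto
  then show "fcl i w \<in> AF i"
    using u by simp
next
  assume "fcl i w \<in> AF i"
  then obtain a where "a \<in> carrier AA" "fcl i w = \<phi> i a"
    by (auto simp: AF_image)
  then show "el w \<in> A_in_G \<A>"
    using fmem_self[OF assms] unfolding A_in_G_iff[of _ i] by metis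
qed

text \<open>The normal form theorem. Take the regular action of the factor in which the word does not
  start: then already the first syllable leaves the pre-cover.\<close>

lemma alternating_nontrivial:
  assumes "alternating i ws" "ws \<noteq> []"
  shows "el (concat ws) \<noteq> \<one>\<^bsub>G\<^esub>"
proof
  let ?k = "other i"
  interpret P: precover \<A> "\<lambda>k. if k = ?k then carrier (F ?k) else {}" "\<lambda>k v g. v \<otimes>\<^bsub>F k\<^esub> g"
    by unfold_locales (auto simp: F.m_assoc split: if_splits)
  assume "el (concat ws) = \<one>\<^bsub>G\<^esub>"
  moreover have "concat ws \<in> words XX"
    using assms(1) by (induction i ws rule: alternating.induct) (auto intro: words_XX)
  ultimately have "P.run (concat ws) (\<one>\<^bsub>F ?k\<^esub>, []) = P.run [] (\<one>\<^bsub>F ?k\<^esub>, [])"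
    by (intro P.run_eqI) (auto simp: elt_one)
  moreover have "length (snd (P.run (concat ws) (\<one>\<^bsub>F ?k\<^esub>, []))) = 0 + length ws"
    using P.run_alternating_free[of "(\<one>\<^bsub>F ?k\<^esub>, [])" i ws] assms by auto
  ultimately show False
    using assms by simp
qed

end

section \<open>Walks in labelled graphs\<close>

declare split_paired_Ex [simp del] split_paired_All [simp del]

fun walk :: "('v, 'x) lgraph \<Rightarrow> 'v \<Rightarrow> 'x word \<Rightarrow> 'v \<Rightarrow> bool" where
  "walk \<Gamma> u [] v \<longleftrightarrow> u \<in> verts \<Gamma> \<and> u = v"
| "walk \<Gamma> u (a # w) v \<longleftrightarrow> (\<exists>u'. (u, a, u') \<in> edges \<Gamma> \<and> walk \<Gamma> u' w v)"

text \<open>Walks forget the edges of a path. In a graph without folds nothing is lost, and they can be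
  compared with words directly.\<close>

lemma walk_iff_path: "walk \<Gamma> u w v \<longleftrightarrow> (\<exists>p. path \<Gamma> u p v \<and> label p = w)"
proof
  show "walk \<Gamma> u w v \<Longrightarrow> \<exists>p. path \<Gamma> u p v \<and> label p = w"
  proof (induction w arbitrary: u)
    case Nil
    then show ?case
      by (auto simp: label_def intro: exI[of _ "[]"])
  next
    case (Cons a w)
    then obtain u' where "(u, a, u') \<in> edges \<Gamma>" "walk \<Gamma> u' w v"
      by auto
    moreover from this obtain p where "path \<Gamma> u' p v" "label p = w"
      using Cons.IH by blast
    ultimately show ?case
      by (intro exI[of _ "(u, a, u') # p"]) (auto simp: label_def)
  qed
  have "path \<Gamma> u p v \<Longrightarrow> walk \<Gamma> u (label p) v" for p
  proof (induction p arbitrary: u)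
    case (Cons e p)
    then show ?case
      by (cases e) (auto simp: label_def)
  qed (simp add: label_def)
  then show "\<exists>p. path \<Gamma> u p v \<and> label p = w \<Longrightarrow> walk \<Gamma> u w v"
    by blast
qed

lemma path_walk: "path \<Gamma> u p v \<Longrightarrow> walk \<Gamma> u (label p) v"
  unfolding walk_iff_path by blast

lemma walk_in_verts:
  "wf_graph \<Gamma> \<Longrightarrow> walk \<Gamma> u w v \<Longrightarrow> u \<in> verts \<Gamma> \<and> v \<in> verts \<Gamma>"
  by (induction w arbitrary: u) (auto simp: wf_graph_def)

lemma wf_edge:
  assumes "wf_graph \<Gamma>" "(u, a, v) \<in> edges \<Gamma>"
  shows "u \<in> verts \<Gamma>" "v \<in> verts \<Gamma>" "(v, linv a, u) \<in> edges \<Gamma>"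
  using assms by (auto simp: wf_graph_def einv_def)

lemma wf_graphI:
  assumes "\<And>u a v. (u, a, v) \<in> edges \<Gamma> \<Longrightarrow>
    u \<in> verts \<Gamma> \<and> v \<in> verts \<Gamma> \<and> (v, linv a, u) \<in> edges \<Gamma>"
  shows "wf_graph \<Gamma>"
  unfolding wf_graph_def
proof
  fix e assume "e \<in> edges \<Gamma>"
  then show "ini e \<in> verts \<Gamma> \<and> ter e \<in> verts \<Gamma> \<and> einv e \<in> edges \<Gamma>"
    using assms[of "ini e" "lab e" "ter e"] by (simp add: einv_def)
qed

lemma walk_append:
  "wf_graph \<Gamma> \<Longrightarrow> walk \<Gamma> u (w @ w') v \<longleftrightarrow> (\<exists>t. walk \<Gamma> u w t \<and> walk \<Gamma> t w' v)"
  by (induction w arbitrary: u) (auto dest: walk_in_verts)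

lemma walk_snoc:
  "wf_graph \<Gamma> \<Longrightarrow> walk \<Gamma> u (w @ [a]) v \<longleftrightarrow> (\<exists>t. walk \<Gamma> u w t \<and> (t, a, v) \<in> edges \<Gamma>)"
  by (auto simp: walk_append dest: wf_edge)

lemma walk_inv: "wf_graph \<Gamma> \<Longrightarrow> walk \<Gamma> u w v \<Longrightarrow> walk \<Gamma> v (winv w) u"
proof (induction w arbitrary: u)
  case (Cons a w)
  then obtain u' where "(u, a, u') \<in> edges \<Gamma>" "walk \<Gamma> u' w v"
    by auto
  then show ?case
    using Cons by (auto simp: walk_snoc dest: wf_edge)
qed auto

lemma walk_mono:
  "walk \<Gamma> u w v \<Longrightarrow> verts \<Gamma> \<subseteq> verts \<Gamma>' \<Longrightarrow> edges \<Gamma> \<subseteq> edges \<Gamma>' \<Longrightarrow> walk \<Gamma>' u w v"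
  by (induction w arbitrary: u) auto

definition det :: "('v, 'x) lgraph \<Rightarrow> bool" where
  "det \<Gamma> \<longleftrightarrow> (\<forall>u a v v'. (u, a, v) \<in> edges \<Gamma> \<longrightarrow> (u, a, v') \<in> edges \<Gamma> \<longrightarrow> v = v')"

lemma det_walk: "det \<Gamma> \<Longrightarrow> walk \<Gamma> u w v \<Longrightarrow> walk \<Gamma> u w v' \<Longrightarrow> v = v'"
proof (induction w arbitrary: u)
  case (Cons a w)
  then obtain t t' where t: "(u, a, t) \<in> edges \<Gamma>" "walk \<Gamma> t w v"
    "(u, a, t') \<in> edges \<Gamma>" "walk \<Gamma> t' w v'"
    by auto
  then have "t' = t"
    using Cons.prems(1) unfolding det_def by metis
  then show ?case
    using t Cons.IH[OF Cons.prems(1)] by blast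
qed auto

lemma no_fold_det: "\<nexists>\<Gamma>'. fold_step \<Gamma> \<Gamma>' \<Longrightarrow> det (fst \<Gamma>)"
  unfolding det_def fold_step_def by fastforce


subsection \<open>Images of graphs\<close>

lemma map_simps [simp]:
  "verts (fst (map_pgraph f \<Gamma>)) = f ` verts (fst \<Gamma>)"
  "snd (map_pgraph f \<Gamma>) = f (snd \<Gamma>)"
  by (simp_all add: map_pgraph_def)

lemma map_edge_iff:
  "(x, a, y) \<in> edges (fst (map_pgraph f \<Gamma>)) \<longleftrightarrow>
    (\<exists>u v. x = f u \<and> y = f v \<and> (u, a, v) \<in> edges (fst \<Gamma>))"
  by (force simp: map_pgraph_def)

lemma map_edgeI:
  "(u, a, v) \<in> edges (fst \<Gamma>) \<Longrightarrow> (f u, a, f v) \<in> edges (fst (map_pgraph f \<Gamma>))"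
  by (auto simp: map_edge_iff)

lemma walk_map: "walk (fst \<Gamma>) u w v \<Longrightarrow> walk (fst (map_pgraph f \<Gamma>)) (f u) w (f v)"
  by (induction w arbitrary: u) (auto simp: map_edge_iff)

lemma wf_map:
  assumes "wf_graph (fst \<Gamma>)"
  shows "wf_graph (fst (map_pgraph f \<Gamma>))"
proof -
  have "x \<in> f ` verts (fst \<Gamma>) \<and> y \<in> f ` verts (fst \<Gamma>) \<and>
      (y, linv a, x) \<in> edges (fst (map_pgraph f \<Gamma>))"
    if "(x, a, y) \<in> edges (fst (map_pgraph f \<Gamma>))" for x a y
    using that wf_edge[OF assms] unfolding map_edge_iff by blast
  then show ?thesis
    by (intro wf_graphI) simp
qed

lemma quot_eq_iff:
  "(P \<union> P\<inverse>)\<^sup>* `` {x} = (P \<union> P\<inverse>)\<^sup>* `` {y} \<longleftrightarrow> (x, y) \<in> (P \<union> P\<inverse>)\<^sup>*"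
proof -
  have "sym ((P \<union> P\<inverse>)\<^sup>*)"
    by (intro sym_rtrancl sym_Un_converse)
  then have "equiv UNIV ((P \<union> P\<inverse>)\<^sup>*)"
    by (intro equivI refl_rtrancl trans_rtrancl) auto
  then show ?thesis
    by (intro eq_equiv_class_iff) auto
qed

lemma quot_class_constant:
  assumes "\<And>x y. (x, y) \<in> P \<Longrightarrow> f x = f y" "(x, y) \<in> (P \<union> P\<inverse>)\<^sup>*"
  shows "f x = f y"
  using assms(2) by (induction rule: rtrancl_induct) (use assms(1) in auto)


subsection \<open>Iterating a terminating step\<close>

lemma exhausts_invariant:
  assumes "exhausts r x y" "Q x" "\<And>x y. Q x \<Longrightarrow> r x y \<Longrightarrow> Q y"
  shows "Q y"
proof -
  have "r\<^sup>*\<^sup>* x y"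
    using assms(1) by (simp add: exhausts_def)
  then show ?thesis
    by (induction rule: rtranclp_induct) (use assms in blast)+
qed

lemma exhausts_exists:
  fixes f :: "'s \<Rightarrow> nat"
  assumes "Q x" "\<And>x y. Q x \<Longrightarrow> r x y \<Longrightarrow> Q y \<and> f y < f x"
  shows "\<exists>y. exhausts r x y"
  using assms(1)
proof (induction x rule: measure_induct_rule[of f])
  case (less x)
  show ?case
  proof (cases "\<exists>y. r x y")
    case True
    then obtain y where y: "r x y"
      by blast
    then obtain z where "exhausts r y z"
      using less assms(2) by blast
    then show ?thesis
      using y unfolding exhausts_def by (meson converse_rtranclp_into_rtranclp)
  next
    case False
    then show ?thesis
      by (auto simp: exhausts_def)
  qed
qed


section \<open>Invariants of the folding algorithm\<close>

context amalgam
begin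

definition col :: "('v, 'x) lgraph \<Rightarrow> factor \<Rightarrow> 'v set" where
  "col \<Gamma> i = {v \<in> verts \<Gamma>. \<exists>a u. (v, a, u) \<in> edges \<Gamma> \<and> a \<in> letters (X i)}"

lemma bichromatic_iff: "v \<in> bichromatic \<A> \<Gamma> \<longleftrightarrow> (\<forall>i. v \<in> col \<Gamma> i)"
proof -
  have "(\<exists>e\<in>edges \<Gamma>. ini e = v \<and> lab e \<in> letters (X i)) \<longleftrightarrow>
      (\<exists>a u. (v, a, u) \<in> edges \<Gamma> \<and> a \<in> letters (X i))" for i
    by (metis fst_conv prod.collapse snd_conv)
  then show ?thesis
    by (auto simp: bichromatic_def col_def)
qed

lemma bichromatic_iff2: "v \<in> bichromatic \<A> \<Gamma> \<longleftrightarrow> v \<in> col \<Gamma> i \<and> v \<in> col \<Gamma> (other i)"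
  unfolding bichromatic_iff using factor_exhaust_other by metis

lemma colI: "wf_graph \<Gamma> \<Longrightarrow> (v, a, u) \<in> edges \<Gamma> \<Longrightarrow> a \<in> letters (X i) \<Longrightarrow> v \<in> col \<Gamma> i \<and> u \<in> col \<Gamma> i"
  unfolding col_def mem_Collect_eq using wf_edge[of \<Gamma> v a u] linv_letters by metis

lemma col_map:
  assumes "wf_graph (fst \<Gamma>)"
  shows "col (fst (map_pgraph f \<Gamma>)) i = f ` col (fst \<Gamma>) i"
proof (intro equalityI subsetI)
  fix x assume "x \<in> col (fst (map_pgraph f \<Gamma>)) i"
  then obtain a u v where "x = f u" "(u, a, v) \<in> edges (fst \<Gamma>)" "a \<in> letters (X i)"
    unfolding col_def map_edge_iff by blast
  then show "x \<in> f ` col (fst \<Gamma>) i"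
    using colI[OF assms] by blast
next
  fix x assume "x \<in> f ` col (fst \<Gamma>) i"
  then obtain a u v where "x = f u" "u \<in> verts (fst \<Gamma>)" "(u, a, v) \<in> edges (fst \<Gamma>)" "a \<in> letters (X i)"
    unfolding col_def by blast
  then show "x \<in> col (fst (map_pgraph f \<Gamma>)) i"
    unfolding col_def map_edge_iff by auto
qed

lemma walk_col:
  assumes "wf_graph \<Gamma>" "walk \<Gamma> u w v" "w \<in> words (X i)" "w \<noteq> [] \<or> u \<in> col \<Gamma> i"
  shows "v \<in> col \<Gamma> i \<and> u \<in> col \<Gamma> i"
proof (cases w rule: rev_cases)
  case Nil
  then show ?thesis using assms by auto
next
  case (snoc w' a)
  then obtain t where "(t, a, v) \<in> edges \<Gamma>" "a \<in> letters (X i)"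
    using assms by (auto simp: walk_snoc)
  then have "v \<in> col \<Gamma> i"
    using colI[OF assms(1)] by metis
  moreover obtain b w'' where b: "w = b # w''"
    using snoc by (metis Nil_is_append_conv list.exhaust not_Cons_self2)
  then obtain s where "(u, b, s) \<in> edges \<Gamma>" "b \<in> letters (X i)"
    using assms by auto
  then have "u \<in> col \<Gamma> i"
    using colI[OF assms(1)] by metis
  ultimately show ?thesis by blast
qed

text \<open>The monochromatic component of \<open>u\<close>, described by walks with labels in one factor; by
  \<open>mono_component_eq_comp\<close> there are no others.\<close>

definition comp :: "factor \<Rightarrow> ('v, 'x) lgraph \<Rightarrow> 'v \<Rightarrow> ('v, 'x) lgraph" where
  "comp i \<Gamma> u =
    (let V = {v. \<exists>w\<in>words (X i). walk \<Gamma> u w v}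
     in \<lparr>verts = V, edges = {e \<in> edges \<Gamma>. ini e \<in> V \<and> lab e \<in> letters (X i)}\<rparr>)"

lemma comp_verts: "v \<in> verts (comp i \<Gamma> u) \<longleftrightarrow> (\<exists>w\<in>words (X i). walk \<Gamma> u w v)"
  by (simp add: comp_def Let_def)

lemma comp_edges:
  "e \<in> edges (comp i \<Gamma> u) \<longleftrightarrow> e \<in> edges \<Gamma> \<and> ini e \<in> verts (comp i \<Gamma> u) \<and> lab e \<in> letters (X i)"
  by (auto simp: comp_def Let_def)

lemma comp_self: "u \<in> verts \<Gamma> \<Longrightarrow> u \<in> verts (comp i \<Gamma> u)"
  by (auto simp: comp_verts intro: bexI[of _ "[]"])

lemma comp_step:
  assumes "wf_graph \<Gamma>" "v \<in> verts (comp i \<Gamma> u)" "(v, a, v') \<in> edges \<Gamma>" "a \<in> letters (X i)"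
  shows "v' \<in> verts (comp i \<Gamma> u)"
proof -
  obtain w where "w \<in> words (X i)" "walk \<Gamma> u w v"
    using assms by (auto simp: comp_verts)
  then have "w @ [a] \<in> words (X i)" "walk \<Gamma> u (w @ [a]) v'"
    using assms by (auto simp: walk_snoc)
  then show ?thesis
    unfolding comp_verts by blast
qed

lemma comp_walk:
  assumes "wf_graph \<Gamma>" "v \<in> verts (comp i \<Gamma> u)" "w \<in> words (X i)" "walk \<Gamma> v w v'"
  shows "walk (comp i \<Gamma> u) v w v'"
  using assms(2-)
proof (induction w arbitrary: v)
  case (Cons a w)
  then obtain t where t: "(v, a, t) \<in> edges \<Gamma>" "walk \<Gamma> t w v'"
    by auto
  then have "walk (comp i \<Gamma> u) t w v'"
    using Cons comp_step[OF assms(1)] by auto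
  then show ?case
    using t Cons by (auto simp: comp_edges)
qed simp

lemma comp_subgraph:
  assumes "wf_graph \<Gamma>"
  shows "subgraph (comp i \<Gamma> u) \<Gamma>"
proof -
  have "wf_graph (comp i \<Gamma> u)"
  proof (rule wf_graphI)
    fix v a v' assume "(v, a, v') \<in> edges (comp i \<Gamma> u)"
    then show "v \<in> verts (comp i \<Gamma> u) \<and> v' \<in> verts (comp i \<Gamma> u) \<and>
        (v', linv a, v) \<in> edges (comp i \<Gamma> u)"
      using comp_step[OF assms, of v i u a v'] wf_edge[OF assms, of v a v']
      by (simp add: comp_edges)
  qed
  moreover have "verts (comp i \<Gamma> u) \<subseteq> verts \<Gamma>"
    using walk_in_verts[OF assms] by (auto simp: comp_verts)
  ultimately show ?thesis
    by (auto simp: subgraph_def comp_edges)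
qed

lemma connected_walk:
  assumes "connected_graph C" "u \<in> verts C" "v \<in> verts C" "lab ` edges C \<subseteq> letters (X i)"
  obtains w where "walk C u w v" "w \<in> words (X i)"
proof -
  obtain w where w: "walk C u w v"
    using assms unfolding connected_graph_def walk_iff_path by blast
  have "walk C u w v \<Longrightarrow> w \<in> words (X i)" for u
  proof (induction w arbitrary: u)
    case (Cons a w)
    then show ?case
      using assms(4) by (force simp: image_subset_iff)
  qed simp
  then show ?thesis
    using w that by blast
qed

lemma mono_connected_subset_comp:
  assumes "mono_connected (X i) \<Gamma> D" "u \<in> verts D"
  shows "verts D \<subseteq> verts (comp i \<Gamma> u)" "edges D \<subseteq> edges (comp i \<Gamma> u)"
proof -
  have D: "subgraph D \<Gamma>" "connected_graph D" "lab ` edges D \<subseteq> letters (X i)"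
    using assms by (auto simp: mono_connected_def)
  show verts: "verts D \<subseteq> verts (comp i \<Gamma> u)"
  proof
    fix v assume "v \<in> verts D"
    then obtain w where "walk D u w v" "w \<in> words (X i)"
      using connected_walk[OF D(2) assms(2) _ D(3)] by blast
    then show "v \<in> verts (comp i \<Gamma> u)"
      using D unfolding comp_verts subgraph_def by (meson walk_mono)
  qed
  show "edges D \<subseteq> edges (comp i \<Gamma> u)"
  proof
    fix e assume "e \<in> edges D"
    then show "e \<in> edges (comp i \<Gamma> u)"
      using D verts unfolding comp_edges subgraph_def wf_graph_def by blast
  qed
qed

lemma comp_mono_connected:
  assumes "wf_graph \<Gamma>" "u \<in> col \<Gamma> i"
  shows "mono_connected (X i) \<Gamma> (comp i \<Gamma> u)"
proof -
  obtain a v where e: "(u, a, v) \<in> edges \<Gamma>" "a \<in> letters (X i)" "u \<in> verts \<Gamma>"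
    using assms by (auto simp: col_def)
  then have "edges (comp i \<Gamma> u) \<noteq> {}"
    using comp_self[of u \<Gamma> i] comp_edges[of "(u, a, v)"] by auto
  moreover have "connected_graph (comp i \<Gamma> u)"
    unfolding connected_graph_def
  proof (intro ballI)
    fix v v' assume v: "v \<in> verts (comp i \<Gamma> u)" "v' \<in> verts (comp i \<Gamma> u)"
    then obtain w w' where w: "w \<in> words (X i)" "walk \<Gamma> u w v" "w' \<in> words (X i)" "walk \<Gamma> u w' v'"
      unfolding comp_verts by blast
    then have "walk \<Gamma> v (winv w @ w') v'"
      using walk_inv[OF assms(1)] by (auto simp: walk_append[OF assms(1)])
    then have "walk (comp i \<Gamma> u) v (winv w @ w') v'"
      using comp_walk[OF assms(1) v(1)] w by simp
    then show "\<exists>p. path (comp i \<Gamma> u) v p v'"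
      by (auto simp: walk_iff_path)
  qed
  ultimately show ?thesis
    using comp_subgraph[OF assms(1)] by (auto simp: mono_connected_def comp_edges)
qed

lemma comp_mono_component:
  assumes "wf_graph \<Gamma>" "u \<in> col \<Gamma> i"
  shows "mono_component (X i) \<Gamma> (comp i \<Gamma> u)"
  unfolding mono_component_def
proof (intro conjI allI impI)
  show "mono_connected (X i) \<Gamma> (comp i \<Gamma> u)"
    using assms by (rule comp_mono_connected)
  fix D assume D: "mono_connected (X i) \<Gamma> D \<and> subgraph (comp i \<Gamma> u) D"
  then have "u \<in> verts D"
    using assms comp_self[of u \<Gamma> i] by (auto simp: subgraph_def col_def)
  then have "verts D \<subseteq> verts (comp i \<Gamma> u)" "edges D \<subseteq> edges (comp i \<Gamma> u)"
    using mono_connected_subset_comp[OF conjunct1[OF D]] by auto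
  then show "D = comp i \<Gamma> u"
    using D by (intro lgraph.equality) (auto simp: subgraph_def)
qed

lemma mono_component_eq_comp:
  assumes "wf_graph \<Gamma>" "mono_component (X i) \<Gamma> C" "u \<in> verts C"
  shows "C = comp i \<Gamma> u" "u \<in> col \<Gamma> i"
proof -
  have C: "mono_connected (X i) \<Gamma> C" "subgraph C \<Gamma>" "connected_graph C" "wf_graph C"
      "lab ` edges C \<subseteq> letters (X i)"
    and max: "\<And>D. mono_connected (X i) \<Gamma> D \<Longrightarrow> subgraph C D \<Longrightarrow> D = C"
    using assms(2) by (auto simp: mono_component_def mono_connected_def subgraph_def)
  obtain x a y where e: "(x, a, y) \<in> edges C"
    using C(1) by (fastforce simp: mono_connected_def)
  then have a: "a \<in> letters (X i)" "x \<in> verts C" "(x, a, y) \<in> edges \<Gamma>"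
    using C(2,5) wf_edge[OF C(4) e] imageI[OF e, of lab] by (auto simp: subgraph_def)
  obtain w where w: "walk C x w u" "w \<in> words (X i)"
    using connected_walk[OF C(3) a(2) assms(3) C(5)] .
  then have "walk \<Gamma> x w u"
    using C(2) walk_mono by (auto simp: subgraph_def)
  then show u: "u \<in> col \<Gamma> i"
    using walk_col[OF assms(1) _ w(2)] colI[OF assms(1) a(3,1)] by simp
  show "C = comp i \<Gamma> u"
  proof (rule max[symmetric])
    show "mono_connected (X i) \<Gamma> (comp i \<Gamma> u)"
      using assms(1) u by (rule comp_mono_connected)
    show "subgraph C (comp i \<Gamma> u)"
      using mono_connected_subset_comp[OF C(1) assms(3)] C(4) by (simp add: subgraph_def)
  qed
qed

text \<open>A homomorphism from the Cayley graph of factor \<open>i\<close> that maps the unit to \<open>v\<close>.\<close>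

definition cover :: "('v, 'x) lgraph \<Rightarrow> factor \<Rightarrow> 'v \<Rightarrow> ('x word set \<Rightarrow> 'v) \<Rightarrow> bool" where
  "cover \<Gamma> i v c \<longleftrightarrow> c \<one>\<^bsub>F i\<^esub> = v \<and> (\<forall>g\<in>carrier (F i). c g \<in> verts \<Gamma> \<and>
    (\<forall>a\<in>letters (X i). (c g, a, c (g \<otimes>\<^bsub>F i\<^esub> fcl i [a])) \<in> edges \<Gamma>))"

lemma cover_walk:
  assumes "cover \<Gamma> i v c" "g \<in> carrier (F i)" "w \<in> words (X i)"
  shows "walk \<Gamma> (c g) w (c (g \<otimes>\<^bsub>F i\<^esub> fcl i w))"
  using assms(2,3)
proof (induction w arbitrary: g)
  case Nil
  then show ?case
    using assms(1) by (simp add: cover_def fone[symmetric])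
next
  case (Cons a w)
  then have eq: "g \<otimes>\<^bsub>F i\<^esub> fcl i (a # w) = (g \<otimes>\<^bsub>F i\<^esub> fcl i [a]) \<otimes>\<^bsub>F i\<^esub> fcl i w"
    using fmult[of "[a]" i w] by (simp add: F.m_assoc)
  show ?case
    using Cons.prems Cons.IH[of "g \<otimes>\<^bsub>F i\<^esub> fcl i [a]"] assms(1) unfolding eq
    by (simp add: cover_def) blast
qed

lemma cover_walk_one:
  "cover \<Gamma> i v c \<Longrightarrow> w \<in> words (X i) \<Longrightarrow> walk \<Gamma> v w (c (fcl i w))"
  using cover_walk[of \<Gamma> i v c "\<one>\<^bsub>F i\<^esub>" w] by (simp add: cover_def)

lemma cover_shift:
  assumes "cover \<Gamma> i v c" "h \<in> carrier (F i)"
  shows "cover \<Gamma> i (c h) (\<lambda>g. c (h \<otimes>\<^bsub>F i\<^esub> g))"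
  using assms by (simp add: cover_def F.m_assoc[symmetric])

lemma cover_map:
  "cover (fst \<Gamma>) i v c \<Longrightarrow> cover (fst (map_pgraph f \<Gamma>)) i (f v) (f \<circ> c)"
  by (auto simp: cover_def intro!: map_edgeI)

text \<open>It is enough that some vertex of each component is the image of the unit. In this weak form the
  property survives the identification of vertices (\<open>weakly_saturated_map\<close>), and it gives a cover at
  every vertex once there is nothing to fold (\<open>weakly_saturated_det\<close>).\<close>

definition weakly_saturated :: "('v, 'x) lgraph \<Rightarrow> bool" where
  "weakly_saturated \<Gamma> \<longleftrightarrow> (\<forall>i. \<forall>v\<in>col \<Gamma> i. \<exists>u w c. w \<in> words (X i) \<and> walk \<Gamma> u w v \<and> cover \<Gamma> i u c)"

definition saturated :: "('v, 'x) lgraph \<Rightarrow> bool" where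
  "saturated \<Gamma> \<longleftrightarrow> (\<forall>i. \<forall>v\<in>col \<Gamma> i. \<exists>c. cover \<Gamma> i v c)"

lemma weakly_saturated_map:
  assumes "wf_graph (fst \<Gamma>)" "weakly_saturated (fst \<Gamma>)"
  shows "weakly_saturated (fst (map_pgraph f \<Gamma>))"
  unfolding weakly_saturated_def
proof (intro allI ballI)
  fix i v assume "v \<in> col (fst (map_pgraph f \<Gamma>)) i"
  then obtain v' where v': "v' \<in> col (fst \<Gamma>) i" "v = f v'"
    unfolding col_map[OF assms(1)] by blast
  then obtain u w c where "w \<in> words (X i)" "walk (fst \<Gamma>) u w v'" "cover (fst \<Gamma>) i u c"
    using assms(2) unfolding weakly_saturated_def by blast
  then show "\<exists>u w c. w \<in> words (X i) \<and> walk (fst (map_pgraph f \<Gamma>)) u w v \<and>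
      cover (fst (map_pgraph f \<Gamma>)) i u c"
    using v' walk_map cover_map by metis
qed

lemma weakly_saturated_det:
  assumes "weakly_saturated \<Gamma>" "det \<Gamma>"
  shows "saturated \<Gamma>"
  unfolding saturated_def
proof (intro allI ballI)
  fix i v assume "v \<in> col \<Gamma> i"
  then obtain u w c where w: "w \<in> words (X i)" "walk \<Gamma> u w v" "cover \<Gamma> i u c"
    using assms(1) unfolding weakly_saturated_def by blast
  then have "v = c (fcl i w)"
    using cover_walk_one det_walk assms(2) by metis
  then show "\<exists>c. cover \<Gamma> i v c"
    using cover_shift[OF w(3), of "fcl i w"] w by auto
qed

text \<open>The graph version of the agreement of the two actions of \<open>A\<close> at \<open>b\<close>. Foldings can create
  bichromatic vertices, so it is again a weak form that is carried through: every bichromatic vertex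
  is a translate under \<open>A\<close> of a vertex at which the actions agree.\<close>

definition compat :: "('v, 'x) lgraph \<Rightarrow> 'v \<Rightarrow> bool" where
  "compat \<Gamma> b \<longleftrightarrow> (\<forall>a\<in>carrier AA. \<forall>x\<in>\<phi> First a. \<forall>y\<in>\<phi> Second a. \<exists>t. walk \<Gamma> b x t \<and> walk \<Gamma> b y t)"

definition weakly_compatible :: "('v, 'x) lgraph \<Rightarrow> bool" where
  "weakly_compatible \<Gamma> \<longleftrightarrow> (\<forall>v\<in>bichromatic \<A> \<Gamma>. \<exists>b i a x.
    a \<in> carrier AA \<and> x \<in> \<phi> i a \<and> walk \<Gamma> b x v \<and> compat \<Gamma> b)"

definition compatible :: "('v, 'x) lgraph \<Rightarrow> bool" where
  "compatible \<Gamma> \<longleftrightarrow> (\<forall>v\<in>bichromatic \<A> \<Gamma>. compat \<Gamma> v)"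

lemma compat_map: "compat (fst \<Gamma>) b \<Longrightarrow> compat (fst (map_pgraph f \<Gamma>)) (f b)"
  unfolding compat_def using walk_map by fast

lemma weakly_compatible_map:
  assumes "wf_graph (fst \<Gamma>)" "weakly_compatible (fst \<Gamma>)"
    and "bichromatic \<A> (fst (map_pgraph f \<Gamma>)) \<subseteq> f ` bichromatic \<A> (fst \<Gamma>)"
  shows "weakly_compatible (fst (map_pgraph f \<Gamma>))"
  unfolding weakly_compatible_def
proof
  fix v assume "v \<in> bichromatic \<A> (fst (map_pgraph f \<Gamma>))"
  then obtain v' where v': "v' \<in> bichromatic \<A> (fst \<Gamma>)" "v = f v'"
    using assms(3) by blast
  then show "\<exists>b i a x. a \<in> carrier AA \<and> x \<in> \<phi> i a \<and> walk (fst (map_pgraph f \<Gamma>)) b x v \<and>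
      compat (fst (map_pgraph f \<Gamma>)) b"
    using assms(2) walk_map compat_map unfolding weakly_compatible_def by metis
qed

lemma \<phi>_mult_word:
  assumes "a \<in> carrier AA" "b \<in> carrier AA" "x \<in> \<phi> i a" "y \<in> \<phi> i b"
  shows "x @ y \<in> \<phi> i (a \<otimes>\<^bsub>AA\<^esub> b)"
proof -
  have "x @ y \<in> words (X i)" "fcl i (x @ y) = \<phi> i (a \<otimes>\<^bsub>AA\<^esub> b)"
    using assms \<phi>_word[of a x i] \<phi>_word[of b y i] fmult[of x i y] by auto
  then show ?thesis
    using fmem_self by metis
qed

lemma weakly_compatible_det:
  assumes "wf_graph \<Gamma>" "weakly_compatible \<Gamma>" "det \<Gamma>"
  shows "compatible \<Gamma>"
  unfolding compatible_def compat_def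
proof (intro ballI)
  fix v a x y
  assume v: "v \<in> bichromatic \<A> \<Gamma>" and a: "a \<in> carrier AA" "x \<in> \<phi> First a" "y \<in> \<phi> Second a"
  obtain b i d z where b: "d \<in> carrier AA" "z \<in> \<phi> i d" "walk \<Gamma> b z v" "compat \<Gamma> b"
    using v assms(2) unfolding weakly_compatible_def by blast
  obtain z1 z2 where z: "z1 \<in> \<phi> First d" "z2 \<in> \<phi> Second d" "z1 = z \<or> z2 = z"
    using b ex_\<phi>_word by (cases i) metis+
  then obtain t where t: "walk \<Gamma> b z1 t" "walk \<Gamma> b z2 t"
    using b unfolding compat_def by metis
  then have "t = v"
    using z b det_walk assms by metis
  have "z1 @ x \<in> \<phi> First (d \<otimes>\<^bsub>AA\<^esub> a)" "z2 @ y \<in> \<phi> Second (d \<otimes>\<^bsub>AA\<^esub> a)"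
    using \<phi>_mult_word z a b by auto
  then obtain s where "walk \<Gamma> b (z1 @ x) s" "walk \<Gamma> b (z2 @ y) s"
    using b a unfolding compat_def by (meson A.m_closed)
  then have "walk \<Gamma> v x s" "walk \<Gamma> v y s"
    using t \<open>t = v\<close> det_walk[OF assms(3)] unfolding walk_append[OF assms(1)] by metis+
  then show "\<exists>t. walk \<Gamma> v x t \<and> walk \<Gamma> v y t"
    by blast
qed

lemma finite_edges:
  assumes "wf_graph \<Gamma>" "finite (verts \<Gamma>)" "lab ` edges \<Gamma> \<subseteq> letters XX"
  shows "finite (edges \<Gamma>)"
proof (rule finite_subset)
  show "edges \<Gamma> \<subseteq> verts \<Gamma> \<times> letters XX \<times> verts \<Gamma>"
    using assms by (auto simp: wf_graph_def)
  show "finite (verts \<Gamma> \<times> letters XX \<times> verts \<Gamma>)"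
    using assms finite_gens by (auto simp: letters_def all_gens_def)
qed

end

section \<open>Disjoint unions and relative Cayley graphs\<close>

lemma mem_einv_image: "(u, a, v) \<in> einv ` E \<longleftrightarrow> (v, linv a, u) \<in> E"
proof
  assume "(u, a, v) \<in> einv ` E"
  then obtain e where "e \<in> E" "(u, a, v) = einv e"
    by blast
  then show "(v, linv a, u) \<in> E"
    by (simp add: einv_def)
next
  assume "(v, linv a, u) \<in> E"
  then have "einv (v, linv a, u) \<in> einv ` E"
    by blast
  then show "(u, a, v) \<in> einv ` E"
    by (simp add: einv_def)
qed

definition disj_union ::
  "('v, 'x) pgraph \<Rightarrow> 'k set \<Rightarrow> ('k \<Rightarrow> ('w, 'x) lgraph) \<Rightarrow> ('v + 'k \<times> 'w, 'x) pgraph" where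
  "disj_union \<Gamma> I \<Delta> =
    (\<lparr>verts = Inl ` verts (fst \<Gamma>) \<union> {Inr (k, g) |k g. k \<in> I \<and> g \<in> verts (\<Delta> k)},
      edges = {(Inl u, a, Inl v) |u a v. (u, a, v) \<in> edges (fst \<Gamma>)} \<union>
        {(Inr (k, g), a, Inr (k, h)) |k g a h. k \<in> I \<and> (g, a, h) \<in> edges (\<Delta> k)}\<rparr>,
     Inl (snd \<Gamma>))"

lemma glue_eq: "glue P \<Gamma> I \<Delta> = map_pgraph (\<lambda>v. (P \<union> P\<inverse>)\<^sup>* `` {v}) (disj_union \<Gamma> I \<Delta>)"
  by (simp add: glue_def quot_pgraph_def disj_union_def)

lemma disj_union_snd [simp]: "snd (disj_union \<Gamma> I \<Delta>) = Inl (snd \<Gamma>)"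
  by (simp add: disj_union_def)

lemma disj_union_verts [simp]:
  "Inl v \<in> verts (fst (disj_union \<Gamma> I \<Delta>)) \<longleftrightarrow> v \<in> verts (fst \<Gamma>)"
  "Inr (k, g) \<in> verts (fst (disj_union \<Gamma> I \<Delta>)) \<longleftrightarrow> k \<in> I \<and> g \<in> verts (\<Delta> k)"
  by (auto simp: disj_union_def)

lemma disj_union_verts_eq:
  "verts (fst (disj_union \<Gamma> I \<Delta>)) = Inl ` verts (fst \<Gamma>) \<union> (\<lambda>(k, g). Inr (k, g)) ` (SIGMA k:I. verts (\<Delta> k))"
  by (auto simp: disj_union_def)

lemma disj_union_edges [simp]:
  "(Inl u, a, z) \<in> edges (fst (disj_union \<Gamma> I \<Delta>)) \<longleftrightarrow> (\<exists>v. z = Inl v \<and> (u, a, v) \<in> edges (fst \<Gamma>))"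
  "(Inr (k, g), a, z) \<in> edges (fst (disj_union \<Gamma> I \<Delta>)) \<longleftrightarrow>
    (\<exists>h. z = Inr (k, h) \<and> k \<in> I \<and> (g, a, h) \<in> edges (\<Delta> k))"
  by (auto simp: disj_union_def)

lemma disj_union_wf:
  assumes "wf_graph (fst \<Gamma>)" "\<And>k. k \<in> I \<Longrightarrow> wf_graph (\<Delta> k)"
  shows "wf_graph (fst (disj_union \<Gamma> I \<Delta>))"
proof (rule wf_graphI)
  fix x a y assume e: "(x, a, y) \<in> edges (fst (disj_union \<Gamma> I \<Delta>))"
  show "x \<in> verts (fst (disj_union \<Gamma> I \<Delta>)) \<and> y \<in> verts (fst (disj_union \<Gamma> I \<Delta>)) \<and>
      (y, linv a, x) \<in> edges (fst (disj_union \<Gamma> I \<Delta>))"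
  proof (cases x)
    case (Inl u)
    then obtain v where "y = Inl v" "(u, a, v) \<in> edges (fst \<Gamma>)"
      using e by auto
    then show ?thesis
      using Inl wf_edge[OF assms(1), of u a v] by simp
  next
    case (Inr p)
    then obtain k g h where x: "x = Inr (k, g)" "y = Inr (k, h)" "k \<in> I" "(g, a, h) \<in> edges (\<Delta> k)"
      using e by (cases p) auto
    then show ?thesis
      using wf_edge[OF assms(2)[of k], of g a h] by simp
  qed
qed

lemma walk_Inl: "walk (fst \<Gamma>) u w v \<Longrightarrow> walk (fst (disj_union \<Gamma> I \<Delta>)) (Inl u) w (Inl v)"
  by (induction w arbitrary: u) auto

context amalgam
begin

lemma fcl_linv:
  assumes "a \<in> letters (X i)"
  shows "fcl i [a] \<otimes>\<^bsub>F i\<^esub> fcl i [linv a] = \<one>\<^bsub>F i\<^esub>"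
proof -
  have "fcl i [a] \<otimes>\<^bsub>F i\<^esub> fcl i [linv a] = fcl i ([a] @ winv [a])"
    using assms by (simp add: fmult)
  also have "\<dots> = \<one>\<^bsub>F i\<^esub>"
    unfolding fone using assms by (intro fp.cl_eqI fp.pres_rel_winv) auto
  finally show ?thesis .
qed

lemma el_linv:
  assumes "a \<in> letters XX"
  shows "el [a] \<otimes>\<^bsub>G\<^esub> el [linv a] = \<one>\<^bsub>G\<^esub>"
  using elt_winv_cancel[of "[a]"] assms by (simp add: elt_mult)

lemma factor_cayley_verts [simp]: "verts (fst (factor_cayley \<A> i S)) = rcosets\<^bsub>F i\<^esub> S"
  by (simp add: factor_cayley_def cayley_def Let_def factor_group_def)

lemma factor_cayley_snd [simp]: "snd (factor_cayley \<A> i S) = S #>\<^bsub>F i\<^esub> \<one>\<^bsub>F i\<^esub>"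
  by (simp add: factor_cayley_def cayley_def Let_def factor_group_def)

lemma factor_cayley_edge:
  "(D, a, D') \<in> edges (fst (factor_cayley \<A> i S)) \<longleftrightarrow>
    (\<exists>g\<in>carrier (F i). D = S #>\<^bsub>F i\<^esub> g \<and> D' = S #>\<^bsub>F i\<^esub> (g \<otimes>\<^bsub>F i\<^esub> fcl i [a])) \<and> a \<in> letters (X i)"
  by (auto simp: factor_cayley_def cayley_def Let_def factor_group_def)

lemma rcosets_iff: "D \<in> rcosets\<^bsub>F i\<^esub> S \<longleftrightarrow> (\<exists>g\<in>carrier (F i). D = S #>\<^bsub>F i\<^esub> g)"
  by (auto simp: RCOSETS_def)

lemma factor_cayley_wf: "wf_graph (fst (factor_cayley \<A> i S))"
proof (rule wf_graphI)
  fix D a D' assume "(D, a, D') \<in> edges (fst (factor_cayley \<A> i S))"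
  then obtain g where g: "g \<in> carrier (F i)" "D = S #>\<^bsub>F i\<^esub> g" "D' = S #>\<^bsub>F i\<^esub> (g \<otimes>\<^bsub>F i\<^esub> fcl i [a])"
    "a \<in> letters (X i)"
    by (auto simp: factor_cayley_edge)
  moreover have "(g \<otimes>\<^bsub>F i\<^esub> fcl i [a]) \<otimes>\<^bsub>F i\<^esub> fcl i [linv a] = g"
    using g fcl_linv[of a i] by (simp add: F.m_assoc)
  moreover have "g \<otimes>\<^bsub>F i\<^esub> fcl i [a] \<in> carrier (F i)"
    using g by simp
  ultimately show "D \<in> verts (fst (factor_cayley \<A> i S)) \<and> D' \<in> verts (fst (factor_cayley \<A> i S)) \<and>
      (D', linv a, D) \<in> edges (fst (factor_cayley \<A> i S))"
    unfolding factor_cayley_edge factor_cayley_verts rcosets_iff by (metis linv_letters)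
qed

lemma factor_cayley_cover:
  "g \<in> carrier (F i) \<Longrightarrow>
    cover (fst (factor_cayley \<A> i S)) i (S #>\<^bsub>F i\<^esub> g) (\<lambda>h. S #>\<^bsub>F i\<^esub> (g \<otimes>\<^bsub>F i\<^esub> h))"
  unfolding cover_def factor_cayley_edge factor_cayley_verts rcosets_iff
  by (auto simp: F.m_assoc[symmetric])

lemma finite_rcosets: "finite (rcosets\<^bsub>F i\<^esub> S)"
  by (simp add: RCOSETS_def finite_F)

lemma subgroup_trivial: "subgroup {\<one>\<^bsub>F i\<^esub>} (F i)"
  by (rule F.triv_subgroup)

end


section \<open>The subgroup and the first steps of the algorithm\<close>

locale stallings_input = amalgam \<A> for \<A> :: "('a, 'x) amalgam" +
  fixes ws :: "'x word list"
  assumes ws_words: "set ws \<subseteq> words XX"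
begin

definition H :: "'x word set set" where
  "H = generate G (el ` set ws)"

lemma subgroup_H: "subgroup H G"
  unfolding H_def using ws_words by (intro G.generate_is_subgroup) (auto simp: gcarrier)

lemma H_carrier: "H \<subseteq> carrier G"
  using subgroup_H by (rule subgroup.subset)

lemma rcosets_H: "c \<in> rcosets\<^bsub>G\<^esub> H \<longleftrightarrow> (\<exists>g\<in>carrier G. c = H #>\<^bsub>G\<^esub> g)"
  by (auto simp: RCOSETS_def)

lemma rcosets_H_carrier: "c \<in> rcosets\<^bsub>G\<^esub> H \<Longrightarrow> c \<subseteq> carrier G"
  using G.r_coset_subset_G H_carrier by (auto simp: rcosets_H)

lemma rcosets_H_mult:
  assumes "c \<in> rcosets\<^bsub>G\<^esub> H" "g \<in> carrier G"
  shows "c #>\<^bsub>G\<^esub> g \<in> rcosets\<^bsub>G\<^esub> H"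
proof -
  obtain h where "h \<in> carrier G" "c = H #>\<^bsub>G\<^esub> h"
    using assms by (auto simp: rcosets_H)
  then have "c #>\<^bsub>G\<^esub> g = H #>\<^bsub>G\<^esub> (h \<otimes>\<^bsub>G\<^esub> g)" "h \<otimes>\<^bsub>G\<^esub> g \<in> carrier G"
    using assms G.coset_mult_assoc H_carrier by auto
  then show ?thesis
    by (auto simp: rcosets_H)
qed

lemma coset_mult_assoc:
  "c \<in> rcosets\<^bsub>G\<^esub> H \<Longrightarrow> g \<in> carrier G \<Longrightarrow> h \<in> carrier G \<Longrightarrow>
    (c #>\<^bsub>G\<^esub> g) #>\<^bsub>G\<^esub> h = c #>\<^bsub>G\<^esub> (g \<otimes>\<^bsub>G\<^esub> h)"
  by (intro G.coset_mult_assoc rcosets_H_carrier)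

lemma coset_one: "c \<in> rcosets\<^bsub>G\<^esub> H \<Longrightarrow> c #>\<^bsub>G\<^esub> \<one>\<^bsub>G\<^esub> = c"
  by (intro G.coset_mult_one rcosets_H_carrier)

lemma coset_eq_iff:
  assumes "g \<in> carrier G" "h \<in> carrier G"
  shows "H #>\<^bsub>G\<^esub> g = H #>\<^bsub>G\<^esub> h \<longleftrightarrow> g \<otimes>\<^bsub>G\<^esub> inv\<^bsub>G\<^esub> h \<in> H"
proof -
  have "H #>\<^bsub>G\<^esub> g = H #>\<^bsub>G\<^esub> h \<longleftrightarrow> g \<in> H #>\<^bsub>G\<^esub> h"
    using assms G.rcos_self[OF _ subgroup_H] G.repr_independence[OF _ _ subgroup_H] by metis
  also have "\<dots> \<longleftrightarrow> g \<otimes>\<^bsub>G\<^esub> inv\<^bsub>G\<^esub> h \<in> H"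
    by (rule subgroup.rcos_module[OF subgroup_H G.is_group assms(2,1)])
  finally show ?thesis .
qed

text \<open>A label-preserving map to the relative Cayley graph of \<open>H\<close>. Its existence says that all words
  read along closed walks at the base point represent elements of \<open>H\<close>. As a map it passes to
  quotients without any choice of walks.\<close>

definition coset_map :: "('v, 'x) pgraph \<Rightarrow> ('v \<Rightarrow> 'x word set set) \<Rightarrow> bool" where
  "coset_map \<Gamma> m \<longleftrightarrow> m (snd \<Gamma>) = H \<and> (\<forall>v\<in>verts (fst \<Gamma>). m v \<in> rcosets\<^bsub>G\<^esub> H) \<and>
    (\<forall>u a v. (u, a, v) \<in> edges (fst \<Gamma>) \<longrightarrow> m v = m u #>\<^bsub>G\<^esub> el [a])"

definition graph_ok :: "('v, 'x) pgraph \<Rightarrow> bool" where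
  "graph_ok \<Gamma> \<longleftrightarrow> wf_graph (fst \<Gamma>) \<and> finite (verts (fst \<Gamma>)) \<and>
    (\<forall>u a v. (u, a, v) \<in> edges (fst \<Gamma>) \<longrightarrow> a \<in> letters XX) \<and> snd \<Gamma> \<in> verts (fst \<Gamma>)"

definition reads_gens :: "('v, 'x) pgraph \<Rightarrow> bool" where
  "reads_gens \<Gamma> \<longleftrightarrow> (\<forall>y\<in>set ws. \<exists>w. walk (fst \<Gamma>) (snd \<Gamma>) w (snd \<Gamma>) \<and> el w = el y)"

definition based_connected :: "('v, 'x) pgraph \<Rightarrow> bool" where
  "based_connected \<Gamma> \<longleftrightarrow> (\<forall>v\<in>verts (fst \<Gamma>). \<exists>w. walk (fst \<Gamma>) (snd \<Gamma>) w v)"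

text \<open>The invariant of the whole algorithm: a finite connected graph in which the closed walks at the
  base point represent exactly the elements of \<open>H\<close>.\<close>

definition good :: "('v, 'x) pgraph \<Rightarrow> bool" where
  "good \<Gamma> \<longleftrightarrow> graph_ok \<Gamma> \<and> based_connected \<Gamma> \<and> reads_gens \<Gamma> \<and> (\<exists>m. coset_map \<Gamma> m)"

lemma graph_ok_wf: "graph_ok \<Gamma> \<Longrightarrow> wf_graph (fst \<Gamma>)"
  by (simp add: graph_ok_def)

lemma good_wf: "good \<Gamma> \<Longrightarrow> wf_graph (fst \<Gamma>)"
  by (simp add: good_def graph_ok_def)

lemma walk_words: "graph_ok \<Gamma> \<Longrightarrow> walk (fst \<Gamma>) u w v \<Longrightarrow> w \<in> words XX"
proof (induction w arbitrary: u)
  case (Cons a w)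
  then obtain t where "(u, a, t) \<in> edges (fst \<Gamma>)" "walk (fst \<Gamma>) t w v"
    by auto
  then show ?case
    using Cons unfolding graph_ok_def by auto
qed simp

lemma coset_map_edge:
  "coset_map \<Gamma> m \<Longrightarrow> (u, a, v) \<in> edges (fst \<Gamma>) \<Longrightarrow> m v = m u #>\<^bsub>G\<^esub> el [a]"
  unfolding coset_map_def by blast

lemma coset_map_vert: "coset_map \<Gamma> m \<Longrightarrow> v \<in> verts (fst \<Gamma>) \<Longrightarrow> m v \<in> rcosets\<^bsub>G\<^esub> H"
  unfolding coset_map_def by blast

lemma coset_map_walk:
  assumes "graph_ok \<Gamma>" "coset_map \<Gamma> m" "walk (fst \<Gamma>) u w v"
  shows "m v = m u #>\<^bsub>G\<^esub> el w"
  using assms(3)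
proof (induction w arbitrary: u)
  case Nil
  then have "u = v" "m u \<in> rcosets\<^bsub>G\<^esub> H"
    using coset_map_vert[OF assms(2)] by auto
  then show ?case
    using coset_one[of "m u"] by (simp add: elt_one)
next
  case (Cons a w)
  then obtain t where t: "(u, a, t) \<in> edges (fst \<Gamma>)" "walk (fst \<Gamma>) t w v"
    by auto
  have words: "[a] @ w \<in> words XX"
    using walk_words[OF assms(1) Cons.prems] by simp
  have u: "m u \<in> rcosets\<^bsub>G\<^esub> H"
    using t wf_edge[OF graph_ok_wf[OF assms(1)]] coset_map_vert[OF assms(2)] by metis
  have "m v = (m u #>\<^bsub>G\<^esub> el [a]) #>\<^bsub>G\<^esub> el w"
    using Cons.IH t coset_map_edge[OF assms(2)] by metis
  also have "\<dots> = m u #>\<^bsub>G\<^esub> el ([a] @ w)"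
    using u words by (simp add: coset_mult_assoc elt_mult)
  finally show ?case by simp
qed

lemma graph_ok_map: "graph_ok \<Gamma> \<Longrightarrow> graph_ok (map_pgraph f \<Gamma>)"
  unfolding graph_ok_def map_edge_iff using wf_map[of \<Gamma> f] by fastforce

lemma reads_gens_map: "reads_gens \<Gamma> \<Longrightarrow> reads_gens (map_pgraph f \<Gamma>)"
  unfolding reads_gens_def map_simps using walk_map by metis

lemma based_connected_map: "based_connected \<Gamma> \<Longrightarrow> based_connected (map_pgraph f \<Gamma>)"
  unfolding based_connected_def map_simps by (auto dest: walk_map[of _ _ _ _ f])

text \<open>The map descends to a quotient if it is constant on the identified vertices. This is the only
  thing to check for folding, gluing and step 4.\<close>

lemma coset_map_map:
  assumes "graph_ok \<Gamma>" "coset_map \<Gamma> m"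
    and "\<And>x y. x \<in> verts (fst \<Gamma>) \<Longrightarrow> y \<in> verts (fst \<Gamma>) \<Longrightarrow> f x = f y \<Longrightarrow> m x = m y"
  shows "\<exists>m'. coset_map (map_pgraph f \<Gamma>) m'"
proof -
  define m' where "m' z = m (inv_into (verts (fst \<Gamma>)) f z)" for z
  have m': "m' (f x) = m x" if "x \<in> verts (fst \<Gamma>)" for x
    unfolding m'_def using that by (intro assms(3)) (auto intro: inv_into_into f_inv_into_f)
  have "coset_map (map_pgraph f \<Gamma>) m'"
    unfolding coset_map_def
  proof (intro conjI allI impI ballI)
    show "m' (snd (map_pgraph f \<Gamma>)) = H"
      using m' assms(1,2) by (simp add: coset_map_def graph_ok_def)
    show "m' v \<in> rcosets\<^bsub>G\<^esub> H" if "v \<in> verts (fst (map_pgraph f \<Gamma>))" for v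
      using that m' coset_map_vert[OF assms(2)] by auto
    show "m' v = m' u #>\<^bsub>G\<^esub> el [a]"
      if uav: "(u, a, v) \<in> edges (fst (map_pgraph f \<Gamma>))" for u a v
    proof -
      obtain x y where e: "u = f x" "v = f y" "(x, a, y) \<in> edges (fst \<Gamma>)"
        using uav unfolding map_edge_iff by blast
      then show ?thesis
        using m' wf_edge[OF graph_ok_wf[OF assms(1)] e(3)] coset_map_edge[OF assms(2) e(3)] by simp
    qed
  qed
  then show ?thesis by blast
qed

lemma good_map:
  assumes "good \<Gamma>" "coset_map \<Gamma> m"
    and "\<And>x y. x \<in> verts (fst \<Gamma>) \<Longrightarrow> y \<in> verts (fst \<Gamma>) \<Longrightarrow> f x = f y \<Longrightarrow> m x = m y"
  shows "good (map_pgraph f \<Gamma>)"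
  using assms coset_map_map[of \<Gamma> m f] graph_ok_map reads_gens_map based_connected_map
  unfolding good_def by blast

lemma fold_step_elim:
  assumes "fold_step \<Gamma> \<Gamma>'"
  obtains u a s t where "(u, a, s) \<in> edges (fst \<Gamma>)" "(u, a, t) \<in> edges (fst \<Gamma>)" "s \<noteq> t"
    "\<Gamma>' = map_pgraph (\<lambda>v. if v = t then s else v) \<Gamma>"
proof -
  obtain e f where ef: "e \<in> edges (fst \<Gamma>)" "f \<in> edges (fst \<Gamma>)" "e \<noteq> f" "ini e = ini f"
    "lab e = lab f" "\<Gamma>' = map_pgraph (\<lambda>v. if v = ter f then ter e else v) \<Gamma>"
    using assms unfolding fold_step_def by blast
  obtain u a s where e: "e = (u, a, s)"
    by (cases e) auto
  obtain t where f: "f = (u, a, t)"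
    using ef e by (cases f) auto
  show ?thesis
    by (rule that[of u a s t]) (use ef in \<open>simp_all add: e f cong: if_cong\<close>)
qed

lemma fold_step_good:
  assumes "good \<Gamma>" "fold_step \<Gamma> \<Gamma>'"
  shows "good \<Gamma>'"
proof -
  obtain m where m: "coset_map \<Gamma> m"
    using assms by (auto simp: good_def)
  obtain u a s t where f: "(u, a, s) \<in> edges (fst \<Gamma>)" "(u, a, t) \<in> edges (fst \<Gamma>)"
    "\<Gamma>' = map_pgraph (\<lambda>v. if v = t then s else v) \<Gamma>"
    using assms(2) by (rule fold_step_elim)
  then have "m s = m t"
    using coset_map_edge[OF m] by metis
  then show ?thesis
    unfolding f(3) by (intro good_map[OF assms(1) m]) (auto split: if_splits)
qed

lemma fold_step_card:
  assumes "good \<Gamma>" "fold_step \<Gamma> \<Gamma>'"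
  shows "card (verts (fst \<Gamma>')) < card (verts (fst \<Gamma>))"
proof -
  obtain u a s t where f: "(u, a, s) \<in> edges (fst \<Gamma>)" "(u, a, t) \<in> edges (fst \<Gamma>)" "s \<noteq> t"
    "\<Gamma>' = map_pgraph (\<lambda>v. if v = t then s else v) \<Gamma>"
    using assms(2) by (rule fold_step_elim)
  have "s \<in> verts (fst \<Gamma>)" "t \<in> verts (fst \<Gamma>)"
    using f wf_edge[OF good_wf[OF assms(1)]] by metis+
  then have "verts (fst \<Gamma>') \<subseteq> verts (fst \<Gamma>) - {t}" "t \<in> verts (fst \<Gamma>)"
    using f by auto
  then show ?thesis
    using assms(1) unfolding good_def graph_ok_def
    by (meson card_Diff1_less card_mono finite_Diff le_less_trans)
qed

lemma fold_step_weakly_saturated: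
  assumes "good \<Gamma>" "fold_step \<Gamma> \<Gamma>'" "weakly_saturated (fst \<Gamma>)"
  shows "weakly_saturated (fst \<Gamma>')"
  using assms(2) by (rule fold_step_elim) (use assms weakly_saturated_map good_wf in blast)

text \<open>The two vertices that are folded together both have edges in the factor of the common label, so
  their image is bichromatic only if one of them was.\<close>

lemma fold_step_weakly_compatible:
  assumes "good \<Gamma>" "fold_step \<Gamma> \<Gamma>'" "weakly_compatible (fst \<Gamma>)"
  shows "weakly_compatible (fst \<Gamma>')"
proof -
  note wf = good_wf[OF assms(1)]
  obtain u a s t where f: "(u, a, s) \<in> edges (fst \<Gamma>)" "(u, a, t) \<in> edges (fst \<Gamma>)"
    "\<Gamma>' = map_pgraph (\<lambda>v. if v = t then s else v) \<Gamma>"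
    using assms(2) by (rule fold_step_elim)
  let ?f = "\<lambda>v. if v = t then s else v"
  obtain c where "a \<in> letters (X c)"
    using f assms(1) XX_letters unfolding good_def graph_ok_def by metis
  then have c: "s \<in> col (fst \<Gamma>) c" "t \<in> col (fst \<Gamma>) c"
    using colI[OF wf f(1)] colI[OF wf f(2)] by auto
  have "bichromatic \<A> (fst (map_pgraph ?f \<Gamma>)) \<subseteq> ?f ` bichromatic \<A> (fst \<Gamma>)"
  proof
    fix v assume "v \<in> bichromatic \<A> (fst (map_pgraph ?f \<Gamma>))"
    then have "v \<in> ?f ` col (fst \<Gamma>) c" "v \<in> ?f ` col (fst \<Gamma>) (other c)"
      unfolding bichromatic_iff col_map[OF wf] by blast+
    then obtain x y where xy: "x \<in> col (fst \<Gamma>) c" "y \<in> col (fst \<Gamma>) (other c)" "v = ?f x" "v = ?f y"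
      by blast
    then have "y \<in> col (fst \<Gamma>) c"
      using c by (cases "x = y") (auto split: if_splits)
    then show "v \<in> ?f ` bichromatic \<A> (fst \<Gamma>)"
      using xy by (intro image_eqI[of _ _ y]) (simp_all add: bichromatic_iff2[of y _ c])
  qed
  then show ?thesis
    unfolding f(3) using assms wf by (intro weakly_compatible_map) auto
qed

lemma fold_exists:
  "good \<Gamma> \<Longrightarrow> \<exists>\<Gamma>'. exhausts fold_step \<Gamma> \<Gamma>'"
  by (rule exhausts_exists[where Q = good and f = "\<lambda>\<Gamma>. card (verts (fst \<Gamma>))"])
    (auto intro: fold_step_good fold_step_card)

text \<open>The common part of cutting hairs and of removing redundant components: a subgraph is harmless
  if every walk from the base point to one of its vertices can be replaced by a walk in the
  subgraph that represents the same element of the amalgam.\<close>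

lemma good_retract:
  assumes "good \<Gamma>" "wf_graph (fst \<Gamma>')" "verts (fst \<Gamma>') \<subseteq> verts (fst \<Gamma>)"
    "edges (fst \<Gamma>') \<subseteq> edges (fst \<Gamma>)" "snd \<Gamma>' = snd \<Gamma>" "snd \<Gamma>' \<in> verts (fst \<Gamma>')"
    and retract: "\<And>w v. walk (fst \<Gamma>) (snd \<Gamma>) w v \<Longrightarrow> v \<in> verts (fst \<Gamma>') \<Longrightarrow>
      \<exists>w'. walk (fst \<Gamma>') (snd \<Gamma>) w' v \<and> el w' = el w"
  shows "good \<Gamma>'"
proof -
  have \<Gamma>: "graph_ok \<Gamma>" "based_connected \<Gamma>" "reads_gens \<Gamma>" and "\<exists>m. coset_map \<Gamma> m"
    using assms(1) by (auto simp: good_def)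
  then obtain m where m: "coset_map \<Gamma> m"
    by blast
  have "graph_ok \<Gamma>'"
    unfolding graph_ok_def
  proof (intro conjI allI impI)
    show "finite (verts (fst \<Gamma>'))"
      using \<Gamma>(1) assms(3) finite_subset by (auto simp: graph_ok_def)
    show "a \<in> letters XX" if "(u, a, v) \<in> edges (fst \<Gamma>')" for u a v
      using \<Gamma>(1) subsetD[OF assms(4) that] unfolding graph_ok_def by blast
  qed (use assms in auto)
  moreover have "coset_map \<Gamma>' m"
    using m assms(3-5) unfolding coset_map_def by auto
  moreover have "based_connected \<Gamma>'"
    unfolding based_connected_def
  proof
    fix v assume v: "v \<in> verts (fst \<Gamma>')"
    then obtain w where "walk (fst \<Gamma>) (snd \<Gamma>) w v"
      using \<Gamma>(2) assms(3) unfolding based_connected_def by blast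
    then show "\<exists>w. walk (fst \<Gamma>') (snd \<Gamma>') w v"
      using retract[of w v] v assms(5) by auto
  qed
  moreover have "reads_gens \<Gamma>'"
    unfolding reads_gens_def
  proof
    fix y assume "y \<in> set ws"
    then obtain w where "walk (fst \<Gamma>) (snd \<Gamma>) w (snd \<Gamma>)" "el w = el y"
      using \<Gamma>(3) unfolding reads_gens_def by blast
    then show "\<exists>w. walk (fst \<Gamma>') (snd \<Gamma>') w (snd \<Gamma>') \<and> el w = el y"
      using retract[of w "snd \<Gamma>"] assms(5,6) by auto
  qed
  ultimately show ?thesis
    by (auto simp: good_def)
qed

lemma hair_step_good:
  assumes "good \<Gamma>" "hair_step \<Gamma> \<Gamma>'"
  shows "good \<Gamma>'" "card (verts (fst \<Gamma>')) < card (verts (fst \<Gamma>))"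
proof -
  note wf = good_wf[OF assms(1)]
  obtain e where e: "e \<in> edges (fst \<Gamma>)" "ter e \<noteq> snd \<Gamma>"
    "card {f \<in> edges (fst \<Gamma>). ini f = ter e} = 1"
    "\<Gamma>' = (\<lparr>verts = verts (fst \<Gamma>) - {ter e}, edges = edges (fst \<Gamma>) - {e, einv e}\<rparr>, snd \<Gamma>)"
    using assms(2) unfolding hair_step_def by blast
  obtain u a h where eq: "e = (u, a, h)"
    by (cases e) auto
  have uah: "u \<in> verts (fst \<Gamma>)" "h \<in> verts (fst \<Gamma>)" "(h, linv a, u) \<in> edges (fst \<Gamma>)"
    "(u, a, h) \<in> edges (fst \<Gamma>)"
    using wf_edge[OF wf, of u a h] e(1) eq by auto
  obtain x where x: "{f \<in> edges (fst \<Gamma>). ini f = ter e} = {x}"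
    using card_1_singletonE[OF e(3)] by blast
  have mem_x: "(h, b, v) = x" if "(h, b, v) \<in> edges (fst \<Gamma>)" for b v
  proof -
    have "(h, b, v) \<in> {f \<in> edges (fst \<Gamma>). ini f = ter e}"
      using that by (simp add: eq)
    then show ?thesis
      unfolding x by simp
  qed
  have out: "b = linv a \<and> v = u" if "(h, b, v) \<in> edges (fst \<Gamma>)" for b v
    using mem_x[OF that] mem_x[OF uah(3)] by auto
  have inn: "b = a \<and> v = u" if "(v, b, h) \<in> edges (fst \<Gamma>)" for b v
    using out[OF wf_edge(3)[OF wf that]] by (metis linv_linv)
  have "u \<noteq> h"
    using out[of a h] uah linv_neq(1)[of a] by metis
  have mem': "(x, b, y) \<in> edges (fst \<Gamma>') \<longleftrightarrow> (x, b, y) \<in> edges (fst \<Gamma>) \<and>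
      (x, b, y) \<noteq> (u, a, h) \<and> (x, b, y) \<noteq> (h, linv a, u)" for x b y
    by (simp add: e(4) eq einv_def)
  have edges': "(x, b, y) \<in> edges (fst \<Gamma>') \<longleftrightarrow> (x, b, y) \<in> edges (fst \<Gamma>) \<and> x \<noteq> h \<and> y \<noteq> h" for x b y
  proof
    assume "(x, b, y) \<in> edges (fst \<Gamma>')"
    then have "(x, b, y) \<in> edges (fst \<Gamma>)" "(x, b, y) \<noteq> (u, a, h)" "(x, b, y) \<noteq> (h, linv a, u)"
      unfolding mem' by auto
    then show "(x, b, y) \<in> edges (fst \<Gamma>) \<and> x \<noteq> h \<and> y \<noteq> h"
      using out[of b y] inn[of x b] by metis
  next
    assume "(x, b, y) \<in> edges (fst \<Gamma>) \<and> x \<noteq> h \<and> y \<noteq> h"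
    then show "(x, b, y) \<in> edges (fst \<Gamma>')"
      unfolding mem' by simp
  qed
  have \<Gamma>': "verts (fst \<Gamma>') = verts (fst \<Gamma>) - {h}"
    "\<And>x b y. (x, b, y) \<in> edges (fst \<Gamma>') \<longleftrightarrow> (x, b, y) \<in> edges (fst \<Gamma>) \<and> x \<noteq> h \<and> y \<noteq> h"
    "snd \<Gamma>' = snd \<Gamma>"
    using edges' by (simp_all add: e(4) eq)
  have wf': "wf_graph (fst \<Gamma>')"
  proof (rule wf_graphI)
    fix x b y assume "(x, b, y) \<in> edges (fst \<Gamma>')"
    then show "x \<in> verts (fst \<Gamma>') \<and> y \<in> verts (fst \<Gamma>') \<and> (y, linv b, x) \<in> edges (fst \<Gamma>')"
      using wf_edge[OF wf, of x b y] unfolding \<Gamma>' by auto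
  qed
  have ok: "graph_ok \<Gamma>"
    using assms by (simp add: good_def)
  \<comment> \<open>Up to equality in the amalgam, a walk that ends at the hair is one that ends at its root,
    followed by the letter of the hair.\<close>
  have retract: "if v = h then \<exists>w'. walk (fst \<Gamma>') (snd \<Gamma>) w' u \<and> el (w' @ [a]) = el w
      else \<exists>w'. walk (fst \<Gamma>') (snd \<Gamma>) w' v \<and> el w' = el w"
    if "walk (fst \<Gamma>) (snd \<Gamma>) w v" for w v
    using that
  proof (induction w arbitrary: v rule: rev_induct)
    case Nil
    then show ?case
      using e(2) \<Gamma>' by (auto simp: eq intro!: exI[of _ "[]"])
  next
    case (snoc b w)
    then obtain t where t: "walk (fst \<Gamma>) (snd \<Gamma>) w t" "(t, b, v) \<in> edges (fst \<Gamma>)"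
      by (auto simp: walk_snoc[OF wf])
    have words: "w \<in> words XX" "[b] \<in> words XX"
      using walk_words[OF ok snoc.prems] by auto
    note IH = snoc.IH[OF t(1)]
    have elw: "el (w' @ [c]) = el (w @ [c])" if "el w' = el w" "w' \<in> words XX" "c \<in> letters XX" for w' c
      using that words by (simp add: elt_mult[symmetric])
    have w'_words: "w' \<in> words XX" if "walk (fst \<Gamma>') (snd \<Gamma>) w' x" for w' x
      using walk_mono[OF that, of "fst \<Gamma>"] \<Gamma>' walk_words[OF ok] e(4) by auto
    show ?case
    proof (cases "v = h")
      case True
      then have b: "b = a" "t = u" "t \<noteq> h"
        using inn[of t b] t(2) \<open>u \<noteq> h\<close> by auto
      then obtain w' where w': "walk (fst \<Gamma>') (snd \<Gamma>) w' u" "el w' = el w"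
        using IH by auto
      moreover have "el (w' @ [a]) = el (w @ [b])"
        using elw[OF w'(2) w'_words[OF w'(1)], of b] words b by simp
      ultimately show ?thesis
        using True by auto
    next
      case False
      show ?thesis
      proof (cases "t = h")
        case True
        then have b: "b = linv a" "v = u"
          using out[of b v] t(2) by auto
        obtain w' where w': "walk (fst \<Gamma>') (snd \<Gamma>) w' u" "el (w' @ [a]) = el w"
          using IH True by auto
        have wx: "w' \<in> words XX" "a \<in> letters XX"
          using w'_words[OF w'(1)] words b by auto
        have "el (w @ [b]) = el (w' @ [a]) \<otimes>\<^bsub>G\<^esub> el [linv a]"
          unfolding w'(2) b(1)[symmetric] using words by (simp add: elt_mult)
        also have "\<dots> = el w' \<otimes>\<^bsub>G\<^esub> (el [a] \<otimes>\<^bsub>G\<^esub> el [linv a])"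
          using wx by (simp add: elt_mult[symmetric, of w' "[a]"] G.m_assoc)
        also have "\<dots> = el w'"
          using wx by (simp add: el_linv)
        finally show ?thesis
          using False w' b by auto
      next
        case tn: False
        obtain w' where w': "walk (fst \<Gamma>') (snd \<Gamma>) w' t" "el w' = el w"
          using IH tn by auto
        have "(t, b, v) \<in> edges (fst \<Gamma>')"
          using \<Gamma>' t(2) False tn by auto
        then have "walk (fst \<Gamma>') (snd \<Gamma>) (w' @ [b]) v"
          using w' by (auto simp: walk_snoc[OF wf'])
        then show ?thesis
          using False elw[OF w'(2) w'_words[OF w'(1)], of b] words by auto
      qed
    qed
  qed
  show "good \<Gamma>'"
  proof (rule good_retract[OF assms(1) wf'])
    fix w v assume "walk (fst \<Gamma>) (snd \<Gamma>) w v" "v \<in> verts (fst \<Gamma>')"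
    then show "\<exists>w'. walk (fst \<Gamma>') (snd \<Gamma>) w' v \<and> el w' = el w"
      using retract[of w v] \<Gamma>' by (auto split: if_splits)
  next
    show "snd \<Gamma>' \<in> verts (fst \<Gamma>')"
      using ok e(2) \<Gamma>' by (simp add: graph_ok_def eq)
  qed (use \<Gamma>' e(4) in auto)
  show "card (verts (fst \<Gamma>')) < card (verts (fst \<Gamma>))"
    using ok uah(2) unfolding \<Gamma>'(1) graph_ok_def by (intro card_Diff1_less) auto
qed

lemma take_words: "w \<in> words XX \<Longrightarrow> take j w \<in> words XX"
  by (metis append_take_drop_id words_simps(3))

text \<open>The vertex reached after \<open>j\<close> letters of a generator \<open>y\<close> is mapped to the coset of the prefix of
  length \<open>j\<close>. This is consistent at the end of the loop because \<open>y\<close> lies in \<open>H\<close>.\<close>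

lemma step1_good: "good (step1 ws)"
proof -
  let ?\<Gamma> = "step1 ws"
  define m where "m v = (case v of None \<Rightarrow> H | Some (k, j) \<Rightarrow> H #>\<^bsub>G\<^esub> el (take j (ws ! k)))" for v
  have E: "(u, a, v) \<in> edges (fst ?\<Gamma>) \<longleftrightarrow> (\<exists>k j. k < length ws \<and> j < length (ws ! k) \<and>
      ((u = loop_vertex ws k j \<and> a = ws ! k ! j \<and> v = loop_vertex ws k (Suc j)) \<or>
       (v = loop_vertex ws k j \<and> linv a = ws ! k ! j \<and> u = loop_vertex ws k (Suc j))))" for u a v
  proof -
    define E0 where "E0 = {(loop_vertex ws k j, ws ! k ! j, loop_vertex ws k (Suc j)) |k j.
        k < length ws \<and> j < length (ws ! k)}"
    have "(x, b, y) \<in> E0 \<longleftrightarrow> (\<exists>k j. k < length ws \<and> j < length (ws ! k) \<and>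
        x = loop_vertex ws k j \<and> b = ws ! k ! j \<and> y = loop_vertex ws k (Suc j))" for x b y
      unfolding E0_def mem_Collect_eq prod.inject
      by (intro iffI; elim exE conjE; intro exI conjI; assumption)
    moreover have "edges (fst ?\<Gamma>) = E0 \<union> einv ` E0"
      by (simp add: step1_def Let_def E0_def)
    ultimately show ?thesis
      by (simp only: Un_iff mem_einv_image conj_disj_distribL ex_disj_distrib)
  qed
  have V: "verts (fst ?\<Gamma>) =
      {None} \<union> {loop_vertex ws k j |k j. k < length ws \<and> j < length (ws ! k)}"
    and s: "snd ?\<Gamma> = None"
    by (auto simp: step1_def Let_def)
  have lv: "loop_vertex ws k j \<in> verts (fst ?\<Gamma>)" if "k < length ws" "j \<le> length (ws ! k)" for k j
  proof (cases "j = length (ws ! k)")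
    case True
    then show ?thesis
      by (simp add: V loop_vertex_def)
  next
    case False
    then have "j < length (ws ! k)"
      using that by simp
    then show ?thesis
      unfolding V using that(1) by blast
  qed
  have wf: "wf_graph (fst ?\<Gamma>)"
  proof (rule wf_graphI)
    fix u a v assume "(u, a, v) \<in> edges (fst ?\<Gamma>)"
    then obtain k j where kj: "k < length ws" "j < length (ws ! k)"
      "(u = loop_vertex ws k j \<and> a = ws ! k ! j \<and> v = loop_vertex ws k (Suc j)) \<or>
       (v = loop_vertex ws k j \<and> linv a = ws ! k ! j \<and> u = loop_vertex ws k (Suc j))"
      unfolding E by blast
    then have "u \<in> verts (fst ?\<Gamma>)" "v \<in> verts (fst ?\<Gamma>)"
      using lv[of k j] lv[of k "Suc j"] by auto
    moreover have "(v, linv a, u) \<in> edges (fst ?\<Gamma>)"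
      unfolding E linv_linv using kj by blast
    ultimately show "u \<in> verts (fst ?\<Gamma>) \<and> v \<in> verts (fst ?\<Gamma>) \<and> (v, linv a, u) \<in> edges (fst ?\<Gamma>)"
      by blast
  qed
  have word: "ws ! k \<in> words XX" if "k < length ws" for k
    using that ws_words nth_mem by blast
  have letter: "ws ! k ! j \<in> letters XX" if "k < length ws" "j < length (ws ! k)" for k j
    using word[OF that(1)] that(2) by (auto simp: words_def)
  have HH: "H \<in> rcosets\<^bsub>G\<^esub> H"
    unfolding rcosets_H using G.coset_mult_one[OF H_carrier] by force
  have m_lv: "m (loop_vertex ws k j) = H #>\<^bsub>G\<^esub> el (take j (ws ! k))"
    if "k < length ws" "j \<le> length (ws ! k)" for k j
  proof -
    have "el (ws ! k) \<in> H"
      unfolding H_def using that by (intro generate.incl) auto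
    then have "H #>\<^bsub>G\<^esub> el (ws ! k) = H"
      using word[OF that(1)] by (intro G.coset_join2 subgroup_H) auto
    then show ?thesis
      using coset_one[OF HH] by (auto simp: m_def loop_vertex_def elt_one)
  qed
  have step: "m (loop_vertex ws k (Suc j)) = m (loop_vertex ws k j) #>\<^bsub>G\<^esub> el [ws ! k ! j]"
    if "k < length ws" "j < length (ws ! k)" for k j
  proof -
    have "take (Suc j) (ws ! k) = take j (ws ! k) @ [ws ! k ! j]"
      using that by (simp add: take_Suc_conv_app_nth)
    then show ?thesis
      using that letter[OF that] take_words[OF word[OF that(1)], of j] HH
      by (simp add: m_lv coset_mult_assoc elt_mult)
  qed
  have m_coset: "m (loop_vertex ws k j) \<in> rcosets\<^bsub>G\<^esub> H"
    if "k < length ws" "j \<le> length (ws ! k)" for k j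
    using that take_words[OF word[OF that(1)], of j] rcosets_H_mult[OF HH] by (simp add: m_lv)
  have "coset_map ?\<Gamma> m"
    unfolding coset_map_def
  proof (intro conjI allI impI ballI)
    show "m (snd ?\<Gamma>) = H"
      by (simp add: s m_def)
    show "m v \<in> rcosets\<^bsub>G\<^esub> H" if "v \<in> verts (fst ?\<Gamma>)" for v
      using that HH m_coset unfolding V by (auto simp: m_def[of None])
    show "m v = m u #>\<^bsub>G\<^esub> el [a]" if uav: "(u, a, v) \<in> edges (fst ?\<Gamma>)" for u a v
    proof -
      obtain k j where kj: "k < length ws" "j < length (ws ! k)"
        "(u = loop_vertex ws k j \<and> a = ws ! k ! j \<and> v = loop_vertex ws k (Suc j)) \<or>
         (v = loop_vertex ws k j \<and> linv a = ws ! k ! j \<and> u = loop_vertex ws k (Suc j))"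
        using uav unfolding E by blast
      from kj(3) show ?thesis
      proof
        assume r: "v = loop_vertex ws k j \<and> linv a = ws ! k ! j \<and> u = loop_vertex ws k (Suc j)"
        then have a: "a \<in> letters XX"
          using letter[OF kj(1,2)] linv_letters by metis
        have "m u = m v #>\<^bsub>G\<^esub> el [linv a]"
          using r step[OF kj(1,2)] by simp
        then have "m u #>\<^bsub>G\<^esub> el [a] = (m v #>\<^bsub>G\<^esub> el [linv a]) #>\<^bsub>G\<^esub> el [linv (linv a)]"
          by simp
        also have "\<dots> = m v #>\<^bsub>G\<^esub> (el [linv a] \<otimes>\<^bsub>G\<^esub> el [linv (linv a)])"
          using a r m_coset[of k j] kj(1,2) letter[OF kj(1,2)] by (intro coset_mult_assoc) auto
        also have "\<dots> = m v"
          using r m_coset[of k j] kj(1,2) letter[OF kj(1,2)]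
          by (simp add: el_linv coset_one del: linv_linv)
        finally show ?thesis by simp
      qed (use step kj in auto)
    qed
  qed
  moreover have "graph_ok ?\<Gamma>"
    unfolding graph_ok_def
  proof (intro conjI allI impI)
    have "{loop_vertex ws k j |k j. k < length ws \<and> j < length (ws ! k)} =
        (\<lambda>(k, j). loop_vertex ws k j) ` (SIGMA k:{..<length ws}. {..<length (ws ! k)})"
      by auto
    then show "finite (verts (fst ?\<Gamma>))"
      unfolding V by simp
    show "a \<in> letters XX" if "(u, a, v) \<in> edges (fst ?\<Gamma>)" for u a v
      using that letter linv_letters unfolding E by metis
  qed (use wf V s in auto)
  moreover have walk: "walk (fst ?\<Gamma>) None (take j (ws ! k)) (loop_vertex ws k j)"
    if "k < length ws" "j \<le> length (ws ! k)" for k j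
    using that(2)
  proof (induction j)
    case 0
    then show ?case
      by (auto simp: loop_vertex_def V)
  next
    case (Suc j)
    then have "(loop_vertex ws k j, ws ! k ! j, loop_vertex ws k (Suc j)) \<in> edges (fst ?\<Gamma>)"
      unfolding E using that(1) by (intro exI[of _ k] exI[of _ j]) auto
    then show ?case
      using Suc by (auto simp: take_Suc_conv_app_nth walk_snoc[OF wf])
  qed
  have "based_connected ?\<Gamma>"
    unfolding based_connected_def s
  proof
    fix v assume "v \<in> verts (fst ?\<Gamma>)"
    then consider "v = None" | k j where "v = loop_vertex ws k j" "k < length ws" "j < length (ws ! k)"
      unfolding V by blast
    then show "\<exists>w. walk (fst ?\<Gamma>) None w v"
    proof cases
      case 1
      then show ?thesis
        by (auto simp: V intro: exI[of _ "[]"])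
    qed (use walk in \<open>auto intro: less_imp_le\<close>)
  qed
  moreover have "reads_gens ?\<Gamma>"
    unfolding reads_gens_def s
  proof
    fix y assume "y \<in> set ws"
    then obtain k where k: "k < length ws" "y = ws ! k"
      by (metis in_set_conv_nth)
    then have "walk (fst ?\<Gamma>) None y None"
      using walk[of k "length (ws ! k)"] by (simp add: loop_vertex_def)
    then show "\<exists>w. walk (fst ?\<Gamma>) None w None \<and> el w = el y"
      by blast
  qed
  ultimately show ?thesis
    by (auto simp: good_def)
qed

lemma step2_good: "step2 (step1 ws) \<Gamma> \<Longrightarrow> good \<Gamma>"
  unfolding step2_def
  by (erule exhausts_invariant[where Q = good]) (auto intro: step1_good fold_step_good hair_step_good)

lemma step2_exists: "\<exists>\<Gamma>. step2 (step1 ws) \<Gamma>"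
  unfolding step2_def
  by (rule exhausts_exists[where Q = good and f = "\<lambda>\<Gamma>. card (verts (fst \<Gamma>))"])
    (auto intro: step1_good fold_step_good hair_step_good fold_step_card)

end

context stallings_input
begin

lemma graph_ok_letter: "graph_ok \<Gamma> \<Longrightarrow> (u, a, v) \<in> edges (fst \<Gamma>) \<Longrightarrow> a \<in> letters XX"
  unfolding graph_ok_def by blast

text \<open>If a relative Cayley graph is glued to a vertex over the coset \<open>c\<close>, its vertex \<open>S g\<close> lies over
  \<open>c g\<close>. This does not depend on \<open>g\<close> when \<open>S\<close> fixes \<open>c\<close>; for step 3, \<open>S\<close> is trivial.\<close>

definition lift :: "'x word set set \<Rightarrow> factor \<Rightarrow> 'x word set set \<Rightarrow> 'x word set set" where
  "lift c i D = c #>\<^bsub>G\<^esub> gel i (SOME g. g \<in> D)"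

lemma lift_eq:
  assumes "subgroup S (F i)" "c \<in> rcosets\<^bsub>G\<^esub> H" "\<And>s. s \<in> S \<Longrightarrow> c #>\<^bsub>G\<^esub> gel i s = c"
    and "g \<in> carrier (F i)"
  shows "lift c i (S #>\<^bsub>F i\<^esub> g) = c #>\<^bsub>G\<^esub> gel i g"
proof -
  define g' where "g' = (SOME g'. g' \<in> S #>\<^bsub>F i\<^esub> g)"
  have "g \<in> S #>\<^bsub>F i\<^esub> g"
    using F.rcos_self assms by blast
  then have "g' \<in> S #>\<^bsub>F i\<^esub> g"
    unfolding g'_def by (rule someI)
  then obtain s where s: "s \<in> S" "g' = s \<otimes>\<^bsub>F i\<^esub> g"
    by (auto simp: r_coset_def)
  then have "s \<in> carrier (F i)"
    using assms subgroup.mem_carrier by metis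
  then have "c #>\<^bsub>G\<^esub> gel i g' = (c #>\<^bsub>G\<^esub> gel i s) #>\<^bsub>G\<^esub> gel i g"
    using s assms(2,4) by (simp add: coset_mult_assoc)
  also have "\<dots> = c #>\<^bsub>G\<^esub> gel i g"
    using s assms by simp
  finally show ?thesis
    by (simp add: lift_def g'_def)
qed

lemma lift_coset_map:
  assumes "subgroup S (F i)" "c \<in> rcosets\<^bsub>G\<^esub> H" "\<And>s. s \<in> S \<Longrightarrow> c #>\<^bsub>G\<^esub> gel i s = c"
  shows "D \<in> rcosets\<^bsub>F i\<^esub> S \<Longrightarrow> lift c i D \<in> rcosets\<^bsub>G\<^esub> H"
    and "(D, a, D') \<in> edges (fst (factor_cayley \<A> i S)) \<Longrightarrow> lift c i D' = lift c i D #>\<^bsub>G\<^esub> el [a]"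
proof -
  assume "D \<in> rcosets\<^bsub>F i\<^esub> S"
  then show "lift c i D \<in> rcosets\<^bsub>G\<^esub> H"
    using lift_eq[OF assms] rcosets_H_mult[OF assms(2)] by (auto simp: rcosets_iff)
next
  assume "(D, a, D') \<in> edges (fst (factor_cayley \<A> i S))"
  then obtain g where g: "g \<in> carrier (F i)" "D = S #>\<^bsub>F i\<^esub> g" "D' = S #>\<^bsub>F i\<^esub> (g \<otimes>\<^bsub>F i\<^esub> fcl i [a])"
    "a \<in> letters (X i)"
    by (auto simp: factor_cayley_edge)
  have "lift c i D' = c #>\<^bsub>G\<^esub> (gel i g \<otimes>\<^bsub>G\<^esub> el [a])"
    unfolding g(3) using g(1,4) gel_fcl[of "[a]" i] by (subst lift_eq[OF assms]) auto
  also have "\<dots> = lift c i D #>\<^bsub>G\<^esub> el [a]"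
    unfolding g(2) using g(1,4) assms(2) words_XX[of "[a]" i]
    by (subst lift_eq[OF assms]) (auto simp: coset_mult_assoc)
  finally show "lift c i D' = lift c i D #>\<^bsub>G\<^esub> el [a]" .
qed

lemma based_connected_quot:
  assumes "wf_graph (fst \<Gamma>)"
    and "\<And>v. v \<in> verts (fst \<Gamma>) \<Longrightarrow>
      \<exists>w. walk (fst (map_pgraph f \<Gamma>)) (f (snd \<Gamma>)) w (f v)"
  shows "based_connected (map_pgraph f \<Gamma>)"
  using assms(2) unfolding based_connected_def by auto

subsection \<open>Completing the components to Cayley graphs\<close>

text \<open>Gluing keeps the invariant because the coset map extends by \<open>lift\<close>. Each vertex of a component is
  reached from the picked edge by a word in one factor, so one Cayley graph per component is enough
  for weak saturation.\<close>

lemma glue_cayley_good: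
  fixes \<Gamma> :: "('v, 'x) pgraph" and T :: "('v, 'x) edge set"
  assumes good: "good \<Gamma>" and T: "T \<subseteq> edges (fst \<Gamma>)"
    and trans: "\<And>i C. mono_component (X i) (fst \<Gamma>) C \<Longrightarrow> \<exists>!e. e \<in> T \<and> e \<in> edges C"
  defines "fac \<equiv> \<lambda>e. factor_of_letter \<A> (lab e)"
  defines "cay \<equiv> \<lambda>e. factor_cayley \<A> (fac e) {\<one>\<^bsub>F (fac e)\<^esub>}"
  defines "P \<equiv> \<Union>e\<in>T. {(Inl (ini e), Inr (e, snd (cay e)))} \<union>
    {(Inl (ter e), Inr (e, d)) |d. (snd (cay e), lab e, d) \<in> edges (fst (cay e))}"
  shows "good (glue P \<Gamma> T (\<lambda>e. fst (cay e)))" "weakly_saturated (fst (glue P \<Gamma> T (\<lambda>e. fst (cay e))))"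
proof -
  note wf = good_wf[OF good]
  have ok: "graph_ok \<Gamma>" and conn: "based_connected \<Gamma>" and reads: "reads_gens \<Gamma>"
    using good by (auto simp: good_def)
  obtain m where m: "coset_map \<Gamma> m"
    using good by (auto simp: good_def)
  define U where "U = disj_union \<Gamma> T (\<lambda>e. fst (cay e))"
  define q where "q = (\<lambda>v. (P \<union> P\<inverse>)\<^sup>* `` {v})"
  have glue: "glue P \<Gamma> T (\<lambda>e. fst (cay e)) = map_pgraph q U"
    unfolding glue_eq U_def q_def ..
  have q_eq: "q x = q y" if "(x, y) \<in> P" for x y
    unfolding q_def quot_eq_iff using that by blast
  have letter: "lab e \<in> letters (X (fac e))" if "e \<in> T" for e
  proof -
    have "lab e \<in> letters XX"
      using T that graph_ok_letter[OF ok, of "ini e" "lab e" "ter e"] by auto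
    then have "lab e \<in> letters (X First) \<or> lab e \<in> letters (X Second)"
      by (auto simp: letters_def all_gens_def)
    then show ?thesis
      by (auto simp: fac_def factor_of_letter_def)
  qed
  have fac_eq: "fac e = i" if "e \<in> T" "lab e \<in> letters (X i)" for e i
    using letter[OF that(1)] letters_disjoint that(2) factor_exhaust_other[of "fac e" i] by metis
  have ini: "ini e \<in> verts (fst \<Gamma>)" "(ini e, lab e, ter e) \<in> edges (fst \<Gamma>)" "ter e \<in> verts (fst \<Gamma>)"
    if "e \<in> T" for e
    using T that wf unfolding wf_graph_def by auto
  have snd_cay: "snd (cay e) = {\<one>\<^bsub>F (fac e)\<^esub>} #>\<^bsub>F (fac e)\<^esub> \<one>\<^bsub>F (fac e)\<^esub>" for e
    by (simp add: cay_def)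
  have wfU: "wf_graph (fst U)"
    unfolding U_def cay_def using wf factor_cayley_wf by (intro disj_union_wf) auto
  have "finite T"
  proof (rule finite_subset[OF T finite_edges[OF wf]])
    show "finite (verts (fst \<Gamma>))"
      using ok by (simp add: graph_ok_def)
    show "lab ` edges (fst \<Gamma>) \<subseteq> letters XX"
    proof (intro image_subsetI)
      fix e assume "e \<in> edges (fst \<Gamma>)"
      then show "lab e \<in> letters XX"
        using graph_ok_letter[OF ok, of "ini e" "lab e" "ter e"] by simp
    qed
  qed
  then have finU: "finite (verts (fst U))"
    unfolding U_def disj_union_verts_eq using ok finite_rcosets
    by (auto simp: graph_ok_def cay_def)
  have U_letters: "a \<in> letters XX" if e: "(x, a, y) \<in> edges (fst U)" for x a y
  proof (cases x)
    case (Inl u)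
    then show ?thesis
      using e ok unfolding U_def graph_ok_def by auto
  next
    case (Inr p)
    then show ?thesis
      using e XX_letters by (cases p) (auto simp: U_def cay_def factor_cayley_edge)
  qed
  have okU: "graph_ok U"
    unfolding graph_ok_def using wfU finU U_letters ok by (auto simp: U_def graph_ok_def)
  define M where "M z = (case z of Inl v \<Rightarrow> m v | Inr (e, D) \<Rightarrow> lift (m (ini e)) (fac e) D)" for z
  have m_ini: "m (ini e) \<in> rcosets\<^bsub>G\<^esub> H" if "e \<in> T" for e
    using coset_map_vert[OF m] ini that by blast
  have triv: "m (ini e) #>\<^bsub>G\<^esub> gel (fac e) s = m (ini e)" if "e \<in> T" "s \<in> {\<one>\<^bsub>F (fac e)\<^esub>}" for e s
    using that m_ini coset_one by simp
  have lift_e: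
    "g \<in> carrier (F (fac e)) \<Longrightarrow>
      lift (m (ini e)) (fac e) ({\<one>\<^bsub>F (fac e)\<^esub>} #>\<^bsub>F (fac e)\<^esub> g) = m (ini e) #>\<^bsub>G\<^esub> gel (fac e) g"
    "D \<in> rcosets\<^bsub>F (fac e)\<^esub> {\<one>\<^bsub>F (fac e)\<^esub>} \<Longrightarrow> lift (m (ini e)) (fac e) D \<in> rcosets\<^bsub>G\<^esub> H"
    "(D, a, D') \<in> edges (fst (factor_cayley \<A> (fac e) {\<one>\<^bsub>F (fac e)\<^esub>})) \<Longrightarrow>
      lift (m (ini e)) (fac e) D' = lift (m (ini e)) (fac e) D #>\<^bsub>G\<^esub> el [a]"
    if "e \<in> T" for e g D D' a
    using lift_eq[OF subgroup_trivial m_ini[OF that] triv[OF that]]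
      lift_coset_map[OF subgroup_trivial m_ini[OF that] triv[OF that]] by blast+
  have mU: "coset_map U M"
    unfolding coset_map_def
  proof (intro conjI ballI allI impI)
    show "M (snd U) = H"
      using m by (simp add: M_def U_def coset_map_def)
    show "M z \<in> rcosets\<^bsub>G\<^esub> H" if z: "z \<in> verts (fst U)" for z
    proof (cases z)
      case (Inl v)
      then show ?thesis
        using z coset_map_vert[OF m] by (simp add: U_def M_def)
    next
      case (Inr p)
      then obtain e D where "z = Inr (e, D)" "e \<in> T" "D \<in> rcosets\<^bsub>F (fac e)\<^esub> {\<one>\<^bsub>F (fac e)\<^esub>}"
        using z by (cases p) (auto simp: U_def cay_def)
      then show ?thesis
        using lift_e(2) by (simp add: M_def)
    qed
    show "M y = M x #>\<^bsub>G\<^esub> el [a]" if e: "(x, a, y) \<in> edges (fst U)" for x a y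
    proof (cases x)
      case (Inl u)
      then obtain v where "y = Inl v" "(u, a, v) \<in> edges (fst \<Gamma>)"
        using e by (auto simp: U_def)
      then show ?thesis
        using Inl coset_map_edge[OF m] by (simp add: M_def)
    next
      case (Inr p)
      then obtain e0 D D' where "x = Inr (e0, D)" "y = Inr (e0, D')" "e0 \<in> T"
        "(D, a, D') \<in> edges (fst (factor_cayley \<A> (fac e0) {\<one>\<^bsub>F (fac e0)\<^esub>}))"
        using e by (cases p) (auto simp: U_def cay_def)
      then show ?thesis
        using lift_e(3) by (simp add: M_def)
    qed
  qed
  have MP: "M x = M y" if xy: "(x, y) \<in> P" for x y
  proof -
    obtain e where e: "e \<in> T" and
      "(x, y) = (Inl (ini e), Inr (e, snd (cay e))) \<or>
       (\<exists>d. (x, y) = (Inl (ter e), Inr (e, d)) \<and> (snd (cay e), lab e, d) \<in> edges (fst (cay e)))"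
      using xy unfolding P_def by blast
    then show ?thesis
    proof (elim disjE exE conjE)
      assume "(x, y) = (Inl (ini e), Inr (e, snd (cay e)))"
      then show ?thesis
        using e lift_e(1)[OF e, of "\<one>\<^bsub>F (fac e)\<^esub>"] coset_one[OF m_ini[OF e]]
        by (simp add: M_def snd_cay)
    next
      fix d assume d: "(x, y) = (Inl (ter e), Inr (e, d))" "(snd (cay e), lab e, d) \<in> edges (fst (cay e))"
      then have "lift (m (ini e)) (fac e) d = lift (m (ini e)) (fac e) (snd (cay e)) #>\<^bsub>G\<^esub> el [lab e]"
        using lift_e(3)[OF e] unfolding cay_def by blast
      then show ?thesis
        using e lift_e(1)[OF e, of "\<one>\<^bsub>F (fac e)\<^esub>"] coset_one[OF m_ini[OF e]]
          coset_map_edge[OF m ini(2)[OF e]] d(1)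
        by (simp add: M_def snd_cay)
    qed
  qed
  have Mq: "M x = M y" if "q x = q y" for x y
    using that MP quot_class_constant[of P M x y] unfolding q_def quot_eq_iff by blast
  have walk_q: "walk (fst (map_pgraph q U)) (q (Inl u)) w (q (Inl v))" if "walk (fst \<Gamma>) u w v" for u w v
    using walk_Inl[OF that] walk_map unfolding U_def by metis
  have q_base: "q (Inl (ini e)) = q (Inr (e, snd (cay e)))" if "e \<in> T" for e
    using that by (intro q_eq) (auto simp: P_def)
  have cover_U: "cover (fst U) (fac e) (Inr (e, {\<one>\<^bsub>F (fac e)\<^esub>} #>\<^bsub>F (fac e)\<^esub> g))
      (\<lambda>h. Inr (e, {\<one>\<^bsub>F (fac e)\<^esub>} #>\<^bsub>F (fac e)\<^esub> (g \<otimes>\<^bsub>F (fac e)\<^esub> h)))"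
    if "e \<in> T" "g \<in> carrier (F (fac e))" for e g
    using factor_cayley_cover[OF that(2)] that unfolding cover_def U_def cay_def by simp
  show "good (glue P \<Gamma> T (\<lambda>e. fst (cay e)))"
    unfolding glue good_def
  proof (intro conjI)
    show "graph_ok (map_pgraph q U)"
      using okU by (rule graph_ok_map)
    show "reads_gens (map_pgraph q U)"
      unfolding reads_gens_def
    proof
      fix y assume "y \<in> set ws"
      then obtain w where "walk (fst \<Gamma>) (snd \<Gamma>) w (snd \<Gamma>)" "el w = el y"
        using reads unfolding reads_gens_def by blast
      then show "\<exists>w. walk (fst (map_pgraph q U)) (snd (map_pgraph q U)) w (snd (map_pgraph q U)) \<and>
          el w = el y"
        using walk_q[of "snd \<Gamma>" w "snd \<Gamma>"] by (auto simp: U_def)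
    qed
    show "\<exists>m. coset_map (map_pgraph q U) m"
      using Mq by (intro coset_map_map[OF okU mU])
    show "based_connected (map_pgraph q U)"
    proof (rule based_connected_quot[OF wfU])
      fix z assume z: "z \<in> verts (fst U)"
      have snd_U: "snd U = Inl (snd \<Gamma>)"
        by (simp add: U_def)
      have "\<exists>w. walk (fst (map_pgraph q U)) (q (snd U)) w (q (Inl v))" if v: "v \<in> verts (fst \<Gamma>)" for v
        using conn v walk_q unfolding based_connected_def snd_U by meson
      moreover have "\<exists>w. walk (fst (map_pgraph q U)) (q (snd U)) w (q (Inr (e, D)))"
        if e: "e \<in> T" and D: "D \<in> verts (fst (cay e))" for e D
      proof -
        obtain g where g: "g \<in> carrier (F (fac e))" "D = {\<one>\<^bsub>F (fac e)\<^esub>} #>\<^bsub>F (fac e)\<^esub> g"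
          using D by (auto simp: cay_def rcosets_iff)
        then obtain w where w: "w \<in> words (X (fac e))" "g = fcl (fac e) w"
          using ex_fword by blast
        have "walk (fst U) (Inr (e, snd (cay e))) w (Inr (e, D))"
          using cover_walk_one[OF cover_U[OF e F.one_closed] w(1)] g w by (simp add: snd_cay)
        then have "walk (fst (map_pgraph q U)) (q (Inl (ini e))) w (q (Inr (e, D)))"
          unfolding q_base[OF e] by (rule walk_map)
        moreover obtain w' where "walk (fst (map_pgraph q U)) (q (snd U)) w' (q (Inl (ini e)))"
          using calculation conn ini(1)[OF e] walk_q unfolding based_connected_def snd_U by meson
        ultimately show ?thesis
          using walk_append[OF wf_map[OF wfU]] by metis
      qed
      ultimately show "\<exists>w. walk (fst (map_pgraph q U)) (q (snd U)) w (q z)"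
        using z unfolding U_def disj_union_verts_eq by auto
    qed
  qed
  show "weakly_saturated (fst (glue P \<Gamma> T (\<lambda>e. fst (cay e))))"
    unfolding glue weakly_saturated_def
  proof (intro allI ballI)
    fix i v assume "v \<in> col (fst (map_pgraph q U)) i"
    then obtain z where z: "z \<in> col (fst U) i" "v = q z"
      unfolding col_map[OF wfU] by blast
    then obtain a z' where za: "z \<in> verts (fst U)" "(z, a, z') \<in> edges (fst U)" "a \<in> letters (X i)"
      unfolding col_def by blast
    show "\<exists>u w c. w \<in> words (X i) \<and> walk (fst (map_pgraph q U)) u w v \<and>
        cover (fst (map_pgraph q U)) i u c"
    proof (cases z)
      case (Inl x)
      then have x: "x \<in> col (fst \<Gamma>) i"
        using za unfolding U_def col_def by auto
      define C where "C = comp i (fst \<Gamma>) x"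
      have C: "mono_component (X i) (fst \<Gamma>) C" "x \<in> verts C" "wf_graph C"
        unfolding C_def using comp_mono_component[OF wf x] comp_self[of x] comp_subgraph[OF wf] x
        by (auto simp: col_def subgraph_def)
      obtain e where e: "e \<in> T" "e \<in> edges C"
        using trans[OF C(1)] by blast
      then have "lab e \<in> letters (X i)" "ini e \<in> verts C"
        unfolding C_def comp_edges by auto
      then have i: "fac e = i"
        using fac_eq e by blast
      have conC: "connected_graph C" "lab ` edges C \<subseteq> letters (X i)" "verts C \<subseteq> verts (fst \<Gamma>)"
        "edges C \<subseteq> edges (fst \<Gamma>)"
        using C(1) by (auto simp: mono_component_def mono_connected_def subgraph_def)
      obtain w where w: "walk C (ini e) w x" "w \<in> words (X i)"
        using connected_walk[OF conC(1) \<open>ini e \<in> verts C\<close> C(2) conC(2)] .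
      have "walk (fst (map_pgraph q U)) (q (Inr (e, snd (cay e)))) w v"
        unfolding q_base[OF e(1), symmetric] z(2) Inl
        by (rule walk_q[OF walk_mono[OF w(1) conC(3,4)]])
      moreover have "\<exists>c. cover (fst U) i (Inr (e, snd (cay e))) c"
        using cover_U[OF e(1) F.one_closed] unfolding snd_cay i by blast
      ultimately show ?thesis
        using w(2) cover_map by metis
    next
      case (Inr p)
      then obtain e D D' where p: "z = Inr (e, D)" "e \<in> T" "D \<in> rcosets\<^bsub>F (fac e)\<^esub> {\<one>\<^bsub>F (fac e)\<^esub>}"
        "(D, a, D') \<in> edges (fst (factor_cayley \<A> (fac e) {\<one>\<^bsub>F (fac e)\<^esub>}))"
        using za by (cases p) (auto simp: U_def cay_def)
      then have i: "fac e = i"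
        using za(3) letters_disjoint factor_exhaust_other[of "fac e" i]
        unfolding factor_cayley_edge by metis
      obtain g where g: "g \<in> carrier (F (fac e))" "D = {\<one>\<^bsub>F (fac e)\<^esub>} #>\<^bsub>F (fac e)\<^esub> g"
        using p(3) by (auto simp: rcosets_iff)
      have "\<exists>c. cover (fst U) i z c"
        using cover_U[OF p(2) g(1)] unfolding p(1) g(2) i by blast
      then have "\<exists>c. cover (fst (map_pgraph q U)) i v c"
        unfolding z(2) using cover_map by metis
      moreover have "walk (fst (map_pgraph q U)) v [] v"
        using za(1) by (simp add: z(2))
      ultimately show ?thesis
        using words_simps(1) by metis
    qed
  qed
qed

text \<open>Edge sets of different components are disjoint, so one edge can be picked in each of them.\<close>

lemma step3_edges_choice:
  fixes \<Gamma> :: "('v, 'x) lgraph"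
  assumes "wf_graph \<Gamma>"
  obtains T where "T \<subseteq> edges \<Gamma>" "\<And>i C. mono_component (X i) \<Gamma> C \<Longrightarrow> \<exists>!e. e \<in> T \<and> e \<in> edges C"
proof
  define T where "T = {e. \<exists>i C. mono_component (X i) \<Gamma> C \<and> e = (SOME e. e \<in> edges C)}"
  have some: "(SOME e. e \<in> edges C) \<in> edges C" if "mono_component (X i) \<Gamma> C" for i C
    using that by (auto simp: mono_component_def mono_connected_def intro: someI_ex)
  have sub: "edges C \<subseteq> edges \<Gamma>" "lab ` edges C \<subseteq> letters (X i)" "wf_graph C"
    if "mono_component (X i) \<Gamma> C" for i C
    using that by (auto simp: mono_component_def mono_connected_def subgraph_def)
  show "T \<subseteq> edges \<Gamma>"
    unfolding T_def using some sub(1) by blast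
  fix i C assume C: "mono_component (X i) \<Gamma> C"
  show "\<exists>!e. e \<in> T \<and> e \<in> edges C"
  proof (rule ex1I)
    show "(SOME e. e \<in> edges C) \<in> T \<and> (SOME e. e \<in> edges C) \<in> edges C"
      using some[OF C] C unfolding T_def by blast
    fix e assume e: "e \<in> T \<and> e \<in> edges C"
    then obtain k D where D: "mono_component (X k) \<Gamma> D" "e = (SOME e. e \<in> edges D)"
      unfolding T_def by blast
    then have eD: "e \<in> edges D"
      using some by simp
    then have "lab e \<in> letters (X k)" "lab e \<in> letters (X i)"
      using sub(2)[OF D(1)] sub(2)[OF C] e by auto
    then have "k = i"
      using letters_disjoint factor_exhaust_other[of k i] by metis
    moreover have "ini e \<in> verts C" "ini e \<in> verts D"
      using e eD sub(3)[OF C] sub(3)[OF D(1)] by (auto simp: wf_graph_def)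
    ultimately have "C = D"
      using mono_component_eq_comp(1)[OF assms] C D(1) by metis
    then show "e = (SOME e. e \<in> edges C)"
      using D by simp
  qed
qed

lemma step3_good:
  assumes "good \<Gamma>" "step3 \<A> \<Gamma> \<Gamma>'"
  shows "good \<Gamma>'" "weakly_saturated (fst \<Gamma>')" "det (fst \<Gamma>')"
proof -
  let ?P = "\<lambda>T. \<Union>e\<in>T. let i = factor_of_letter \<A> (lab e); (Cay, c) = factor_cayley \<A> i {\<one>\<^bsub>F i\<^esub>} in
            {(Inl (ini e), Inr (e, c))} \<union> {(Inl (ter e), Inr (e, d)) |d. (c, lab e, d) \<in> edges Cay}"
  let ?\<Delta> = "\<lambda>e. let i = factor_of_letter \<A> (lab e) in fst (factor_cayley \<A> i {\<one>\<^bsub>F i\<^esub>})"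
  obtain T where T: "T \<subseteq> edges (fst \<Gamma>)"
    "\<And>i C. mono_component (X i) (fst \<Gamma>) C \<Longrightarrow> \<exists>!e. e \<in> T \<and> e \<in> edges C"
    and ex: "exhausts fold_step (glue (?P T) \<Gamma> T ?\<Delta>) \<Gamma>'"
    using assms(2) unfolding step3_def by blast
  have "good (glue (?P T) \<Gamma> T ?\<Delta>) \<and> weakly_saturated (fst (glue (?P T) \<Gamma> T ?\<Delta>))"
    using glue_cayley_good[OF assms(1) T] by (simp add: Let_def case_prod_beta)
  then have "good \<Gamma>' \<and> weakly_saturated (fst \<Gamma>')"
    by (rule exhausts_invariant[OF ex, where Q = "\<lambda>\<Gamma>. good \<Gamma> \<and> weakly_saturated (fst \<Gamma>)"])
      (use fold_step_good fold_step_weakly_saturated in blast)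
  then show "good \<Gamma>'" "weakly_saturated (fst \<Gamma>')"
    by auto
  show "det (fst \<Gamma>')"
    using ex by (intro no_fold_det) (simp add: exhausts_def)
qed

lemma step3_exists:
  fixes \<Gamma> :: "('v, 'x) pgraph"
  assumes "good \<Gamma>"
  shows "\<exists>\<Gamma>'. step3 \<A> \<Gamma> \<Gamma>'"
proof -
  let ?P = "\<lambda>T. \<Union>e\<in>T. let i = factor_of_letter \<A> (lab e); (Cay, c) = factor_cayley \<A> i {\<one>\<^bsub>F i\<^esub>} in
            {(Inl (ini e), Inr (e, c))} \<union> {(Inl (ter e), Inr (e, d)) |d. (c, lab e, d) \<in> edges Cay}"
  let ?\<Delta> = "\<lambda>e. let i = factor_of_letter \<A> (lab e) in fst (factor_cayley \<A> i {\<one>\<^bsub>F i\<^esub>})"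
  obtain T where T: "T \<subseteq> edges (fst \<Gamma>)"
    "\<And>i C. mono_component (X i) (fst \<Gamma>) C \<Longrightarrow> \<exists>!e. e \<in> T \<and> e \<in> edges C"
    using step3_edges_choice[OF good_wf[OF assms]] by blast
  have "good (glue (?P T) \<Gamma> T ?\<Delta>)"
    using glue_cayley_good(1)[OF assms T] by (simp add: Let_def case_prod_beta)
  then obtain \<Gamma>' where "exhausts fold_step (glue (?P T) \<Gamma> T ?\<Delta>) \<Gamma>'"
    using fold_exists by blast
  then show ?thesis
    unfolding step3_def using T by blast
qed


subsection \<open>Identifying the two actions of \<open>A\<close>\<close>

definition step4_pairs :: "('v, 'x) pgraph \<Rightarrow> ('v \<times> 'v) set" where
  "step4_pairs \<Gamma> = {(t1, t2) |t1 t2 v p1 p2. v \<in> bichromatic \<A> (fst \<Gamma>) \<and>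
    path (fst \<Gamma>) v p1 t1 \<and> path (fst \<Gamma>) v p2 t2 \<and> t1 \<noteq> t2 \<and>
    label p1 \<in> words (gens \<A> First) \<and> label p2 \<in> words (gens \<A> Second) \<and>
    elt \<A> (label p1) \<in> A_in_G \<A> \<and> elt \<A> (label p2) \<in> A_in_G \<A> \<and>
    elt \<A> (label p1) = elt \<A> (label p2)}"

lemma step4_pairs_iff:
  "(t1, t2) \<in> step4_pairs \<Gamma> \<longleftrightarrow> t1 \<noteq> t2 \<and> (\<exists>v w1 w2. v \<in> bichromatic \<A> (fst \<Gamma>) \<and>
    walk (fst \<Gamma>) v w1 t1 \<and> walk (fst \<Gamma>) v w2 t2 \<and> w1 \<in> words (X First) \<and> w2 \<in> words (X Second) \<and>
    el w1 \<in> A_in_G \<A> \<and> el w1 = el w2)"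
proof
  assume "(t1, t2) \<in> step4_pairs \<Gamma>"
  then obtain v p1 p2 where "v \<in> bichromatic \<A> (fst \<Gamma>)" "path (fst \<Gamma>) v p1 t1" "path (fst \<Gamma>) v p2 t2"
    "t1 \<noteq> t2" "label p1 \<in> words (gens \<A> First)" "label p2 \<in> words (gens \<A> Second)"
    "el (label p1) \<in> A_in_G \<A>" "el (label p1) = el (label p2)"
    unfolding step4_pairs_def by blast
  then show "t1 \<noteq> t2 \<and> (\<exists>v w1 w2. v \<in> bichromatic \<A> (fst \<Gamma>) \<and>
    walk (fst \<Gamma>) v w1 t1 \<and> walk (fst \<Gamma>) v w2 t2 \<and> w1 \<in> words (X First) \<and> w2 \<in> words (X Second) \<and>
    el w1 \<in> A_in_G \<A> \<and> el w1 = el w2)"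
    using path_walk by metis
next
  assume "t1 \<noteq> t2 \<and> (\<exists>v w1 w2. v \<in> bichromatic \<A> (fst \<Gamma>) \<and>
    walk (fst \<Gamma>) v w1 t1 \<and> walk (fst \<Gamma>) v w2 t2 \<and> w1 \<in> words (X First) \<and> w2 \<in> words (X Second) \<and>
    el w1 \<in> A_in_G \<A> \<and> el w1 = el w2)"
  then show "(t1, t2) \<in> step4_pairs \<Gamma>"
    unfolding step4_pairs_def walk_iff_path by fastforce
qed

text \<open>The identified vertices are reached from one vertex by words that represent the same element of
  the amalgam, so they lie over the same coset. A new bichromatic vertex is the class of
  an identified vertex, that is, of a translate under \<open>A\<close> of an old bichromatic vertex; here the
  embedding of the factors is used.\<close>

lemma step4_quot_good:
  assumes good: "good \<Gamma>" and ws: "weakly_saturated (fst \<Gamma>)" and "det (fst \<Gamma>)"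
  shows "good (quot_pgraph (step4_pairs \<Gamma>) \<Gamma>)"
    "weakly_saturated (fst (quot_pgraph (step4_pairs \<Gamma>) \<Gamma>))"
    "weakly_compatible (fst (quot_pgraph (step4_pairs \<Gamma>) \<Gamma>))"
proof -
  note wf = good_wf[OF good]
  have ok: "graph_ok \<Gamma>"
    using good by (simp add: good_def)
  have sat: "saturated (fst \<Gamma>)"
    using ws assms(3) by (rule weakly_saturated_det)
  obtain m where m: "coset_map \<Gamma> m"
    using good by (auto simp: good_def)
  define P where "P = step4_pairs \<Gamma>"
  define q where "q = (\<lambda>v. (P \<union> P\<inverse>)\<^sup>* `` {v})"
  have quot: "quot_pgraph P \<Gamma> = map_pgraph q \<Gamma>"
    by (simp add: quot_pgraph_def q_def)
  have mP: "m x = m y" if "(x, y) \<in> P" for x y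
    using that coset_map_walk[OF ok m] unfolding P_def step4_pairs_iff by metis
  have mq: "m x = m y" if "q x = q y" for x y
    using that mP quot_class_constant[of P m x y] unfolding q_def quot_eq_iff by blast
  show "good (quot_pgraph (step4_pairs \<Gamma>) \<Gamma>)"
    using mq unfolding P_def[symmetric] quot by (intro good_map[OF good m])
  show "weakly_saturated (fst (quot_pgraph (step4_pairs \<Gamma>) \<Gamma>))"
    unfolding P_def[symmetric] quot by (rule weakly_saturated_map[OF wf ws])
  have compat: "compat (fst (map_pgraph q \<Gamma>)) (q b)" if b: "b \<in> bichromatic \<A> (fst \<Gamma>)" for b
    unfolding compat_def
  proof (intro ballI)
    fix a x y assume a: "a \<in> carrier AA" "x \<in> \<phi> First a" "y \<in> \<phi> Second a"
    have w: "x \<in> words (X First)" "y \<in> words (X Second)"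
      using \<phi>_word a by blast+
    obtain t1 t2 where t: "walk (fst \<Gamma>) b x t1" "walk (fst \<Gamma>) b y t2"
      using sat b w cover_walk_one unfolding saturated_def bichromatic_iff by meson
    have "q t1 = q t2"
    proof (cases "t1 = t2")
      case False
      moreover have "el x = el y" "el x \<in> A_in_G \<A>"
        using elt_\<phi>[OF a] A_in_G_iff[of "el x" First] a by auto
      ultimately have "(t1, t2) \<in> P"
        unfolding P_def step4_pairs_iff using b t w by blast
      then show ?thesis
        unfolding q_def quot_eq_iff by blast
    qed simp
    then show "\<exists>t. walk (fst (map_pgraph q \<Gamma>)) (q b) x t \<and> walk (fst (map_pgraph q \<Gamma>)) (q b) y t"
      using t walk_map by metis
  qed
  show "weakly_compatible (fst (quot_pgraph (step4_pairs \<Gamma>) \<Gamma>))"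
    unfolding P_def[symmetric] quot weakly_compatible_def
  proof
    fix v assume "v \<in> bichromatic \<A> (fst (map_pgraph q \<Gamma>))"
    then have "v \<in> q ` col (fst \<Gamma>) First" "v \<in> q ` col (fst \<Gamma>) Second"
      unfolding bichromatic_iff col_map[OF wf] by auto
    then obtain x y where xy: "x \<in> col (fst \<Gamma>) First" "v = q x" "y \<in> col (fst \<Gamma>) Second" "v = q y"
      by blast
    have "\<exists>b k w. b \<in> bichromatic \<A> (fst \<Gamma>) \<and> w \<in> words (X k) \<and> el w \<in> A_in_G \<A> \<and> walk (fst \<Gamma>) b w x"
    proof (cases "x = y")
      case True
      then have "x \<in> bichromatic \<A> (fst \<Gamma>)" "x \<in> verts (fst \<Gamma>)"
        using xy unfolding bichromatic_iff2[of x _ First] by (auto simp: col_def)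
      moreover have "el [] \<in> A_in_G \<A>"
      proof -
        have "[] \<in> \<phi> First \<one>\<^bsub>AA\<^esub>"
          using fmem_self[of "[]" First] by (simp add: fone)
        then show ?thesis
          unfolding A_in_G_iff[of _ First] by blast
      qed
      ultimately show ?thesis
        using words_simps(1) walk.simps(1) by metis
    next
      case False
      then obtain z where "(x, z) \<in> P \<union> P\<inverse>"
        using xy(2,4) quot_eq_iff[of P x y] unfolding q_def by (metis converse_rtranclE)
      then show ?thesis
        unfolding P_def Un_iff converse_iff step4_pairs_iff by metis
    qed
    then obtain b k w where b: "b \<in> bichromatic \<A> (fst \<Gamma>)" "w \<in> words (X k)" "el w \<in> A_in_G \<A>"
      "walk (fst \<Gamma>) b w x"
      by blast
    then obtain a where a: "a \<in> carrier AA" "fcl k w = \<phi> k a"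
      using elt_in_A_iff by (auto simp: AF_image)
    then have "w \<in> \<phi> k a"
      using fmem_self[OF b(2)] by simp
    moreover have "walk (fst (map_pgraph q \<Gamma>)) (q b) w v"
      unfolding xy(2) by (rule walk_map[OF b(4)])
    ultimately show "\<exists>b i a x. a \<in> carrier AA \<and> x \<in> \<phi> i a \<and> walk (fst (map_pgraph q \<Gamma>)) b x v \<and>
        compat (fst (map_pgraph q \<Gamma>)) b"
      using a(1) compat[OF b(1)] by blast
  qed
qed

text \<open>The graphs after step 4. They stay of this kind during step 5.\<close>

definition is_precover :: "('v, 'x) pgraph \<Rightarrow> bool" where
  "is_precover \<Gamma> \<longleftrightarrow> good \<Gamma> \<and> det (fst \<Gamma>) \<and> saturated (fst \<Gamma>) \<and> compatible (fst \<Gamma>)"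

lemma step4_pre:
  assumes "good \<Gamma>" "weakly_saturated (fst \<Gamma>)" "det (fst \<Gamma>)" "step4 \<A> \<Gamma> \<Gamma>'"
  shows "is_precover \<Gamma>'"
proof -
  have ex: "exhausts fold_step (quot_pgraph (step4_pairs \<Gamma>) \<Gamma>) \<Gamma>'"
    using assms(4) unfolding step4_def step4_pairs_def .
  have "good \<Gamma>' \<and> weakly_saturated (fst \<Gamma>') \<and> weakly_compatible (fst \<Gamma>')"
    by (rule exhausts_invariant[OF ex])
      (use step4_quot_good[OF assms(1-3)] fold_step_good fold_step_weakly_saturated
        fold_step_weakly_compatible in blast)+
  moreover have "det (fst \<Gamma>')"
    using ex by (intro no_fold_det) (simp add: exhausts_def)
  ultimately show ?thesis
    unfolding is_precover_def using weakly_saturated_det weakly_compatible_det good_wf by blast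
qed

lemma step4_exists:
  assumes "good \<Gamma>" "weakly_saturated (fst \<Gamma>)" "det (fst \<Gamma>)"
  shows "\<exists>\<Gamma>'. step4 \<A> \<Gamma> \<Gamma>'"
  using fold_exists[OF step4_quot_good(1)[OF assms]] unfolding step4_def step4_pairs_def .

end

section \<open>Pre-covers as graphs\<close>

lemma edge_set_eqI: "(\<And>x a y. (x, a, y) \<in> E \<longleftrightarrow> (x, a, y) \<in> E') \<Longrightarrow> E = E'"
  by auto

context amalgam
begin

text \<open>The action of a factor by reading words. After step 4 all words that represent \<open>g\<close> lead from
  \<open>v\<close> to the same vertex (\<open>walk_act\<close>).\<close>

definition gact :: "('v, 'x) lgraph \<Rightarrow> factor \<Rightarrow> 'v \<Rightarrow> 'x word set \<Rightarrow> 'v" where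
  "gact \<Gamma> i v g = (SOME u. \<exists>w\<in>g. walk \<Gamma> v w u)"

end

locale precover_graph = stallings_input \<A> ws for \<A> :: "('a, 'x) amalgam" and ws +
  fixes \<Gamma> :: "('v, 'x) pgraph"
  assumes pre: "is_precover \<Gamma>"
begin

abbreviation "VV \<equiv> verts (fst \<Gamma>)"
abbreviation "EE \<equiv> edges (fst \<Gamma>)"
abbreviation "v0 \<equiv> snd \<Gamma>"
abbreviation "C i \<equiv> col (fst \<Gamma>) i"
abbreviation "B \<equiv> bichromatic \<A> (fst \<Gamma>)"
abbreviation "act \<equiv> gact (fst \<Gamma>)"

lemma good: "good \<Gamma>" and dt: "det (fst \<Gamma>)" and sat: "saturated (fst \<Gamma>)" and cmp: "compatible (fst \<Gamma>)"
  using pre by (auto simp: is_precover_def)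

lemma wf: "wf_graph (fst \<Gamma>)"
  using good by (rule good_wf)

lemma ok: "graph_ok \<Gamma>"
  using good by (simp add: good_def)

lemma v0_vert: "v0 \<in> VV"
  using ok by (simp add: graph_ok_def)

lemma finite_VV: "finite VV"
  using ok by (simp add: graph_ok_def)

lemma col_vert: "v \<in> C i \<Longrightarrow> v \<in> VV"
  by (simp add: col_def)

lemma walk_act:
  assumes "v \<in> C i" "w \<in> words (X i)"
  shows "walk (fst \<Gamma>) v w u \<longleftrightarrow> u = act i v (fcl i w)"
proof -
  obtain c where c: "cover (fst \<Gamma>) i v c"
    using sat assms unfolding saturated_def by blast
  have "walk (fst \<Gamma>) v w' u' \<longleftrightarrow> u' = c (fcl i w)" if "w' \<in> fcl i w" for w' u'
  proof -
    have "w' \<in> words (X i)" "fcl i w = fcl i w'"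
      using fcl_of_mem[of "fcl i w" i w'] assms that by auto
    then show ?thesis
      using cover_walk_one[OF c, of w'] det_walk[OF dt] by metis
  qed
  then have "act i v (fcl i w) = c (fcl i w)" "walk (fst \<Gamma>) v w u \<longleftrightarrow> u = c (fcl i w)"
    using fmem_self[OF assms(2)] unfolding gact_def by auto
  then show ?thesis by simp
qed

lemma act_walk: "v \<in> C i \<Longrightarrow> w \<in> words (X i) \<Longrightarrow> walk (fst \<Gamma>) v w (act i v (fcl i w))"
  by (simp add: walk_act)

lemma act_col: "v \<in> C i \<Longrightarrow> g \<in> carrier (F i) \<Longrightarrow> act i v g \<in> C i"
  using ex_fword[of g i] act_walk walk_col[OF wf] by metis

sublocale P: precover \<A> "\<lambda>i. col (fst \<Gamma>) i" "gact (fst \<Gamma>)"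
proof
  show "v \<in> C i \<Longrightarrow> g \<in> carrier (F i) \<Longrightarrow> act i v g \<in> C i" for v i g
    by (rule act_col)
  show one: "act i v \<one>\<^bsub>F i\<^esub> = v" if "v \<in> C i" for v i
    using walk_act[OF that, of "[]" v] col_vert[OF that] by (simp add: fone)
  show "act i v (g \<otimes>\<^bsub>F i\<^esub> h) = act i (act i v g) h"
    if v: "v \<in> C i" and g: "g \<in> carrier (F i)" and h: "h \<in> carrier (F i)" for v i g h
  proof -
    obtain x y where xy: "x \<in> words (X i)" "g = fcl i x" "y \<in> words (X i)" "h = fcl i y"
      using ex_fword[OF g] ex_fword[OF h] by blast
    then have "walk (fst \<Gamma>) v (x @ y) (act i (act i v g) h)"
      using act_walk[OF v, of x] act_walk[OF act_col[OF v g], of y]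
      unfolding walk_append[OF wf] by blast
    then have "act i (act i v g) h = act i v (fcl i (x @ y))"
      using walk_act[OF v, of "x @ y"] xy by simp
    then show ?thesis
      using xy by (simp add: fmult)
  qed
  show "act First v (\<phi> First a) = act Second v (\<phi> Second a)"
    if v: "v \<in> C First" "v \<in> C Second" and a: "a \<in> carrier AA" for v a
  proof -
    obtain x y where xy: "x \<in> \<phi> First a" "y \<in> \<phi> Second a"
      using ex_\<phi>_word[OF a] by blast
    have "v \<in> B"
      using v bichromatic_iff2[of v "fst \<Gamma>" First] by simp
    then obtain t where "walk (fst \<Gamma>) v x t" "walk (fst \<Gamma>) v y t"
      using cmp xy a unfolding compatible_def compat_def by blast
    then show ?thesis
      using walk_act[OF v(1), of x t] walk_act[OF v(2), of y t] \<phi>_word[OF a] xy by auto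
  qed
qed

lemma act_act_inv:
  assumes "v \<in> C i" "g \<in> carrier (F i)"
  shows "act i (act i v g) (inv\<^bsub>F i\<^esub> g) = v"
  using assms by (simp add: P.act_mult[symmetric])

lemma run_walk:
  assumes "walk (fst \<Gamma>) v w u" "v \<in> C k"
  shows "P.run w (v, []) = (u, [])"
  using assms
proof (induction w arbitrary: v k)
  case (Cons a w)
  then obtain t where t: "(v, a, t) \<in> EE" "walk (fst \<Gamma>) t w u"
    by auto
  obtain i where i: "a \<in> letters (X i)"
    using graph_ok_letter[OF ok t(1)] XX_letters by blast
  then have col: "v \<in> C i" "t \<in> C i"
    using colI[OF wf t(1)] by auto
  have "walk (fst \<Gamma>) v [a] t"
    using t(1) col_vert[OF col(2)] by auto
  then have "P.step a (v, []) = (t, [])"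
    using i col walk_act[of v i "[a]" t] by (simp add: P.step_def P.factor_of_letter_eq[of a i])
  then show ?case
    using Cons.IH[OF t(2) col(2)] by simp
qed simp

lemma connected: "v \<in> VV \<Longrightarrow> \<exists>w. walk (fst \<Gamma>) v0 w v"
  using good by (auto simp: good_def based_connected_def)

lemma ex_col: "(u, a, v) \<in> EE \<Longrightarrow> \<exists>i. a \<in> letters (X i) \<and> u \<in> C i \<and> v \<in> C i"
  using graph_ok_letter[OF ok] XX_letters colI[OF wf] by metis

lemma v0_col_or_trivial: "(\<exists>k. v0 \<in> C k) \<or> (VV = {v0} \<and> EE = {})"
proof (cases "\<exists>k. v0 \<in> C k")
  case False
  have VV: "VV = {v0}"
  proof -
    have "v = v0" if v: "v \<in> VV" for v
    proof -
      obtain w where w: "walk (fst \<Gamma>) v0 w v"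
        using connected[OF v] by blast
      show ?thesis
      proof (cases w)
        case (Cons a w')
        then obtain t where "(v0, a, t) \<in> EE"
          using w by auto
        then show ?thesis
          using ex_col False by metis
      qed (use w in simp)
    qed
    then show ?thesis
      using v0_vert by blast
  qed
  have "e \<notin> EE" for e
  proof
    assume "e \<in> EE"
    then have "(ini e, lab e, ter e) \<in> EE"
      by simp
    then show False
      using ex_col wf_edge[OF wf] VV False by (metis singletonD)
  qed
  then show ?thesis
    using VV by blast
qed blast

text \<open>In the extended action \<open>H\<close> fixes the base point, because its generators can be read there as
  closed walks.\<close>

lemma run_H:
  assumes "v0 \<in> C k" "w \<in> words XX" "el w \<in> H"
  shows "P.run w (v0, []) = (v0, [])"
proof -
  have valid: "P.valid (v0, [])"
    using assms by auto
  have gen: "\<exists>w'. walk (fst \<Gamma>) v0 w' v0 \<and> el w' = y" if "y \<in> el ` set ws" for y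
    using that good unfolding good_def reads_gens_def by blast
  have "\<forall>w\<in>words XX. el w = h \<longrightarrow> P.run w (v0, []) = (v0, [])" if "h \<in> generate G (el ` set ws)" for h
    using that
  proof (induction rule: generate.induct)
    case one
    show ?case
    proof (intro ballI impI)
      fix w assume "w \<in> words XX" "el w = \<one>\<^bsub>G\<^esub>"
      then have "P.run w (v0, []) = P.run [] (v0, [])"
        using valid by (intro P.run_eqI) (auto simp: elt_one)
      then show "P.run w (v0, []) = (v0, [])" by simp
    qed
  next
    case (incl h)
    obtain w' where w': "walk (fst \<Gamma>) v0 w' v0" "el w' = h"
      using gen[OF incl] by blast
    show ?case
    proof (intro ballI impI)
      fix w assume "w \<in> words XX" "el w = h"
      then have "P.run w (v0, []) = P.run w' (v0, [])"
        using valid w' walk_words[OF ok] by (intro P.run_eqI) auto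
      then show "P.run w (v0, []) = (v0, [])"
        using run_walk[OF w'(1) assms(1)] by simp
    qed
  next
    case (inv h)
    obtain w' where w': "walk (fst \<Gamma>) v0 w' v0" "el w' = h"
      using gen[OF inv] by blast
    have w'w: "w' \<in> words XX"
      using walk_words[OF ok w'(1)] .
    show ?case
    proof (intro ballI impI)
      fix w assume "w \<in> words XX" "el w = inv\<^bsub>G\<^esub> h"
      then have "P.run w (v0, []) = P.run (winv w') (v0, [])"
        using valid w' w'w by (intro P.run_eqI) (auto simp: elt_inv)
      then show "P.run w (v0, []) = (v0, [])"
        using run_walk[OF walk_inv[OF wf w'(1)] assms(1)] by simp
    qed
  next
    case (eng h1 h2)
    have "h1 \<in> carrier G" "h2 \<in> carrier G"
      using eng.hyps H_carrier unfolding H_def by auto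
    then obtain w1 w2 where w12: "w1 \<in> words XX" "h1 = el w1" "w2 \<in> words XX" "h2 = el w2"
      unfolding gcarrier by blast
    show ?case
    proof (intro ballI impI)
      fix w assume "w \<in> words XX" "el w = h1 \<otimes>\<^bsub>G\<^esub> h2"
      then have "P.run w (v0, []) = P.run (w1 @ w2) (v0, [])"
        using valid w12 by (intro P.run_eqI) (auto simp: elt_mult)
      then show "P.run w (v0, []) = (v0, [])"
        using eng.IH w12 by simp
    qed
  qed
  then show ?thesis
    using assms unfolding H_def by blast
qed

text \<open>If walks to \<open>u\<close> and \<open>v\<close> represent the same coset, then the extended action leads from the base
  point to the same state along both, and these states are \<open>u\<close> and \<open>v\<close>. So a pre-cover embeds in the
  relative Cayley graph.\<close>

lemma coset_map_inj:
  assumes m: "coset_map \<Gamma> m" and "u \<in> VV" "v \<in> VV" "m u = m v"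
  shows "u = v"
proof (cases "\<exists>k. v0 \<in> C k")
  case True
  then obtain k where k: "v0 \<in> C k" by blast
  obtain w w' where w: "walk (fst \<Gamma>) v0 w u" "walk (fst \<Gamma>) v0 w' v"
    using connected assms by blast
  have words: "w \<in> words XX" "w' \<in> words XX"
    using w walk_words[OF ok] by auto
  have "H #>\<^bsub>G\<^esub> el w = H #>\<^bsub>G\<^esub> el w'"
    using coset_map_walk[OF ok m w(1)] coset_map_walk[OF ok m w(2)] assms(4) m
    by (simp add: coset_map_def)
  then have "el w \<otimes>\<^bsub>G\<^esub> inv\<^bsub>G\<^esub> (el w') \<in> H"
    using words by (simp add: coset_eq_iff)
  then have "el (w @ winv w') \<in> H"
    using words by (simp add: elt_mult[symmetric] elt_inv)
  then have "P.run (w @ winv w') (v0, []) = (v0, [])"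
    using run_H[OF k, of "w @ winv w'"] words by simp
  then have run_back: "P.run (winv w') (u, []) = (v0, [])"
    using run_walk[OF w(1) k] by simp
  have "\<exists>i. u \<in> C i"
    using w(1) k
  proof (cases w rule: rev_cases)
    case (snoc x a)
    then obtain t where "(t, a, u) \<in> EE"
      using w(1) by (auto simp: walk_snoc[OF wf])
    then show ?thesis
      using ex_col by blast
  qed auto
  then have "P.run (winv w' @ w') (u, []) = P.run [] (u, [])"
    using words elt_winv_cancel[of "winv w'"] by (intro P.run_eqI) (auto simp: elt_one)
  then have "P.run w' (v0, []) = (u, [])"
    using run_back by simp
  then show ?thesis
    using run_walk[OF w(2) k] by simp
next
  case False
  then show ?thesis
    using v0_col_or_trivial assms by auto
qed

lemma comp_verts_act:
  assumes "v \<in> C i"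
  shows "verts (comp i (fst \<Gamma>) v) = act i v ` carrier (F i)"
proof (intro equalityI subsetI)
  fix u assume "u \<in> verts (comp i (fst \<Gamma>) v)"
  then obtain w where "w \<in> words (X i)" "walk (fst \<Gamma>) v w u"
    unfolding comp_verts by blast
  then show "u \<in> act i v ` carrier (F i)"
    using walk_act[OF assms] by auto
next
  fix u assume "u \<in> act i v ` carrier (F i)"
  then obtain g where g: "g \<in> carrier (F i)" "u = act i v g"
    by blast
  then obtain w where "w \<in> words (X i)" "g = fcl i w"
    using ex_fword by blast
  then show "u \<in> verts (comp i (fst \<Gamma>) v)"
    unfolding comp_verts using act_walk[OF assms] g by blast
qed

lemma stabilizer_subgroup:
  assumes "v \<in> C i"
  shows "subgroup {g \<in> carrier (F i). act i v g = v} (F i)"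
proof (rule F.subgroupI)
  show "inv\<^bsub>F i\<^esub> g \<in> {g \<in> carrier (F i). act i v g = v}" if "g \<in> {g \<in> carrier (F i). act i v g = v}" for g
    using that act_act_inv[OF assms, of g] by auto
qed (use assms in \<open>auto simp: P.act_mult intro: exI[of _ "\<one>\<^bsub>F i\<^esub>"]\<close>)

text \<open>Orbits and stabilizers. With \<open>S\<close> the whole factor this describes components (\<open>comp_iso\<close>), with
  \<open>S\<close> the group \<open>A\<close> it counts the vertices that are bichromatic in a redundant component.\<close>

lemma orbit_coset:
  assumes v: "v \<in> C i" and S: "subgroup S (F i)" and h: "h \<in> S"
  shows "{g \<in> S. act i v g = act i v h} = {g \<in> S. act i v g = v} #>\<^bsub>F i\<^esub> h"
proof -
  note SC = subgroup.mem_carrier[OF S]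
  have "g \<in> S \<and> act i v g = act i v h \<longleftrightarrow> g \<in> {g \<in> S. act i v g = v} #>\<^bsub>F i\<^esub> h" for g
  proof
    assume g: "g \<in> S \<and> act i v g = act i v h"
    define k where "k = g \<otimes>\<^bsub>F i\<^esub> inv\<^bsub>F i\<^esub> h"
    have "k \<in> S" "g = k \<otimes>\<^bsub>F i\<^esub> h"
      using g h S SC by (auto simp: k_def F.m_assoc subgroup.m_closed subgroup.m_inv_closed)
    moreover have "act i v k = v"
      using g h v SC act_act_inv[OF v, of h] by (simp add: k_def P.act_mult)
    ultimately show "g \<in> {g \<in> S. act i v g = v} #>\<^bsub>F i\<^esub> h"
      by (auto simp: r_coset_def)
  next
    assume "g \<in> {g \<in> S. act i v g = v} #>\<^bsub>F i\<^esub> h"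
    then obtain k where "k \<in> S" "act i v k = v" "g = k \<otimes>\<^bsub>F i\<^esub> h"
      by (auto simp: r_coset_def)
    then show "g \<in> S \<and> act i v g = act i v h"
      using v h S SC by (simp add: P.act_mult subgroup.m_closed)
  qed
  then show ?thesis by blast
qed

lemma orbit_bij:
  assumes v: "v \<in> C i" and S: "subgroup S (F i)"
  shows "bij_betw (\<lambda>u. {g \<in> S. act i v g = u}) (act i v ` S)
    (rcosets\<^bsub>(F i)\<lparr>carrier := S\<rparr>\<^esub> {g \<in> S. act i v g = v})"
  unfolding bij_betw_def
proof
  show "inj_on (\<lambda>u. {g \<in> S. act i v g = u}) (act i v ` S)"
    by (rule inj_onI) blast
  show "(\<lambda>u. {g \<in> S. act i v g = u}) ` act i v ` S =
      rcosets\<^bsub>(F i)\<lparr>carrier := S\<rparr>\<^esub> {g \<in> S. act i v g = v}"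
    using orbit_coset[OF assms] by (auto simp: RCOSETS_def r_coset_def)
qed

lemma comp_iso:
  assumes v: "v \<in> C i"
  shows "(comp i (fst \<Gamma>) v, v) \<cong>\<^sub>p factor_cayley \<A> i {g \<in> carrier (F i). act i v g = v}"
proof -
  let ?K = "{g \<in> carrier (F i). act i v g = v}"
  define f where "f u = {g \<in> carrier (F i). act i v g = u}" for u
  have f: "f (act i v g) = ?K #>\<^bsub>F i\<^esub> g" if "g \<in> carrier (F i)" for g
    unfolding f_def using orbit_coset[OF v F.subgroup_self that] .
  have bij: "bij_betw f (verts (comp i (fst \<Gamma>) v)) (rcosets\<^bsub>F i\<^esub> ?K)"
    using orbit_bij[OF v F.subgroup_self] unfolding f_def comp_verts_act[OF v] by simp
  have edge: "(act i v g, a, u) \<in> edges (comp i (fst \<Gamma>) v) \<longleftrightarrow>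
      u = act i v (g \<otimes>\<^bsub>F i\<^esub> fcl i [a])" if "g \<in> carrier (F i)" "a \<in> letters (X i)" for g a u
  proof -
    have "act i v g \<in> verts (comp i (fst \<Gamma>) v)"
      using that comp_verts_act[OF v] by blast
    then have "(act i v g, a, u) \<in> edges (comp i (fst \<Gamma>) v) \<longleftrightarrow> (act i v g, a, u) \<in> EE"
      using that by (simp add: comp_edges)
    also have "\<dots> \<longleftrightarrow> walk (fst \<Gamma>) (act i v g) [a] u"
      using wf_edge(2)[OF wf, of "act i v g" a u] by auto
    also have "\<dots> \<longleftrightarrow> u = act i (act i v g) (fcl i [a])"
      using that v by (intro walk_act) auto
    finally show ?thesis
      using that v by (simp add: P.act_mult)
  qed
  have "map_pgraph f (comp i (fst \<Gamma>) v, v) = factor_cayley \<A> i ?K"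
  proof (rule prod_eqI)
    show "snd (map_pgraph f (comp i (fst \<Gamma>) v, v)) = snd (factor_cayley \<A> i ?K)"
      using f[OF F.one_closed] v by simp
    show "fst (map_pgraph f (comp i (fst \<Gamma>) v, v)) = fst (factor_cayley \<A> i ?K)"
    proof (rule lgraph.equality)
      show "verts (fst (map_pgraph f (comp i (fst \<Gamma>) v, v))) = verts (fst (factor_cayley \<A> i ?K))"
        using bij by (simp add: bij_betw_def)
      have "(x, a, y) \<in> edges (fst (map_pgraph f (comp i (fst \<Gamma>) v, v))) \<longleftrightarrow>
          (x, a, y) \<in> edges (fst (factor_cayley \<A> i ?K))" for x a y
      proof
        assume "(x, a, y) \<in> edges (fst (map_pgraph f (comp i (fst \<Gamma>) v, v)))"
        then obtain s t where st: "x = f s" "y = f t" "(s, a, t) \<in> edges (comp i (fst \<Gamma>) v)"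
          unfolding map_edge_iff by auto
        then have "s \<in> verts (comp i (fst \<Gamma>) v)" "a \<in> letters (X i)"
          by (auto simp: comp_edges)
        then obtain g where g: "g \<in> carrier (F i)" "s = act i v g"
          unfolding comp_verts_act[OF v] by blast
        then have "t = act i v (g \<otimes>\<^bsub>F i\<^esub> fcl i [a])"
          using edge st(3) \<open>a \<in> letters (X i)\<close> by blast
        then show "(x, a, y) \<in> edges (fst (factor_cayley \<A> i ?K))"
          unfolding factor_cayley_edge using st g f \<open>a \<in> letters (X i)\<close> by auto
      next
        assume "(x, a, y) \<in> edges (fst (factor_cayley \<A> i ?K))"
        then obtain g where g: "g \<in> carrier (F i)" "x = ?K #>\<^bsub>F i\<^esub> g"
          "y = ?K #>\<^bsub>F i\<^esub> (g \<otimes>\<^bsub>F i\<^esub> fcl i [a])" "a \<in> letters (X i)"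
          unfolding factor_cayley_edge by blast
        then have "x = f (act i v g)" "y = f (act i v (g \<otimes>\<^bsub>F i\<^esub> fcl i [a]))"
          "(act i v g, a, act i v (g \<otimes>\<^bsub>F i\<^esub> fcl i [a])) \<in> edges (comp i (fst \<Gamma>) v)"
          using f edge by auto
        then show "(x, a, y) \<in> edges (fst (map_pgraph f (comp i (fst \<Gamma>) v, v)))"
          unfolding map_edge_iff by auto
      qed
      then show "edges (fst (map_pgraph f (comp i (fst \<Gamma>) v, v))) = edges (fst (factor_cayley \<A> i ?K))"
        by (rule edge_set_eqI)
    qed simp
  qed
  then show ?thesis
    using bij unfolding pgraph_iso_def bij_betw_def by auto
qed

lemma factor_cayley_det:
  assumes "subgroup K (F i)"
  shows "det (fst (factor_cayley \<A> i K))"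
  unfolding det_def factor_cayley_edge
proof (intro allI impI)
  fix u a v v'
  assume 1: "(\<exists>g\<in>carrier (F i). u = K #>\<^bsub>F i\<^esub> g \<and> v = K #>\<^bsub>F i\<^esub> (g \<otimes>\<^bsub>F i\<^esub> fcl i [a])) \<and>
      a \<in> letters (X i)"
    and 2: "(\<exists>g\<in>carrier (F i). u = K #>\<^bsub>F i\<^esub> g \<and> v' = K #>\<^bsub>F i\<^esub> (g \<otimes>\<^bsub>F i\<^esub> fcl i [a])) \<and>
      a \<in> letters (X i)"
  have "z = u #>\<^bsub>F i\<^esub> fcl i [a]"
    if "(\<exists>g\<in>carrier (F i). u = K #>\<^bsub>F i\<^esub> g \<and> z = K #>\<^bsub>F i\<^esub> (g \<otimes>\<^bsub>F i\<^esub> fcl i [a])) \<and>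
      a \<in> letters (X i)" for z
    using that F.coset_mult_assoc[OF subgroup.subset[OF assms]] by auto
  then show "v = v'"
    using 1 2 by metis
qed

text \<open>The subgroup in the definitions of redundant components and of completion is therefore always
  a stabilizer.\<close>

lemma iso_stabilizer:
  assumes v: "v \<in> C i" and K: "subgroup K (F i)"
    and iso: "(comp i (fst \<Gamma>) v, v) \<cong>\<^sub>p factor_cayley \<A> i K"
  shows "K = {g \<in> carrier (F i). act i v g = v}"
proof -
  obtain f where f: "inj_on f (verts (comp i (fst \<Gamma>) v))"
    "map_pgraph f (comp i (fst \<Gamma>) v, v) = factor_cayley \<A> i K"
    using iso unfolding pgraph_iso_def by auto
  have fv: "f v = K #>\<^bsub>F i\<^esub> \<one>\<^bsub>F i\<^esub>"
    using f(2) map_simps(2)[of f "(comp i (fst \<Gamma>) v, v)"] by simp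
  have act: "f (act i v g) = K #>\<^bsub>F i\<^esub> g" if g: "g \<in> carrier (F i)" for g
  proof -
    obtain w where w: "w \<in> words (X i)" "g = fcl i w"
      using ex_fword[OF g] by blast
    have "walk (comp i (fst \<Gamma>) v) v w (act i v g)"
      using comp_walk[OF wf comp_self[OF col_vert[OF v]] w(1)] act_walk[OF v w(1)] w(2) by simp
    then have "walk (fst (map_pgraph f (comp i (fst \<Gamma>) v, v))) (f v) w (f (act i v g))"
      by (intro walk_map) simp
    then have "walk (fst (factor_cayley \<A> i K)) (K #>\<^bsub>F i\<^esub> \<one>\<^bsub>F i\<^esub>) w (f (act i v g))"
      unfolding f(2) fv .
    moreover have "walk (fst (factor_cayley \<A> i K)) (K #>\<^bsub>F i\<^esub> \<one>\<^bsub>F i\<^esub>) w (K #>\<^bsub>F i\<^esub> g)"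
      using cover_walk_one[OF factor_cayley_cover[OF F.one_closed] w(1)] w by simp
    ultimately show ?thesis
      using det_walk[OF factor_cayley_det[OF K]] by blast
  qed
  have vv: "v \<in> verts (comp i (fst \<Gamma>) v)"
    using col_vert[OF v] by (rule comp_self)
  have "g \<in> K \<longleftrightarrow> act i v g = v" if g: "g \<in> carrier (F i)" for g
  proof -
    have "act i v g = v \<longleftrightarrow> f (act i v g) = f v"
      using f(1) vv comp_verts_act[OF v] g by (metis imageI inj_on_eq_iff)
    also have "\<dots> \<longleftrightarrow> K #>\<^bsub>F i\<^esub> g = K"
      using act[OF g] fv F.coset_mult_one[OF subgroup.subset[OF K]] by simp
    also have "\<dots> \<longleftrightarrow> g \<in> K"
      using F.coset_join1[OF _ g K] F.coset_join2[OF g K] by blast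
    finally show ?thesis by blast
  qed
  then show ?thesis
    using subgroup.subset[OF K] by blast
qed


lemma factor_walk_mono:
  assumes "wf_graph \<Gamma>'" "verts \<Gamma>' \<subseteq> VV" "edges \<Gamma>' \<subseteq> EE" "u \<in> verts \<Gamma>'" "w \<in> words (X i)"
    and "\<And>x a y. (x, a, y) \<in> EE \<Longrightarrow> a \<in> letters (X i) \<Longrightarrow> x \<in> verts \<Gamma>' \<Longrightarrow> (x, a, y) \<in> edges \<Gamma>'"
    and "walk (fst \<Gamma>) u w t"
  shows "walk \<Gamma>' u w t"
  using assms(4,5,7)
proof (induction w arbitrary: u)
  case (Cons a w)
  then obtain s where s: "(u, a, s) \<in> EE" "walk (fst \<Gamma>) s w t"
    by auto
  then have e: "(u, a, s) \<in> edges \<Gamma>'"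
    using assms(6)[OF s(1)] Cons.prems by auto
  then have "s \<in> verts \<Gamma>'"
    using wf_edge(2)[OF assms(1)] by blast
  then show ?case
    using Cons s e by auto
qed simp


subsection \<open>Removing redundant components\<close>

text \<open>
  A redundant component \<open>D\<close> with its data, and the graph \<open>\<Gamma>'\<close> without it. The condition on
  cardinalities says that the bichromatic vertices of \<open>D\<close> are exactly those of the orbit \<open>\<theta> A\<close>
  (\<open>D_bichromatic\<close>). The conditions on the base point enter in the form that it is not one of the
  vertices that get lost.
\<close>

context
  fixes i K \<theta> and \<Gamma>' :: "('v, 'x) pgraph" and D :: "('v, 'x) lgraph"
  assumes D: "mono_component (X i) (fst \<Gamma>) D"
    and K: "subgroup K (F i)" "K \<subseteq> AF i"
    and \<theta>: "\<theta> \<in> B \<inter> verts D"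
    and iso: "(D, \<theta>) \<cong>\<^sub>p factor_cayley \<A> i K"
    and card: "card (B \<inter> verts D) = card (rcosets\<^bsub>(F i)\<lparr>carrier := AF i\<rparr>\<^esub> K)"
    and base: "v0 \<in> verts D \<Longrightarrow> v0 \<in> B"
    and \<Gamma>': "\<Gamma>' = (\<lparr>verts = VV - (verts D - B), edges = EE - edges D\<rparr>, v0)"
begin

lemma \<theta>_col: "\<theta> \<in> C k"
  using \<theta> by (simp add: bichromatic_iff)

lemma D_comp: "D = comp i (fst \<Gamma>) \<theta>"
  using mono_component_eq_comp(1)[OF wf D] \<theta> by blast

lemma K_stab: "K = {g \<in> carrier (F i). act i \<theta> g = \<theta>}"
  using iso_stabilizer[OF \<theta>_col K(1)] iso D_comp by simp

lemma K_stab_A: "K = {g \<in> AF i. act i \<theta> g = \<theta>}"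
  using K_stab K(2) AF_carrier by blast

lemma D_verts: "verts D = act i \<theta> ` carrier (F i)"
  unfolding D_comp by (rule comp_verts_act[OF \<theta>_col])

lemma D_edges: "(x, a, y) \<in> edges D \<longleftrightarrow> (x, a, y) \<in> EE \<and> x \<in> verts D \<and> a \<in> letters (X i)"
  unfolding D_comp comp_edges by simp

lemma D_step: "x \<in> verts D \<Longrightarrow> (x, a, y) \<in> EE \<Longrightarrow> a \<in> letters (X i) \<Longrightarrow> y \<in> verts D"
  unfolding D_comp using comp_step[OF wf] .

lemma D_edge_ends: "(x, a, y) \<in> EE \<Longrightarrow> a \<in> letters (X i) \<Longrightarrow> x \<in> verts D \<longleftrightarrow> y \<in> verts D"
  using D_step wf_edge(3)[OF wf] linv_letters by metis

lemma D_bichromatic: "B \<inter> verts D = act i \<theta> ` AF i"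
proof (rule card_subset_eq[symmetric])
  show "finite (B \<inter> verts D)"
    using finite_VV by (auto simp: bichromatic_def)
  show "act i \<theta> ` AF i \<subseteq> B \<inter> verts D"
  proof
    fix u assume "u \<in> act i \<theta> ` AF i"
    then obtain a where a: "a \<in> carrier AA" "u = act i \<theta> (\<phi> i a)"
      by (auto simp: AF_image)
    then have "u = P.aact \<theta> a"
      using P.aact_eq \<theta>_col by metis
    then have "u \<in> C k" for k
      using P.aact_closed[OF \<theta>_col a(1)] by simp
    then show "u \<in> B \<inter> verts D"
      using a by (auto simp: D_verts bichromatic_iff)
  qed
  show "card (act i \<theta> ` AF i) = card (B \<inter> verts D)"
    using bij_betw_same_card[OF orbit_bij[OF \<theta>_col subgroup_AF]] card K_stab_A by simp
qed

lemma D_bichromatic_AF: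
  assumes "g \<in> carrier (F i)" "act i \<theta> g \<in> B"
  shows "g \<in> AF i"
proof -
  have "act i \<theta> g \<in> B \<inter> verts D"
    using assms by (auto simp: D_verts)
  then obtain b where b: "b \<in> AF i" "act i \<theta> g = act i \<theta> b"
    unfolding D_bichromatic by blast
  have bc: "b \<in> carrier (F i)"
    using b AF_carrier by blast
  have "act i \<theta> (g \<otimes>\<^bsub>F i\<^esub> inv\<^bsub>F i\<^esub> b) = \<theta>"
    using b bc assms act_act_inv[OF \<theta>_col bc] by (simp add: P.act_mult \<theta>_col)
  then have "g \<otimes>\<^bsub>F i\<^esub> inv\<^bsub>F i\<^esub> b \<in> AF i"
    using K_stab K(2) assms bc by auto
  then have "(g \<otimes>\<^bsub>F i\<^esub> inv\<^bsub>F i\<^esub> b) \<otimes>\<^bsub>F i\<^esub> b \<in> AF i"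
    using b subgroup_AF by (meson subgroup.m_closed)
  then show ?thesis
    using assms bc by (simp add: F.m_assoc)
qed

lemma \<Gamma>'_simps:
  "v \<in> verts (fst \<Gamma>') \<longleftrightarrow> v \<in> VV \<and> (v \<in> verts D \<longrightarrow> v \<in> B)"
  "(x, a, y) \<in> edges (fst \<Gamma>') \<longleftrightarrow> (x, a, y) \<in> EE \<and> (x, a, y) \<notin> edges D"
  "snd \<Gamma>' = v0"
  unfolding \<Gamma>' by auto

lemma \<Gamma>'_wf: "wf_graph (fst \<Gamma>')"
proof (rule wf_graphI)
  fix x a y assume "(x, a, y) \<in> edges (fst \<Gamma>')"
  then have e: "(x, a, y) \<in> EE" "(x, a, y) \<notin> edges D"
    unfolding \<Gamma>'_simps by auto
  have inv: "(y, linv a, x) \<in> EE" "(y, linv a, x) \<notin> edges D"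
    using wf_edge(3)[OF wf e(1)] e D_edge_ends[OF e(1)] unfolding D_edges by auto
  have "z \<in> B" if z: "(z, b, z') \<in> EE" "(z, b, z') \<notin> edges D" "z \<in> verts D" for z b z'
  proof -
    have "b \<notin> letters (X i)"
      using z unfolding D_edges by blast
    moreover obtain k where k: "b \<in> letters (X k)" "z \<in> C k"
      using ex_col[OF z(1)] by blast
    ultimately have "k = other i"
      using factor_exhaust_other[of k i] by auto
    moreover have "z \<in> C i"
      using mono_component_eq_comp(2)[OF wf D z(3)] .
    ultimately show ?thesis
      using k bichromatic_iff2[of z "fst \<Gamma>" i] by simp
  qed
  then show "x \<in> verts (fst \<Gamma>') \<and> y \<in> verts (fst \<Gamma>') \<and> (y, linv a, x) \<in> edges (fst \<Gamma>')"
    using e inv wf_edge[OF wf e(1)] unfolding \<Gamma>'_simps by blast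
qed

lemma \<Gamma>'_sub: "verts (fst \<Gamma>') \<subseteq> VV" "edges (fst \<Gamma>') \<subseteq> EE"
  unfolding \<Gamma>' by auto

lemma \<Gamma>'_base: "v0 \<in> verts (fst \<Gamma>')"
  using base v0_vert unfolding \<Gamma>'_simps by blast

lemma \<Gamma>'_walk_other:
  assumes "walk (fst \<Gamma>) u w t" "w \<in> words (X (other i))" "u \<in> verts (fst \<Gamma>')"
  shows "walk (fst \<Gamma>') u w t"
proof (rule factor_walk_mono[OF \<Gamma>'_wf \<Gamma>'_sub assms(3,2) _ assms(1)])
  fix x a y assume "(x, a, y) \<in> EE" "a \<in> letters (X (other i))"
  then show "(x, a, y) \<in> edges (fst \<Gamma>')"
    using letters_disjoint[of a i] unfolding \<Gamma>'_simps D_edges by blast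
qed

lemma \<theta>_vert: "\<theta> \<in> verts (fst \<Gamma>')"
  using \<theta> unfolding \<Gamma>'_simps by (auto simp: bichromatic_def)

lemma \<theta>_walk:
  assumes "a \<in> carrier AA" "x \<in> \<phi> i a" "y \<in> \<phi> (other i) a"
  shows "walk (fst \<Gamma>) \<theta> x (act i \<theta> (\<phi> i a))" "walk (fst \<Gamma>') \<theta> y (act i \<theta> (\<phi> i a))"
proof -
  have x: "x \<in> words (X i)" "fcl i x = \<phi> i a" and y: "y \<in> words (X (other i))" "fcl (other i) y = \<phi> (other i) a"
    using \<phi>_word assms by auto
  show "walk (fst \<Gamma>) \<theta> x (act i \<theta> (\<phi> i a))"
    using walk_act[OF \<theta>_col x(1)] x by simp
  have "act (other i) \<theta> (\<phi> (other i) a) = act i \<theta> (\<phi> i a)"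
    using P.aact_eq[OF \<theta>_col assms(1)] by metis
  then have "walk (fst \<Gamma>) \<theta> y (act i \<theta> (\<phi> i a))"
    using walk_act[OF \<theta>_col y(1)] y by simp
  then show "walk (fst \<Gamma>') \<theta> y (act i \<theta> (\<phi> i a))"
    using \<Gamma>'_walk_other y \<theta>_vert by blast
qed

text \<open>A walk that crosses the removed component enters and leaves it at vertices of \<open>\<theta> A\<close>. Since the
  stabilizer of \<open>\<theta>\<close> lies in \<open>A\<close>, the part inside the component represents an element of \<open>A\<close> and can
  be read in the other factor. For walks that end inside the component, the induction keeps track
  of the last passage at \<open>\<theta>\<close>.\<close>

lemma \<Gamma>'_retract:
  assumes "walk (fst \<Gamma>) v0 w v"
  shows "(v \<in> verts (fst \<Gamma>') \<longrightarrow> (\<exists>w'. walk (fst \<Gamma>') v0 w' v \<and> el w' = el w)) \<and>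
    (v \<in> verts D \<longrightarrow> (\<exists>w' x. walk (fst \<Gamma>') v0 w' \<theta> \<and> x \<in> words (X i) \<and> walk (fst \<Gamma>) \<theta> x v \<and>
      el (w' @ x) = el w))"
proof -
  have words: "w \<in> words XX" if "walk (fst \<Gamma>') u w v" for u w v
    using walk_words[OF ok walk_mono[OF that \<Gamma>'_sub]] .
  have enter: "\<exists>w'' x. walk (fst \<Gamma>') v0 w'' \<theta> \<and> x \<in> words (X i) \<and> walk (fst \<Gamma>) \<theta> x v \<and>
      el (w'' @ x) = el w'"
    if w': "walk (fst \<Gamma>') v0 w' v" and v: "v \<in> B" "v \<in> verts D" for w' v
  proof -
    obtain a where a: "a \<in> carrier AA" "v = act i \<theta> (\<phi> i a)"
      using v D_bichromatic by (auto simp: AF_image)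
    obtain x y where xy: "x \<in> \<phi> i a" "y \<in> \<phi> (other i) a"
      using ex_\<phi>_word[OF a(1)] by blast
    note walks = \<theta>_walk[OF a(1) xy]
    have xyw: "x \<in> words (X i)" "x \<in> words XX" "y \<in> words XX"
      using xy \<phi>_word[OF a(1)] words_XX by blast+
    have "walk (fst \<Gamma>') v0 (w' @ winv y) \<theta>"
      using w' walk_inv[OF \<Gamma>'_wf walks(2)] a(2) by (auto simp: walk_append[OF \<Gamma>'_wf])
    moreover have "el ((w' @ winv y) @ x) = el w'"
    proof -
      have "el ((w' @ winv y) @ x) = el w' \<otimes>\<^bsub>G\<^esub> (inv\<^bsub>G\<^esub> el y \<otimes>\<^bsub>G\<^esub> el x)"
        using xyw words[OF w'] by (simp add: elt_mult[symmetric] elt_inv[symmetric] G.m_assoc)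
      also have "el x = el y"
        using elt_\<phi>[OF a(1) xy] .
      finally show ?thesis
        using xyw words[OF w'] by simp
    qed
    ultimately show ?thesis
      using walks(1) a(2) xyw(1) by blast
  qed
  have leave: "\<exists>w''. walk (fst \<Gamma>') v0 w'' v \<and> el w'' = el (w' @ x)"
    if w': "walk (fst \<Gamma>') v0 w' \<theta>" and x: "x \<in> words (X i)" "walk (fst \<Gamma>) \<theta> x v" and v: "v \<in> B"
    for w' x v
  proof -
    have vx: "v = act i \<theta> (fcl i x)"
      using walk_act[OF \<theta>_col x(1)] x(2) by simp
    then have "fcl i x \<in> AF i"
      using D_bichromatic_AF v x(1) by simp
    then obtain a where a: "a \<in> carrier AA" "fcl i x = \<phi> i a"
      by (auto simp: AF_image)
    then have xa: "x \<in> \<phi> i a"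
      using fmem_self[OF x(1)] by simp
    obtain y where y: "y \<in> \<phi> (other i) a"
      using ex_\<phi>_word[OF a(1)] by blast
    have "walk (fst \<Gamma>') \<theta> y v"
      using \<theta>_walk(2)[OF a(1) xa y] vx a(2) by simp
    then have "walk (fst \<Gamma>') v0 (w' @ y) v"
      using w' by (auto simp: walk_append[OF \<Gamma>'_wf])
    moreover have "el (w' @ y) = el (w' @ x)"
      using elt_\<phi>[OF a(1) xa y] words[OF w'] words_XX[of y "other i"] \<phi>_word[OF a(1) y] words_XX[OF x(1)]
      by (simp add: elt_mult[symmetric])
    ultimately show ?thesis by blast
  qed
  show ?thesis
    using assms
  proof (induction w arbitrary: v rule: rev_induct)
    case Nil
    then have "walk (fst \<Gamma>') v0 [] v"
      using \<Gamma>'_base by simp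
    then show ?case
      using enter[of "[]" v] base Nil by (auto intro: exI[of _ "[]"])
  next
    case (snoc a w)
    then obtain t where t: "walk (fst \<Gamma>) v0 w t" "(t, a, v) \<in> EE"
      by (auto simp: walk_snoc[OF wf])
    have wa: "w \<in> words XX" "a \<in> letters XX"
      using walk_words[OF ok snoc.prems] by auto
    have snoc_el: "el (u @ [a]) = el (w @ [a])" if "el u = el w" "u \<in> words XX" for u
      using that wa by (simp add: elt_mult[symmetric])
    note IH = snoc.IH[OF t(1)]
    show ?case
    proof (cases "(t, a, v) \<in> edges D")
      case True
      then have a: "a \<in> letters (X i)" "t \<in> verts D" "v \<in> verts D"
        using D_step unfolding D_edges by blast+
      obtain w' x where w': "walk (fst \<Gamma>') v0 w' \<theta>" "x \<in> words (X i)" "walk (fst \<Gamma>) \<theta> x t"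
        "el (w' @ x) = el w"
        using IH a(2) by blast
      have x: "x @ [a] \<in> words (X i)" "walk (fst \<Gamma>) \<theta> (x @ [a]) v"
        using w' a(1) t(2) by (auto simp: walk_snoc[OF wf])
      have el: "el (w' @ (x @ [a])) = el (w @ [a])"
        using snoc_el[OF w'(4)] words[OF w'(1)] words_XX[OF w'(2)] by simp
      have "v \<in> B" if "v \<in> verts (fst \<Gamma>')"
        using that a(3) unfolding \<Gamma>'_simps by blast
      then show ?thesis
        using leave[OF w'(1) x] w'(1) x el by metis
    next
      case False
      then have e: "(t, a, v) \<in> edges (fst \<Gamma>')"
        using t(2) unfolding \<Gamma>'_simps by blast
      then have tv: "t \<in> verts (fst \<Gamma>')" "v \<in> verts (fst \<Gamma>')"
        using wf_edge[OF \<Gamma>'_wf] by blast+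
      then obtain w' where w': "walk (fst \<Gamma>') v0 w' t" "el w' = el w"
        using IH by blast
      then have w'a: "walk (fst \<Gamma>') v0 (w' @ [a]) v" "el (w' @ [a]) = el (w @ [a])"
        using e snoc_el[OF w'(2) words[OF w'(1)]] by (auto simp: walk_snoc[OF \<Gamma>'_wf])
      moreover have "v \<in> B" if "v \<in> verts D"
        using that tv(2) unfolding \<Gamma>'_simps by blast
      ultimately show ?thesis
        using enter[OF w'a(1)] by metis
    qed
  qed
qed

lemma \<Gamma>'_good: "good \<Gamma>'"
proof (rule good_retract[OF good \<Gamma>'_wf \<Gamma>'_sub])
  show "\<exists>w'. walk (fst \<Gamma>') v0 w' v \<and> el w' = el w" if "walk (fst \<Gamma>) v0 w v" "v \<in> verts (fst \<Gamma>')" for w v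
    using \<Gamma>'_retract[OF that(1)] that(2) by blast
qed (use \<Gamma>'_base in \<open>simp_all add: \<Gamma>'_simps\<close>)

lemma \<Gamma>'_col: "v \<in> col (fst \<Gamma>') k \<Longrightarrow> v \<in> C k \<and> v \<in> verts (fst \<Gamma>') \<and> (k = i \<longrightarrow> v \<notin> verts D)"
  unfolding col_def \<Gamma>'_simps D_edges by blast

lemma \<Gamma>'_walk:
  assumes v: "v \<in> col (fst \<Gamma>') k" and w: "w \<in> words (X k)" "walk (fst \<Gamma>) v w t"
  shows "walk (fst \<Gamma>') v w t"
proof (cases "k = i")
  case False
  then have "k = other i"
    using factor_exhaust_other[of k i] by blast
  then show ?thesis
    using \<Gamma>'_walk_other w \<Gamma>'_col[OF v] by blast
next
  case True
  have "walk (fst \<Gamma>) v w t \<Longrightarrow> v \<in> VV \<Longrightarrow> v \<notin> verts D \<Longrightarrow> walk (fst \<Gamma>') v w t" for v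
    using w(1)
  proof (induction w arbitrary: v)
    case Nil
    then show ?case
      by (simp add: \<Gamma>'_simps)
  next
    case (Cons a w)
    then obtain s where s: "(v, a, s) \<in> EE" "walk (fst \<Gamma>) s w t" "a \<in> letters (X i)"
      using True by auto
    then have "s \<notin> verts D" "s \<in> VV" "(v, a, s) \<in> edges (fst \<Gamma>')"
      using Cons.prems D_edge_ends[OF s(1,3)] wf_edge(2)[OF wf s(1)] unfolding \<Gamma>'_simps D_edges
      by blast+
    then show ?case
      using Cons s(2) by auto
  qed
  then show ?thesis
    using w(2) \<Gamma>'_col[OF v] True col_vert by blast
qed

lemma \<Gamma>'_pre: "is_precover \<Gamma>'"
  unfolding is_precover_def
proof (intro conjI)
  show "good \<Gamma>'"
    by (rule \<Gamma>'_good)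
  show "det (fst \<Gamma>')"
    using dt \<Gamma>'_sub(2) unfolding det_def by blast
  show "saturated (fst \<Gamma>')"
    unfolding saturated_def
  proof (intro allI ballI)
    fix k v assume v: "v \<in> col (fst \<Gamma>') k"
    then obtain c where c: "cover (fst \<Gamma>) k v c"
      using sat \<Gamma>'_col unfolding saturated_def by blast
    have "cover (fst \<Gamma>') k v c"
      unfolding cover_def
    proof (intro conjI ballI)
      show "c \<one>\<^bsub>F k\<^esub> = v"
        using c by (simp add: cover_def)
      fix g assume g: "g \<in> carrier (F k)"
      then obtain w where w: "w \<in> words (X k)" "g = fcl k w"
        using ex_fword by blast
      have walk: "walk (fst \<Gamma>') v w (c g)"
        using \<Gamma>'_walk[OF v w(1) cover_walk_one[OF c w(1)]] w(2) by simp
      then show "c g \<in> verts (fst \<Gamma>')"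
        using walk_in_verts[OF \<Gamma>'_wf] by blast
      fix a assume a: "a \<in> letters (X k)"
      have "walk (fst \<Gamma>) v (w @ [a]) (c (g \<otimes>\<^bsub>F k\<^esub> fcl k [a]))"
        using cover_walk_one[OF c, of "w @ [a]"] w a by (simp add: fmult)
      then have "walk (fst \<Gamma>') v (w @ [a]) (c (g \<otimes>\<^bsub>F k\<^esub> fcl k [a]))"
        using \<Gamma>'_walk[OF v, of "w @ [a]"] w a by simp
      then obtain t where "walk (fst \<Gamma>') v w t" "(t, a, c (g \<otimes>\<^bsub>F k\<^esub> fcl k [a])) \<in> edges (fst \<Gamma>')"
        unfolding walk_snoc[OF \<Gamma>'_wf] by blast
      moreover have "t = c g"
        using det_walk[OF dt walk_mono[OF calculation(1) \<Gamma>'_sub] walk_mono[OF walk \<Gamma>'_sub]] .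
      ultimately show "(c g, a, c (g \<otimes>\<^bsub>F k\<^esub> fcl k [a])) \<in> edges (fst \<Gamma>')"
        by simp
    qed
    then show "\<exists>c. cover (fst \<Gamma>') k v c" by blast
  qed
  show "compatible (fst \<Gamma>')"
    unfolding compatible_def compat_def
  proof (intro ballI)
    fix v a x y
    assume v: "v \<in> bichromatic \<A> (fst \<Gamma>')" and a: "a \<in> carrier AA" "x \<in> \<phi> First a" "y \<in> \<phi> Second a"
    have vk: "v \<in> col (fst \<Gamma>') k" for k
      using v by (simp add: bichromatic_iff)
    then have "v \<in> B"
      using \<Gamma>'_col by (auto simp: bichromatic_iff)
    then obtain t where "walk (fst \<Gamma>) v x t" "walk (fst \<Gamma>) v y t"
      using cmp a unfolding compatible_def compat_def by blast
    then show "\<exists>t. walk (fst \<Gamma>') v x t \<and> walk (fst \<Gamma>') v y t"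
      using \<Gamma>'_walk[OF vk] \<phi>_word[OF a(1)] a by blast
  qed
qed

lemma \<Gamma>'_card: "card (edges (fst \<Gamma>')) < card EE"
proof (rule psubset_card_mono)
  show "finite EE"
  proof (rule finite_edges[OF wf finite_VV], rule image_subsetI)
    fix e assume "e \<in> EE"
    then show "lab e \<in> letters XX"
      using graph_ok_letter[OF ok, of "ini e" "lab e" "ter e"] by simp
  qed
  have "edges D \<noteq> {}" "edges D \<subseteq> EE"
    using D by (auto simp: mono_component_def mono_connected_def subgraph_def)
  then show "edges (fst \<Gamma>') \<subset> EE"
    unfolding \<Gamma>' by auto
qed

end

lemma not_mono_bichromatic:
  assumes "v \<in> C i" "v \<notin> monochromatic \<A> i (fst \<Gamma>)"
  shows "v \<in> B"
proof -
  obtain e where e: "e \<in> EE" "ini e = v" "lab e \<notin> letters (X i)"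
    using assms by (auto simp: monochromatic_def col_vert)
  then have "(v, lab e, ter e) \<in> EE"
    by auto
  then obtain k where "lab e \<in> letters (X k)" "v \<in> C k"
    using ex_col by blast
  then have "v \<in> C (other i)"
    using e(3) factor_exhaust_other[of k i] by auto
  then show ?thesis
    using assms bichromatic_iff2[of v _ i] by blast
qed

lemma removal_step_pre:
  assumes "removal_step \<A> \<Gamma> \<Gamma>'"
  shows "is_precover \<Gamma>'" "card (edges (fst \<Gamma>')) < card EE"
proof -
  obtain i D where red: "redundant \<A> \<Gamma> i D"
    and \<Gamma>': "\<Gamma>' = (\<lparr>verts = VV - (verts D - B), edges = EE - edges D\<rparr>, v0)"
    using assms unfolding removal_step_def by blast
  obtain K \<theta> where D: "mono_component (X i) (fst \<Gamma>) D"
    and K: "subgroup K (F i)" "K \<subseteq> AF i" "\<theta> \<in> B \<inter> verts D"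
    "(D, \<theta>) \<cong>\<^sub>p factor_cayley \<A> i K"
    "card (B \<inter> verts D) = card (rcosets\<^bsub>(F i)\<lparr>carrier := AF i\<rparr>\<^esub> K)"
    and base: "K = {\<one>\<^bsub>F i\<^esub>} \<and> v0 \<notin> monochromatic \<A> i (fst \<Gamma>) \<inter> verts D \<or>
       K \<noteq> {\<one>\<^bsub>F i\<^esub>} \<and> v0 \<notin> verts D"
    using red unfolding redundant_def by blast
  have base': "v0 \<in> B" if "v0 \<in> verts D"
    using base that mono_component_eq_comp(2)[OF wf D that] not_mono_bichromatic by blast
  show "is_precover \<Gamma>'" "card (edges (fst \<Gamma>')) < card EE"
    using \<Gamma>'_pre[OF D K base' \<Gamma>'] \<Gamma>'_card[OF D K base' \<Gamma>'] by auto
qed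

end

context stallings_input
begin

lemma pre_removal_step:
  assumes "is_precover \<Gamma>" "removal_step \<A> \<Gamma> \<Gamma>'"
  shows "is_precover \<Gamma>'" "card (edges (fst \<Gamma>')) < card (edges (fst \<Gamma>))"
proof -
  interpret precover_graph \<A> ws \<Gamma>
    using assms by unfold_locales
  show "is_precover \<Gamma>'" "card (edges (fst \<Gamma>')) < card (edges (fst \<Gamma>))"
    using removal_step_pre[OF assms(2)] by auto
qed

lemma removal_pre: "is_precover \<Gamma> \<Longrightarrow> exhausts (removal_step \<A>) \<Gamma> \<Gamma>' \<Longrightarrow> is_precover \<Gamma>'"
  by (erule exhausts_invariant[where Q = is_precover]) (auto intro: pre_removal_step)

lemma removal_exists: "is_precover \<Gamma> \<Longrightarrow> \<exists>\<Gamma>'. exhausts (removal_step \<A>) \<Gamma> \<Gamma>'"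
  by (rule exhausts_exists[where Q = is_precover and f = "\<lambda>\<Gamma>. card (edges (fst \<Gamma>))"])
    (auto intro: pre_removal_step)

end

section \<open>Reduced walks and essential components\<close>

context amalgam
begin

lemma AF_mult_right:
  assumes "g \<in> carrier (F i)" "a \<in> carrier AA"
  shows "g \<otimes>\<^bsub>F i\<^esub> \<phi> i a \<in> AF i \<longleftrightarrow> g \<in> AF i"
proof
  assume "g \<otimes>\<^bsub>F i\<^esub> \<phi> i a \<in> AF i"
  then have "(g \<otimes>\<^bsub>F i\<^esub> \<phi> i a) \<otimes>\<^bsub>F i\<^esub> inv\<^bsub>F i\<^esub> (\<phi> i a) \<in> AF i"
    using assms subgroup_AF by (meson \<phi>_mem_AF subgroup.m_closed subgroup.m_inv_closed)
  then show "g \<in> AF i"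
    using assms by (simp add: F.m_assoc)
qed (use assms subgroup_AF in \<open>simp add: subgroup.m_closed\<close>)

lemma AF_inv:
  assumes "g \<in> carrier (F i)"
  shows "inv\<^bsub>F i\<^esub> g \<in> AF i \<longleftrightarrow> g \<in> AF i"
  using assms subgroup.m_inv_closed[OF subgroup_AF, of g i]
    subgroup.m_inv_closed[OF subgroup_AF, of "inv\<^bsub>F i\<^esub> g" i] by auto

lemma AF_one: "\<one>\<^bsub>F i\<^esub> \<in> AF i"
  by (rule subgroup.one_closed[OF subgroup_AF])

end

context precover_graph
begin

text \<open>Normal closed paths are studied through states \<open>(u, i)\<close>: a vertex together with the factor by
  which it was reached, so that the next syllable comes from the other factor. The relation \<open>syl\<close>
  is one syllable. Its transitive closure stands for the words in normal form, and \<open>flip\<close> turns a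
  word in normal form into its inverse.\<close>

definition syl :: "(('v \<times> factor) \<times> 'v \<times> factor) set" where
  "syl = {((u, i), (v, k)) |u i v k. k = other i \<and> u \<in> C k \<and>
    (\<exists>g\<in>carrier (F k). g \<notin> AF k \<and> v = act k u g)}"

lemma syl_iff:
  "((u, i), (v, k)) \<in> syl \<longleftrightarrow> k = other i \<and> u \<in> C k \<and> (\<exists>g\<in>carrier (F k). g \<notin> AF k \<and> v = act k u g)"
  by (auto simp: syl_def)

fun flip :: "'v \<times> factor \<Rightarrow> 'v \<times> factor" where
  "flip (u, i) = (u, other i)"

lemma flip_flip [simp]: "flip (flip p) = p"
  by (cases p) simp

lemma syl_flip: "(p, q) \<in> syl \<Longrightarrow> (flip q, flip p) \<in> syl"
proof (cases p; cases q)
  fix u i v k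
  assume *: "(p, q) \<in> syl" "p = (u, i)" "q = (v, k)"
  then obtain g where g: "k = other i" "u \<in> C k" "g \<in> carrier (F k)" "g \<notin> AF k" "v = act k u g"
    by (auto simp: syl_iff)
  then have "u = act k v (inv\<^bsub>F k\<^esub> g)" "v \<in> C k" "inv\<^bsub>F k\<^esub> g \<notin> AF k"
    using act_act_inv by (auto simp: AF_inv)
  then show ?thesis
    using * g by (auto simp: syl_iff)
qed

lemma syl_rtrancl_flip: "(p, q) \<in> syl\<^sup>* \<Longrightarrow> (flip q, flip p) \<in> syl\<^sup>*"
  by (induction rule: rtrancl_induct) (auto intro: syl_flip converse_rtrancl_into_rtrancl)

lemma syl_trancl_flip: "(p, q) \<in> syl\<^sup>+ \<Longrightarrow> (flip q, flip p) \<in> syl\<^sup>+"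
  by (induction rule: trancl_induct) (auto intro: syl_flip trancl_into_trancl2)

text \<open>Changing the end of a walk within its orbit under \<open>A\<close> only changes the last syllable.\<close>

lemma syl_adjust:
  assumes "((u, i), (v, k)) \<in> syl" "a \<in> carrier AA"
  shows "((u, i), (P.aact v a, k)) \<in> syl"
proof -
  obtain g where g: "k = other i" "u \<in> C k" "g \<in> carrier (F k)" "g \<notin> AF k" "v = act k u g"
    using assms unfolding syl_iff by blast
  have "v \<in> C k"
    using g act_col by simp
  then have "P.aact v a = act k u (g \<otimes>\<^bsub>F k\<^esub> \<phi> k a)"
    using assms(2) g(2,3) g(5) by (simp add: P.aact_eq[of "act k u g" k a] P.act_mult act_col)
  moreover have "g \<otimes>\<^bsub>F k\<^esub> \<phi> k a \<notin> AF k"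
    using g assms(2) by (simp add: AF_mult_right)
  ultimately show ?thesis
    unfolding syl_iff using g assms(2) by (auto intro!: bexI[of _ "g \<otimes>\<^bsub>F k\<^esub> \<phi> k a"])
qed

definition reached :: "('v \<times> factor) set" where
  "reached = {q. \<exists>i. ((v0, i), q) \<in> syl\<^sup>*}"

lemma reached_base: "(v0, i) \<in> reached"
  unfolding reached_def by blast

lemma reached_step: "p \<in> reached \<Longrightarrow> (p, q) \<in> syl\<^sup>* \<Longrightarrow> q \<in> reached"
  unfolding reached_def by (blast intro: rtrancl_trans)

lemma reached_cases:
  assumes "(b, i) \<in> reached"
  obtains "b = v0" | b0 g where "(b0, other i) \<in> reached" "b0 \<in> C i" "g \<in> carrier (F i)" "g \<notin> AF i" "b = act i b0 g"
proof -
  obtain k where k: "((v0, k), (b, i)) \<in> syl\<^sup>*"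
    using assms unfolding reached_def by blast
  show ?thesis
  proof (cases "((v0, k), (b, i)) \<in> syl\<^sup>+")
    case True
    then obtain p where p: "((v0, k), p) \<in> syl\<^sup>*" "(p, (b, i)) \<in> syl"
      by (metis tranclD2)
    obtain b0 c where p2: "p = (b0, c)"
      by (cases p) auto
    then have c: "c = other i"
      using p(2) syl_iff other_other by metis
    then have "(b0, other i) \<in> reached"
      using p p2 unfolding reached_def by blast
    moreover obtain g where "b0 \<in> C i" "g \<in> carrier (F i)" "g \<notin> AF i" "b = act i b0 g"
      using p(2) unfolding p2 syl_iff by blast
    ultimately show ?thesis
      using that(2) by blast
  next
    case False
    then show ?thesis
      using that(1) k by (metis Pair_inject rtranclD)
  qed
qed

text \<open>Every component is entered by a reduced walk from the base point. Follow an arbitrary walk; a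
  syllable that falls into \<open>A\<close> is absorbed into the syllable before it.\<close>

lemma reach:
  assumes "u \<in> C i"
  shows "\<exists>b. (b, other i) \<in> reached \<and> b \<in> C i \<and> (\<exists>g\<in>carrier (F i). u = act i b g)"
proof -
  obtain w where w: "walk (fst \<Gamma>) v0 w u"
    using connected[OF col_vert[OF assms]] by blast
  then show ?thesis
    using assms
  proof (induction w arbitrary: u i rule: rev_induct)
    case Nil
    then have "u = act i v0 \<one>\<^bsub>F i\<^esub>" "v0 \<in> C i"
      by auto
    then show ?case
      using reached_base by blast
  next
    case (snoc a w)
    then obtain t where t: "walk (fst \<Gamma>) v0 w t" "(t, a, u) \<in> EE"
      by (auto simp: walk_snoc[OF wf])
    obtain c where c: "a \<in> letters (X c)" "t \<in> C c" "u \<in> C c"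
      using ex_col[OF t(2)] by blast
    obtain b g where b: "(b, other c) \<in> reached" "b \<in> C c" "g \<in> carrier (F c)" "t = act c b g"
      using snoc.IH[OF t(1) c(2)] by blast
    define z where "z = g \<otimes>\<^bsub>F c\<^esub> fcl c [a]"
    have z: "z \<in> carrier (F c)"
      using b c by (simp add: z_def)
    have "walk (fst \<Gamma>) t [a] u"
      using t(2) col_vert[OF c(3)] by auto
    then have u: "u = act c b z"
      using walk_act[OF c(2), of "[a]"] c b by (simp add: z_def P.act_mult)
    show ?case
    proof (cases "i = c")
      case True
      then show ?thesis
        using b u z by blast
    next
      case False
      then have i: "i = other c"
        using factor_exhaust_other[of i c] by blast
      show ?thesis
      proof (cases "z \<in> AF c")
        case False
        then have "((b, other c), (u, c)) \<in> syl"
          unfolding syl_iff using b z u by auto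
        then have "(u, c) \<in> reached"
          using reached_step[OF b(1)] by blast
        then show ?thesis
          using i snoc.prems(2) by (auto intro!: exI[of _ u] bexI[of _ "\<one>\<^bsub>F i\<^esub>"])
      next
        case True
        then obtain d where d: "d \<in> carrier AA" "z = \<phi> c d"
          by (auto simp: AF_image)
        then have ud: "u = P.aact b d"
          using u P.aact_eq[OF b(2)] by simp
        then have bi: "b \<in> C i"
          using P.aact_mem_iff[OF b(2) d(1)] snoc.prems(2) by simp
        then have ud': "u = act i b (\<phi> i d)"
          using ud P.aact_eq d(1) by simp
        have bD: "(b, i) \<in> reached"
          using b(1) i by simp
        then show ?thesis
        proof (cases rule: reached_cases)
          case 1
          then show ?thesis
            using bi ud' d(1) reached_base \<phi>.hom_closed by blast
        next
          case (2 b0 g0)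
          then have "u = act i b0 (g0 \<otimes>\<^bsub>F i\<^esub> \<phi> i d)"
            using ud' d(1) by (simp add: P.act_mult)
          then show ?thesis
            using 2(1-3) d(1)
            by (intro exI[of _ b0] conjI bexI[of _ "g0 \<otimes>\<^bsub>F i\<^esub> \<phi> i d"]) auto
        qed
      qed
    qed
  qed
qed

text \<open>If a reduced walk from the base point runs into a reduced cycle, then one can run around the
  cycle and return, so the end of the walk is reached in both directions. Induction on the walk:
  if it meets the cycle along the same syllable up to \<open>A\<close>, the meeting point moves back by one.\<close>

lemma lollipop:
  assumes "q \<in> reached" "(q, q) \<in> syl\<^sup>+"
  shows "flip q \<in> reached"
proof -
  obtain k where "((v0, k), q) \<in> syl\<^sup>*"
    using assms(1) unfolding reached_def by blast
  then show ?thesis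
    using assms(2)
  proof (induction rule: rtrancl_induct)
    case base
    then show ?case
      using reached_base by simp
  next
    case (step p q)
    obtain u i v j where pq: "p = (u, i)" "q = (v, j)"
      by (cases p; cases q) auto
    obtain g where g: "j = other i" "u \<in> C j" "g \<in> carrier (F j)" "g \<notin> AF j" "v = act j u g"
      using step(2) unfolding pq syl_iff by blast
    have pD: "p \<in> reached"
      using step(1) unfolding reached_def by blast
    obtain r where r: "(q, r) \<in> syl\<^sup>*" "(r, q) \<in> syl"
      using step.prems by (metis tranclD2)
    obtain x i' where rx: "r = (x, i')"
      by (cases r) auto
    then have i': "i' = i"
      using r(2) g(1) unfolding pq syl_iff rx by (metis other_other)
    obtain h where h: "x \<in> C j" "h \<in> carrier (F j)" "h \<notin> AF j" "v = act j x h"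
      using r(2) unfolding pq rx syl_iff by blast
    define d where "d = g \<otimes>\<^bsub>F j\<^esub> inv\<^bsub>F j\<^esub> h"
    have d: "d \<in> carrier (F j)"
      using g h by (simp add: d_def)
    have x: "x = act j u d"
      using g h act_act_inv[OF h(1,2)] by (simp add: d_def P.act_mult)
    show ?case
    proof (cases "d \<in> AF j")
      case False
      then have "(p, flip r) \<in> syl"
        unfolding pq rx i' using g x d by (auto simp: syl_iff)
      moreover have "(flip r, flip q) \<in> syl\<^sup>*"
        using r(1) by (rule syl_rtrancl_flip)
      ultimately show ?thesis
        using reached_step[OF pD] by (meson converse_rtrancl_into_rtrancl)
    next
      case True
      then obtain a where a: "a \<in> carrier AA" "d = \<phi> j a"
        by (auto simp: AF_image)
      then have xa: "x = P.aact u a"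
        using x P.aact_eq[OF g(2)] by simp
      have ux: "P.aact x (inv\<^bsub>AA\<^esub> a) = u"
        using a g(2) by (simp add: xa P.aact_mult[OF g(2), symmetric] P.aact_one[OF g(2)])
      have "q \<noteq> r"
        using pq rx i' g(1) by auto
      then have "(q, r) \<in> syl\<^sup>+"
        using r(1) by (metis rtranclD)
      then obtain s where s: "(q, s) \<in> syl\<^sup>*" "(s, r) \<in> syl"
        by (metis tranclD2)
      obtain y c where sy: "s = (y, c)"
        by (cases s) auto
      have "(s, p) \<in> syl"
        using syl_adjust[of y c x i' "inv\<^bsub>AA\<^esub> a"] s(2) a unfolding sy rx ux pq i' by simp
      then have qp: "(q, p) \<in> syl\<^sup>+"
        using s(1) by (rule rtrancl_into_trancl1[rotated])
      then have "(p, p) \<in> syl\<^sup>+"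
        using step(2) by (rule trancl_into_trancl2[rotated])
      then have "flip p \<in> reached"
        using step.IH by blast
      then show ?thesis
        using syl_trancl_flip[OF qp] reached_step by (meson trancl_into_rtrancl)
    qed
  qed
qed

text \<open>The component of \<open>v\<close> in factor \<open>i\<close> lies on a normal closed path. In the first case the path has
  several syllables: it reaches the component at \<open>b\<close>, crosses it to \<open>b'\<close>, and returns along the
  inverse of a reduced walk to \<open>b'\<close>; also one syllable outside \<open>A\<close> at the base point is of this
  form. In the second case it is a single syllable at the base point, possibly in \<open>A\<close>.\<close>

definition essential :: "factor \<Rightarrow> 'v \<Rightarrow> bool" where
  "essential i v \<longleftrightarrow>
    (\<exists>b b'. (b, other i) \<in> reached \<and> (b', other i) \<in> reached \<and> ((b, other i), (b', i)) \<in> syl \<and>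
      (\<exists>g\<in>carrier (F i). v = act i b g)) \<or>
    (v0 \<in> C i \<and> (\<exists>g\<in>carrier (F i). v = act i v0 g) \<and>
      (\<exists>g\<in>carrier (F i). g \<noteq> \<one>\<^bsub>F i\<^esub> \<and> act i v0 g = v0))"

lemma bichromatic_aact: "v \<in> B \<Longrightarrow> a \<in> carrier AA \<Longrightarrow> P.aact v a \<in> B"
  unfolding bichromatic_iff using P.aact_closed by blast

text \<open>Suppose that the component is not essential, and consider all states that can be reached through
  it. None of them can be reached in the opposite direction as well, since otherwise one could
  return. By \<open>lollipop\<close> the steps between these states are acyclic, so there is a last state that
  can still be left. The component entered from that state is redundant, or it is the whole graph
  and a Cayley graph.\<close>

lemma all_essential:
  assumes irreducible: "\<nexists>\<Gamma>'. removal_step \<A> \<Gamma> \<Gamma>'"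
    and nontrivial: "\<not> (B = {} \<and> (\<exists>i. \<Gamma> \<cong>\<^sub>p factor_cayley \<A> i {\<one>\<^bsub>F i\<^esub>}))"
    and v: "v \<in> C i"
  shows "essential i v"
proof (rule ccontr)
  assume not_ess: "\<not> essential i v"
  obtain b g1 where b: "(b, other i) \<in> reached" "b \<in> C i" "g1 \<in> carrier (F i)" "v = act i b g1"
    using reach[OF v] by blast
  define s where "s = (b, other i)"
  have sD: "s \<in> reached"
    using b by (simp add: s_def)
  \<comment> \<open>A state reached in both directions would give a way back through the component.\<close>
  have no_return: "flip q \<notin> reached" if q: "(s, q) \<in> syl\<^sup>+" for q
  proof
    assume "flip q \<in> reached"
    obtain q1 where q1: "(s, q1) \<in> syl" "(q1, q) \<in> syl\<^sup>*"
      using q by (metis tranclD)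
    have "flip q1 \<in> reached"
      using syl_rtrancl_flip[OF q1(2)] \<open>flip q \<in> reached\<close> reached_step by blast
    moreover obtain b1 c where "q1 = (b1, c)"
      by (cases q1) auto
    moreover have "c = i"
      using calculation(2) q1(1) by (auto simp: s_def syl_iff)
    ultimately have "(b1, other i) \<in> reached" "((b, other i), (b1, i)) \<in> syl"
      using q1(1) by (auto simp: s_def)
    then have "essential i v"
      unfolding essential_def using b by blast
    then show False
      using not_ess by blast
  qed
  \<comment> \<open>The states beyond the component at which there is a further component to enter.\<close>
  define Z where "Z = {q. (s, q) \<in> syl\<^sup>* \<and> fst q \<in> C (other (snd q))}"
  have "Z \<subseteq> VV \<times> {First, Second}"
  proof
    fix q assume "q \<in> Z"
    then show "q \<in> VV \<times> {First, Second}"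
      using col_vert[of "fst q"] factor.exhaust[of "snd q"] unfolding Z_def
      by (cases q) auto
  qed
  then have finZ: "finite Z"
    using finite_VV by (meson finite.emptyI finite.insertI finite_SigmaI finite_subset)
  have sZ: "s \<in> Z"
    using b by (simp add: Z_def s_def)
  have ZD: "q \<in> reached" if "q \<in> Z" for q
    using that reached_step[OF sD] by (simp add: Z_def)
  have irrefl: "(q, q) \<notin> syl\<^sup>+" if q: "q \<in> Z" for q
  proof
    assume cyc: "(q, q) \<in> syl\<^sup>+"
    then have "(s, q) \<in> syl\<^sup>+"
      using q unfolding Z_def by (auto intro: rtrancl_trancl_trancl)
    then show False
      using no_return lollipop[OF ZD[OF q] cyc] by blast
  qed
  have "\<exists>q\<in>Z. \<forall>q'\<in>Z. (q, q') \<notin> syl\<^sup>+"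
  proof -
    let ?r = "syl\<^sup>+ \<inter> Z \<times> Z"
    have "trans ?r"
      by (auto intro!: transI intro: trancl_trans)
    then have "acyclic ?r"
      using irrefl by (auto simp: acyclic_def trancl_id)
    moreover have "finite ?r"
      using finZ by blast
    ultimately have "wf (?r\<inverse>)"
      by (intro finite_acyclic_wf_converse)
    then obtain q where "q \<in> Z" "\<And>q'. (q', q) \<in> ?r\<inverse> \<Longrightarrow> q' \<notin> Z"
      using sZ by (metis wfE_min)
    then show ?thesis
      by blast
  qed
  then obtain q where q: "q \<in> Z" and max: "\<And>q'. q' \<in> Z \<Longrightarrow> (q, q') \<notin> syl\<^sup>+"
    by blast
  obtain b' c' where q2: "q = (b', c')"
    by (cases q) auto
  define j where "j = other c'"
  have c': "c' = other j"
    by (simp add: j_def)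
  have b': "b' \<in> C j" and sq: "(s, q) \<in> syl\<^sup>*"
    using q by (auto simp: Z_def q2 j_def)
  have next_syl: "(q, (act j b' g, j)) \<in> syl" "(s, (act j b' g, j)) \<in> syl\<^sup>+"
    if "g \<in> carrier (F j)" "g \<notin> AF j" for g
  proof -
    show "(q, (act j b' g, j)) \<in> syl"
      unfolding q2 syl_iff using b' that by (auto simp: j_def)
    then show "(s, (act j b' g, j)) \<in> syl\<^sup>+"
      using sq by (rule rtrancl_into_trancl1[rotated])
  qed
  \<comment> \<open>In the component entered from the last state, everything that matters lies in \<open>A\<close>: the
    stabilizer, the way to bichromatic vertices, and the way to the base point.\<close>
  define K where "K = {g \<in> carrier (F j). act j b' g = b'}"
  have K_A: "K \<subseteq> AF j"
  proof
    fix g assume "g \<in> K"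
    then have g: "g \<in> carrier (F j)" "act j b' g = b'"
      by (auto simp: K_def)
    show "g \<in> AF j"
    proof (rule ccontr)
      assume "g \<notin> AF j"
      then have "(s, (b', j)) \<in> syl\<^sup>+"
        using next_syl(2)[OF g(1)] g(2) by simp
      then have "flip (b', j) \<notin> reached"
        by (rule no_return)
      then show False
        using ZD[OF q] by (simp add: q2 j_def)
    qed
  qed
  have bi_A: "g \<in> AF j" if g: "g \<in> carrier (F j)" "act j b' g \<in> B" for g
  proof (rule ccontr)
    assume n: "g \<notin> AF j"
    have "(act j b' g, j) \<in> Z"
      unfolding Z_def using next_syl(2)[OF g(1) n] g(2) by (auto simp: bichromatic_iff)
    then show False
      using max next_syl(1)[OF g(1) n] by blast
  qed
  have v0_A: "g \<in> AF j" if g: "g \<in> carrier (F j)" "act j b' g = v0" for g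
  proof (rule ccontr)
    assume "g \<notin> AF j"
    then have "(s, (v0, j)) \<in> syl\<^sup>+"
      using next_syl(2)[OF g(1)] g(2) by simp
    then have "flip (v0, j) \<notin> reached"
      by (rule no_return)
    then show False
      using reached_base by simp
  qed
  let ?D = "comp j (fst \<Gamma>) b'"
  show False
  proof (cases "b' \<in> B")
    case True
    have verts_D: "verts ?D = act j b' ` carrier (F j)"
      using comp_verts_act[OF b'] .
    have BD: "B \<inter> verts ?D = act j b' ` AF j"
    proof
      show "B \<inter> verts ?D \<subseteq> act j b' ` AF j"
        unfolding verts_D using bi_A by blast
      show "act j b' ` AF j \<subseteq> B \<inter> verts ?D"
      proof
        fix u assume "u \<in> act j b' ` AF j"
        then obtain a where a: "a \<in> carrier AA" "u = act j b' (\<phi> j a)"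
          by (auto simp: AF_image)
        then have "u = P.aact b' a"
          using P.aact_eq[OF b'] by simp
        then have "u \<in> B"
          using bichromatic_aact[OF True a(1)] by simp
        then show "u \<in> B \<inter> verts ?D"
          using a by (simp add: verts_D)
      qed
    qed
    have "{g \<in> AF j. act j b' g = b'} = K"
      using K_A AF_carrier by (auto simp: K_def)
    then have card: "card (B \<inter> verts ?D) = card (rcosets\<^bsub>(F j)\<lparr>carrier := AF j\<rparr>\<^esub> K)"
      using bij_betw_same_card[OF orbit_bij[OF b' subgroup_AF]] by (simp add: BD)
    \<comment> \<open>If the base point lies in this component, then the reduced walk may as well end there, and
      it has returned.\<close>
    have "K = {\<one>\<^bsub>F j\<^esub>} \<and> v0 \<notin> monochromatic \<A> j (fst \<Gamma>) \<inter> verts ?D \<or>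
        K \<noteq> {\<one>\<^bsub>F j\<^esub>} \<and> v0 \<notin> verts ?D"
    proof (cases "v0 \<in> verts ?D")
      case v0D: True
      then obtain g where g: "g \<in> carrier (F j)" "v0 = act j b' g"
        unfolding verts_D by blast
      then obtain a where a: "a \<in> carrier AA" "g = \<phi> j a"
        using v0_A by (auto simp: AF_image)
      then have v0a: "v0 = P.aact b' a"
        using g P.aact_eq[OF b'] by simp
      have v0B: "v0 \<in> B"
        unfolding v0a by (rule bichromatic_aact[OF True a(1)])
      then have "v0 \<in> C (other j)"
        by (simp add: bichromatic_iff)
      then obtain x u where "(v0, x, u) \<in> EE" "x \<in> letters (X (other j))"
        by (auto simp: col_def)
      then have "v0 \<notin> monochromatic \<A> j (fst \<Gamma>)"
        using letters_disjoint[of x j] unfolding monochromatic_def by fastforce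
      moreover have "K = {\<one>\<^bsub>F j\<^esub>}"
      proof (rule ccontr)
        assume "K \<noteq> {\<one>\<^bsub>F j\<^esub>}"
        moreover have "\<one>\<^bsub>F j\<^esub> \<in> K"
          using b' by (simp add: K_def)
        ultimately obtain k where k: "k \<in> carrier (F j)" "act j b' k = b'" "k \<noteq> \<one>\<^bsub>F j\<^esub>"
          by (auto simp: K_def)
        show False
        proof (cases "(s, q) \<in> syl\<^sup>+")
          case True
          then obtain r where r: "(s, r) \<in> syl\<^sup>*" "(r, q) \<in> syl"
            by (metis tranclD2)
          obtain y c where ry: "r = (y, c)"
            by (cases r) auto
          have "(r, (v0, c')) \<in> syl"
            using syl_adjust r(2) a(1) unfolding ry q2 v0a by blast
          then have "(s, (v0, c')) \<in> syl\<^sup>+"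
            using r(1) by (rule rtrancl_into_trancl1[rotated])
          then have "flip (v0, c') \<notin> reached"
            by (rule no_return)
          then show False
            using reached_base by simp
        next
          case False
          then have "s = q"
            using sq by (metis rtranclD)
          then have eq: "b' = b" "j = i"
            by (auto simp: s_def q2 j_def)
          define h where "h = inv\<^bsub>F j\<^esub> g \<otimes>\<^bsub>F j\<^esub> (k \<otimes>\<^bsub>F j\<^esub> g)"
          have h: "h \<in> carrier (F j)" "act j v0 h = v0"
            using g k b' act_act_inv[OF b' g(1)] by (simp_all add: h_def P.act_mult)
          have "h \<noteq> \<one>\<^bsub>F j\<^esub>"
          proof
            assume "h = \<one>\<^bsub>F j\<^esub>"
            then have "g \<otimes>\<^bsub>F j\<^esub> h = g"
              using g by simp
            then have "k \<otimes>\<^bsub>F j\<^esub> g = g"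
              using g k by (simp add: h_def F.m_assoc[symmetric])
            then show False
              using g k by simp
          qed
          moreover have "v = act i v0 (inv\<^bsub>F j\<^esub> g \<otimes>\<^bsub>F j\<^esub> g1)" "inv\<^bsub>F j\<^esub> g \<otimes>\<^bsub>F j\<^esub> g1 \<in> carrier (F j)"
            using g b b' act_act_inv[OF b' g(1)] by (simp_all add: eq P.act_mult)
          moreover have "v0 \<in> C i"
            using v0B by (simp add: bichromatic_iff)
          ultimately have "essential i v"
            unfolding essential_def using h eq by blast
          then show False
            using not_ess by blast
        qed
      qed
      ultimately show ?thesis
        by blast
    qed blast
    then have "redundant \<A> \<Gamma> j ?D"
      unfolding redundant_def
      using comp_mono_component[OF wf b'] stabilizer_subgroup[OF b', folded K_def] K_A
        comp_iso[OF b', folded K_def] True comp_self[OF col_vert[OF b'], of j] card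
      by blast
    then show False
      using irreducible unfolding removal_step_def by blast
  next
    case False
    then have not_c': "b' \<notin> C c'"
      using b' bichromatic_iff2[of b' _ j] by (simp add: j_def)
    have syl_col: "x \<in> C k" if "(p, (x, k)) \<in> syl" for p x k
      using that by (cases p) (auto simp: syl_iff)
    have "(p, q) \<notin> syl\<^sup>+" for p
      using not_c' syl_col unfolding q2 by (metis tranclD2)
    then have "s = q"
      using sq by (metis rtranclD)
    then have eq: "b' = b" "j = i" "c' = other i"
      by (auto simp: s_def q2 j_def)
    \<comment> \<open>A monochromatic vertex from which a component is entered was not reached by a syllable.\<close>
    have b0: "b = v0"
      using b(1)
    proof (cases rule: reached_cases)
      case (2 b0 g)
      then show ?thesis
        using not_c' eq act_col by simp
    qed
    have v0: "v0 \<in> C i" "v0 \<notin> C (other i)"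
      using b' not_c' by (auto simp: eq b0)
    have noB: "u \<notin> B" if u: "u \<in> verts (comp i (fst \<Gamma>) v0)" for u
    proof
      assume uB: "u \<in> B"
      obtain g where g: "g \<in> carrier (F i)" "u = act i v0 g"
        using u comp_verts_act[OF v0(1)] by auto
      then obtain a where a: "a \<in> carrier AA" "g = \<phi> i a"
        using bi_A[unfolded eq b0] uB by (auto simp: AF_image)
      then have "u = P.aact v0 a"
        using g P.aact_eq[OF v0(1)] by simp
      then show False
        using uB P.aact_mem_iff[OF v0(1) a(1)] v0(2) by (auto simp: bichromatic_iff)
    qed
    have edge_i: "a \<in> letters (X i)" if e: "(t, a, u) \<in> EE" "t \<in> verts (comp i (fst \<Gamma>) v0)" for t a u
    proof -
      obtain k where k: "a \<in> letters (X k)" "t \<in> C k"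
        using ex_col[OF e(1)] by blast
      have "t \<in> C i"
        using e(2) comp_verts_act[OF v0(1)] act_col[OF v0(1)] by auto
      then have "k = i"
        using k(2) noB[OF e(2)] factor_exhaust_other[of k i] bichromatic_iff2[of t _ i] by auto
      then show ?thesis
        using k by simp
    qed
    have verts: "u \<in> verts (comp i (fst \<Gamma>) v0)" if "u \<in> VV" for u
    proof -
      obtain w where "walk (fst \<Gamma>) v0 w u"
        using connected[OF \<open>u \<in> VV\<close>] by blast
      then show ?thesis
      proof (induction w arbitrary: u rule: rev_induct)
        case Nil
        then show ?case
          using comp_self[OF v0_vert] by auto
      next
        case (snoc a w)
        then obtain t where "walk (fst \<Gamma>) v0 w t" "(t, a, u) \<in> EE"
          by (auto simp: walk_snoc[OF wf])
        then show ?case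
          using snoc.IH edge_i comp_step[OF wf] by blast
      qed
    qed
    have "comp i (fst \<Gamma>) v0 = fst \<Gamma>"
    proof (rule lgraph.equality)
      show "verts (comp i (fst \<Gamma>) v0) = verts (fst \<Gamma>)"
        using verts comp_subgraph[OF wf, of i v0] by (auto simp: subgraph_def)
      have "(x, a, y) \<in> edges (comp i (fst \<Gamma>) v0) \<longleftrightarrow> (x, a, y) \<in> EE" for x a y
        using edge_i[of x a y] verts wf_edge(1)[OF wf, of x a y] by (auto simp: comp_edges)
      then show "edges (comp i (fst \<Gamma>) v0) = EE"
        by (rule edge_set_eqI)
    qed simp
    then have iso: "\<Gamma> \<cong>\<^sub>p factor_cayley \<A> i K"
      using comp_iso[OF v0(1)] unfolding K_def eq b0 by simp
    have "B = {}"
      using noB verts by (auto simp: bichromatic_def)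
    then have "K \<noteq> {\<one>\<^bsub>F i\<^esub>}"
      using nontrivial iso by auto
    moreover have "\<one>\<^bsub>F i\<^esub> \<in> K"
      using v0 by (simp add: K_def eq b0)
    ultimately obtain k where "k \<in> carrier (F i)" "act i v0 k = v0" "k \<noteq> \<one>\<^bsub>F i\<^esub>"
      by (auto simp: K_def eq b0)
    then have "essential i v"
      unfolding essential_def using v0 b b0 by blast
    then show False
      using not_ess by blast
  qed
qed

end

section \<open>Normal paths in the relative Cayley graph\<close>

lemma label_simps [simp]:
  "label [] = []" "label (e # p) = lab e # label p" "label (p @ q) = label p @ label q"
  by (auto simp: label_def)

lemma path_in_verts: "wf_graph \<Gamma> \<Longrightarrow> path \<Gamma> u p v \<Longrightarrow> u \<in> verts \<Gamma> \<and> v \<in> verts \<Gamma>"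
  using walk_in_verts path_walk by metis

lemma path_append:
  "wf_graph \<Gamma> \<Longrightarrow> path \<Gamma> u (p @ q) v \<longleftrightarrow> (\<exists>t. path \<Gamma> u p t \<and> path \<Gamma> t q v)"
  by (induction p arbitrary: u) (auto dest: path_in_verts)

lemma walk_obtain_path:
  assumes "walk \<Gamma> u w v"
  obtains p where "path \<Gamma> u p v" "label p = w"
  using assms unfolding walk_iff_path by blast

lemma map_pgraph_cong:
  assumes "wf_graph (fst \<Gamma>)" "snd \<Gamma> \<in> verts (fst \<Gamma>)" "\<And>v. v \<in> verts (fst \<Gamma>) \<Longrightarrow> f v = g v"
  shows "map_pgraph f \<Gamma> = map_pgraph g \<Gamma>"
proof -
  have "(\<lambda>e. (f (ini e), lab e, f (ter e))) ` edges (fst \<Gamma>) =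
      (\<lambda>e. (g (ini e), lab e, g (ter e))) ` edges (fst \<Gamma>)"
    using assms(1,3) by (intro image_cong) (auto simp: wf_graph_def)
  moreover have "f ` verts (fst \<Gamma>) = g ` verts (fst \<Gamma>)"
    using assms(3) by (intro image_cong) auto
  ultimately show ?thesis
    using assms(2,3) by (simp add: map_pgraph_def)
qed

lemma map_pgraph_comp: "map_pgraph f (map_pgraph g \<Gamma>) = map_pgraph (f \<circ> g) \<Gamma>"
  by (simp add: map_pgraph_def image_image)

lemma iso_of_same_fibres:
  assumes "wf_graph (fst U)" "snd U \<in> verts (fst U)"
    and fib: "\<And>x y. x \<in> verts (fst U) \<Longrightarrow> y \<in> verts (fst U) \<Longrightarrow> M x = M y \<longleftrightarrow> q x = q y"
  shows "map_pgraph q U \<cong>\<^sub>p map_pgraph M U"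
proof -
  define f where "f z = M (inv_into (verts (fst U)) q z)" for z
  have f: "f (q x) = M x" if x: "x \<in> verts (fst U)" for x
  proof -
    have "inv_into (verts (fst U)) q (q x) \<in> verts (fst U)"
      "q (inv_into (verts (fst U)) q (q x)) = q x"
      using x by (auto intro: inv_into_into f_inv_into_f)
    then show ?thesis
      unfolding f_def using fib x by blast
  qed
  have "inj_on f (verts (fst (map_pgraph q U)))"
    unfolding map_simps by (rule inj_onI) (use f fib in auto)
  moreover have "map_pgraph f (map_pgraph q U) = map_pgraph M U"
    unfolding map_pgraph_comp using f by (intro map_pgraph_cong assms) auto
  ultimately show ?thesis
    unfolding pgraph_iso_def by blast
qed

context amalgam
begin

lemma elt_in_factor: "w \<in> words (X i) \<Longrightarrow> el w \<in> factor_in_G \<A> i"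
  by (simp add: factor_in_G_def)

lemma normal_path_single:
  assumes "label q \<in> words (X i)" "el (label q) \<noteq> \<one>\<^bsub>G\<^esub>"
  shows "normal_path \<A> q"
proof -
  have "q \<noteq> []"
    using assms by (auto simp: elt_one)
  then have "mono_decomposition \<A> q [q]"
    using assms by (auto simp: mono_decomposition_def)
  moreover have "normal_form \<A> [el (label q)]"
    using assms elt_in_factor by (auto simp: normal_form_def)
  ultimately show ?thesis
    unfolding normal_path_def by (intro exI[of _ "[q]"]) simp
qed

lemma alternating_nth:
  "alternating i ws \<Longrightarrow> k < length ws \<Longrightarrow>
    \<exists>j. ws ! k \<in> words (X j) \<and> fcl j (ws ! k) \<notin> AF j \<and>
      (Suc k < length ws \<longrightarrow> ws ! Suc k \<in> words (X (other j)))"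
proof (induction i ws arbitrary: k rule: alternating.induct)
  case (2 i w ws)
  show ?case
  proof (cases k)
    case 0
    then show ?thesis
      using 2 by (cases ws) auto
  next
    case (Suc k')
    then show ?thesis
      using 2 by auto
  qed
qed simp

lemma normal_path_alternating:
  assumes "alternating i (map label ps)"
  shows "normal_path \<A> (concat ps)"
proof -
  have nth: "\<exists>j. label (ps ! k) \<in> words (X j) \<and> fcl j (label (ps ! k)) \<notin> AF j \<and>
      (Suc k < length ps \<longrightarrow> label (ps ! Suc k) \<in> words (X (other j)))" if "k < length ps" for k
    using alternating_nth[OF assms, of k] that by auto
  have mem: "\<exists>j. label q \<in> words (X j) \<and> fcl j (label q) \<notin> AF j" if "q \<in> set ps" for q
    using that nth by (metis in_set_conv_nth)
  have ne: "el (label q) \<notin> A_in_G \<A> \<and> el (label q) \<noteq> \<one>\<^bsub>G\<^esub> \<and> q \<noteq> []" if q: "q \<in> set ps" for q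
  proof -
    obtain j where j: "label q \<in> words (X j)" "fcl j (label q) \<notin> AF j"
      using mem[OF q] by blast
    then have "fcl j (label q) \<noteq> \<one>\<^bsub>F j\<^esub>"
      using AF_one[of j] by auto
    then show ?thesis
      using j elt_in_A_iff elt_one_iff by (auto simp: fone)
  qed
  have "mono_decomposition \<A> (concat ps) ps"
    unfolding mono_decomposition_def
  proof (intro conjI ballI allI impI)
    show "\<exists>i. label (ps ! k) \<in> words (X i) \<and> label (ps ! Suc k) \<in> words (X (other i))"
      if "Suc k < length ps" for k
      using nth[of k] that by auto
  qed (use ne mem in auto)
  moreover have "normal_form \<A> (map (\<lambda>q. el (label q)) ps)"
    unfolding normal_form_def
  proof (intro conjI ballI allI impI)
    fix g assume "g \<in> set (map (\<lambda>q. el (label q)) ps)"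
    then obtain q where q: "q \<in> set ps" "g = el (label q)"
      by auto
    show "g \<noteq> \<one>\<^bsub>G\<^esub>" "\<exists>i. g \<in> factor_in_G \<A> i" "g \<notin> A_in_G \<A>"
      using ne[OF q(1)] mem[OF q(1)] elt_in_factor q(2) by auto
  next
    fix k assume k: "Suc k < length (map (\<lambda>q. el (label q)) ps)"
    then obtain j where "label (ps ! k) \<in> words (X j)" "label (ps ! Suc k) \<in> words (X (other j))"
      using nth[of k] by auto
    then show "\<exists>i. map (\<lambda>q. el (label q)) ps ! k \<in> factor_in_G \<A> i \<and>
        map (\<lambda>q. el (label q)) ps ! Suc k \<in> factor_in_G \<A> (other i)"
      using k elt_in_factor by (intro exI[of _ j]) auto
  qed
  ultimately show ?thesis
    unfolding normal_path_def by blast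
qed

lemma words_factor_unique:
  assumes "w \<in> words (X i)" "w \<in> words (X k)" "w \<noteq> []"
  shows "i = k"
proof -
  obtain a w' where "w = a # w'"
    using assms(3) by (cases w) auto
  then show ?thesis
    using assms letters_disjoint[of a i] factor_exhaust_other[of k i] by auto
qed

text \<open>The syllables of a normal path with more than one syllable alternate between the factors as in
  \<open>alternating\<close>, since a nonempty word belongs to one factor only.\<close>

lemma normal_path_cases:
  assumes "normal_path \<A> p"
  obtains "p = []"
  | i where "label p \<in> words (X i)" "el (label p) \<noteq> \<one>\<^bsub>G\<^esub>"
  | i ps where "p = concat ps" "alternating i (map label ps)" "ps \<noteq> []"
proof -
  obtain ps where dec: "mono_decomposition \<A> p ps"
    and nf: "normal_form \<A> (map (\<lambda>q. el (label q)) ps)"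
    using assms unfolding normal_path_def by blast
  have p: "p = concat ps"
    using dec by (simp add: mono_decomposition_def)
  consider "ps = []" | q where "ps = [q]" | "length ps \<ge> 2"
    by (cases ps; cases "tl ps") auto
  then show ?thesis
  proof cases
    case 1
    then show ?thesis
      using that(1) p by simp
  next
    case (2 q)
    then obtain i where "label q \<in> words (X i)"
      using dec by (auto simp: mono_decomposition_def)
    moreover have "el (label q) \<noteq> \<one>\<^bsub>G\<^esub>"
      using nf 2 by (auto simp: normal_form_def)
    ultimately show ?thesis
      using that(2) p 2 by simp
  next
    case 3
    have A: "el (label q) \<notin> A_in_G \<A>" if "q \<in> set ps" for q
      using nf 3 that unfolding normal_form_def by auto
    have mono: "\<exists>i. label q \<in> words (X i)" "q \<noteq> []" if "q \<in> set ps" for q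
      using dec that by (auto simp: mono_decomposition_def)
    have cons: "\<exists>i. label (ps ! k) \<in> words (X i) \<and> label (ps ! Suc k) \<in> words (X (other i))"
      if "Suc k < length ps" for k
      using dec that by (auto simp: mono_decomposition_def)
    have ex: "\<exists>i. alternating i (map label (drop n ps))" if "n < length ps" for n
      using that
    proof (induction "length ps - n" arbitrary: n)
      case (Suc d)
      then have dr: "drop n ps = ps ! n # drop (Suc n) ps"
        by (simp add: Cons_nth_drop_Suc)
      show ?case
      proof (cases "Suc n < length ps")
        case True
        have "d = length ps - Suc n"
          using Suc.hyps(2) by simp
        then obtain k where k: "alternating k (map label (drop (Suc n) ps))"
          using Suc.hyps(1) True by blast
        have dr2: "drop (Suc n) ps = ps ! Suc n # drop (Suc (Suc n)) ps"
          using True by (simp add: Cons_nth_drop_Suc)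
        obtain i where i: "label (ps ! n) \<in> words (X i)" "label (ps ! Suc n) \<in> words (X (other i))"
          using cons[OF True] by blast
        have "label (ps ! Suc n) \<in> words (X k)"
          using k unfolding dr2 by simp
        moreover have "label (ps ! Suc n) \<noteq> []"
          using mono(2)[of "ps ! Suc n"] True by (auto simp: label_def)
        ultimately have "k = other i"
          using words_factor_unique i(2) by blast
        then show ?thesis
          using i(1) k A[of "ps ! n"] Suc.prems elt_in_A_iff[OF i(1)]
          by (intro exI[of _ i]) (simp add: dr)
      next
        case False
        obtain i where i: "label (ps ! n) \<in> words (X i)"
          using mono(1)[of "ps ! n"] Suc.prems by auto
        then show ?thesis
          using False A[of "ps ! n"] Suc.prems elt_in_A_iff[OF i]
          by (intro exI[of _ i]) (simp add: dr)
      qed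
    qed simp
    have "0 < length ps"
      using 3 by linarith
    then obtain i where "alternating i (map label ps)"
      using ex[of 0] by auto
    moreover have "ps \<noteq> []"
      using 3 by auto
    ultimately show ?thesis
      using that(3)[OF p] by blast
  qed
qed

definition shift :: "factor \<Rightarrow> nat \<Rightarrow> factor" where
  "shift i n = (if even n then i else other i)"

lemma shift_simps [simp]: "shift i 0 = i" "shift i (Suc n) = other (shift i n)"
  "shift (other i) n = other (shift i n)"
  by (auto simp: shift_def)

lemma alternating_append:
  "alternating i (xs @ ys) \<longleftrightarrow> alternating i xs \<and> alternating (shift i (length xs)) ys"
  by (induction i xs rule: alternating.induct) auto

end

context stallings_input
begin

abbreviation "cay \<equiv> fst (amalgam_cayley \<A> H)"
abbreviation "core \<equiv> normal_core \<A> H"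

lemma H_coset: "H \<in> rcosets\<^bsub>G\<^esub> H" and H_one: "H #>\<^bsub>G\<^esub> \<one>\<^bsub>G\<^esub> = H"
  unfolding rcosets_H using G.coset_mult_one[OF H_carrier] by force+

lemma cay_snd [simp]: "snd (amalgam_cayley \<A> H) = H"
  using H_one by (simp add: amalgam_cayley_def cayley_def Let_def amalgam_group_def)

lemma cay_verts: "verts cay = rcosets\<^bsub>G\<^esub> H"
  by (simp add: amalgam_cayley_def cayley_def Let_def amalgam_group_def)

lemma cay_edge:
  "(c, a, c') \<in> edges cay \<longleftrightarrow> c \<in> rcosets\<^bsub>G\<^esub> H \<and> a \<in> letters XX \<and> c' = c #>\<^bsub>G\<^esub> el [a]"
proof -
  have "(c, a, c') \<in> edges cay \<longleftrightarrow> (\<exists>g\<in>carrier G. c = H #>\<^bsub>G\<^esub> g \<and> c' = H #>\<^bsub>G\<^esub> (g \<otimes>\<^bsub>G\<^esub> el [a])) \<and>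
      a \<in> letters XX"
    by (auto simp: amalgam_cayley_def cayley_def Let_def amalgam_group_def elt_def)
  moreover have "H #>\<^bsub>G\<^esub> (g \<otimes>\<^bsub>G\<^esub> el [a]) = (H #>\<^bsub>G\<^esub> g) #>\<^bsub>G\<^esub> el [a]"
    if "g \<in> carrier G" "a \<in> letters XX" for g
    using that by (simp add: G.coset_mult_assoc[OF H_carrier])
  ultimately show ?thesis
    unfolding rcosets_H by metis
qed

lemma cay_wf: "wf_graph cay"
proof (rule wf_graphI)
  fix c a c' assume "(c, a, c') \<in> edges cay"
  then have c: "c \<in> rcosets\<^bsub>G\<^esub> H" "a \<in> letters XX" "c' = c #>\<^bsub>G\<^esub> el [a]"
    by (auto simp: cay_edge)
  then have "c' #>\<^bsub>G\<^esub> el [linv a] = c"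
    by (simp add: coset_mult_assoc el_linv coset_one)
  then show "c \<in> verts cay \<and> c' \<in> verts cay \<and> (c', linv a, c) \<in> edges cay"
    using c rcosets_H_mult[OF c(1), of "el [a]"] by (simp add: cay_verts cay_edge)
qed

lemma cay_walk: "c \<in> rcosets\<^bsub>G\<^esub> H \<Longrightarrow> walk cay c w c' \<longleftrightarrow> w \<in> words XX \<and> c' = c #>\<^bsub>G\<^esub> el w"
proof (induction w arbitrary: c)
  case Nil
  then show ?case
    using coset_one[OF Nil] by (auto simp: cay_verts elt_one)
next
  case (Cons a w)
  have "c #>\<^bsub>G\<^esub> el (a # w) = (c #>\<^bsub>G\<^esub> el [a]) #>\<^bsub>G\<^esub> el w"
    if "a \<in> letters XX" "w \<in> words XX"
    using that Cons.prems elt_mult[of "[a]" w] by (simp add: coset_mult_assoc)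
  then show ?case
    using Cons rcosets_H_mult[OF Cons.prems, of "el [a]"] by (auto simp: cay_edge)
qed

lemma loops_iff: "p \<in> normal_loops \<A> H \<longleftrightarrow> normal_path \<A> p \<and> path cay H p H"
  by (simp add: normal_loops_def)

lemma loop_elt: "path cay H p H \<Longrightarrow> label p \<in> words XX \<and> el (label p) \<in> H"
  using path_walk[of cay H p H] cay_walk[OF H_coset] G.coset_join1[OF _ _ subgroup_H] by auto

lemma core_snd [simp]: "snd core = H"
  by (simp add: normal_core_def)

lemma core_edge_iff:
  "e \<in> edges (fst core) \<longleftrightarrow> (\<exists>p\<in>normal_loops \<A> H. e \<in> set p \<or> e \<in> einv ` set p)"
  by (simp add: normal_core_def)

lemma core_verts: "verts (fst core) = {H} \<union> ini ` edges (fst core)"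
proof -
  have "ini ` einv ` S = ter ` S" for S :: "('x word set set, 'x) edge set"
    by (force simp: einv_def)
  then show ?thesis
    by (simp add: normal_core_def image_UN image_Un)
qed

lemma core_eqI:
  assumes "snd Q = H" "edges (fst Q) = edges (fst core)" "verts (fst Q) = {H} \<union> ini ` edges (fst Q)"
  shows "Q = core"
  using assms core_verts by (intro prod_eqI lgraph.equality) auto

lemma core_edgesI:
  assumes "\<And>u a v. (u, a, v) \<in> E \<Longrightarrow> (v, linv a, u) \<in> E"
    and "\<And>p. p \<in> normal_loops \<A> H \<Longrightarrow> set p \<subseteq> E"
    and "\<And>e. e \<in> E \<Longrightarrow> \<exists>p\<in>normal_loops \<A> H. e \<in> set p"
  shows "E = edges (fst core)"
proof (intro equalityI subsetI)
  fix e assume "e \<in> edges (fst core)"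
  then obtain p where p: "p \<in> normal_loops \<A> H" "e \<in> set p \<or> e \<in> einv ` set p"
    by (auto simp: core_edge_iff)
  have "einv e' \<in> E" if "e' \<in> set p" for e'
    using assms(1)[of "ini e'" "lab e'" "ter e'"] assms(2)[OF p(1)] that by (auto simp: einv_def)
  then show "e \<in> E"
    using p assms(2)[OF p(1)] by auto
next
  fix e assume "e \<in> E"
  then show "e \<in> edges (fst core)"
    unfolding core_edge_iff using assms(3) by blast
qed

lemma core_trivial:
  assumes "H = {\<one>\<^bsub>G\<^esub>}"
  shows "core = (\<lparr>verts = {H}, edges = {}\<rparr>, H)"
proof -
  have nil: "p = []" if p: "p \<in> normal_loops \<A> H" for p
  proof -
    have "path cay H p H"
      using p unfolding loops_iff by blast
    then have "el (label p) \<in> H"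
      using loop_elt by blast
    with assms have el: "el (label p) = \<one>\<^bsub>G\<^esub>"
      by auto
    have "normal_path \<A> p"
      using p by (simp add: loops_iff)
    then show ?thesis
    proof (cases rule: normal_path_cases)
      case (3 i ps)
      have "label p = concat (map label ps)"
        unfolding 3(1) by (induction ps) auto
      then show ?thesis
        using alternating_nontrivial[OF 3(2)] 3(3) el by simp
    qed (use el in auto)
  qed
  have "edges (fst core) = {}"
    using nil by (force simp: core_edge_iff)
  then show ?thesis
    by (intro core_eqI[symmetric]) auto
qed

lemma H_trivialI:
  assumes "\<And>y. y \<in> set ws \<Longrightarrow> el y = \<one>\<^bsub>G\<^esub>"
  shows "H = {\<one>\<^bsub>G\<^esub>}"
proof -
  have "H \<subseteq> {\<one>\<^bsub>G\<^esub>}"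
    unfolding H_def using assms by (intro G.generate_subgroup_incl G.triv_subgroup) auto
  then show ?thesis
    using subgroup.one_closed[OF subgroup_H] by blast
qed

end

context precover_graph
begin

lemma coset_map_cay_edge:
  assumes "coset_map \<Gamma> m" "(u, a, v) \<in> EE"
  shows "(m u, a, m v) \<in> edges cay"
  using coset_map_edge[OF assms] coset_map_vert[OF assms(1)] wf_edge(1)[OF wf assms(2)]
    graph_ok_letter[OF ok assms(2)] by (simp add: cay_edge)

lemma coset_map_path:
  assumes "coset_map \<Gamma> m"
  shows "path (fst \<Gamma>) u p v \<Longrightarrow> path cay (m u) (map (\<lambda>e. (m (ini e), lab e, m (ter e))) p) (m v)"
proof (induction p arbitrary: u)
  case Nil
  then show ?case
    using coset_map_vert[OF assms] by (auto simp: cay_verts)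
next
  case (Cons e p)
  then show ?case
    using coset_map_cay_edge[OF assms, of "ini e" "lab e" "ter e"] by auto
qed

lemma label_map [simp]: "label (map (\<lambda>e. (m (ini e), lab e, m (ter e))) p) = label p"
  by (induction p) auto

lemma map_edges: "edges (fst (map_pgraph m \<Gamma>)) = (\<lambda>e. (m (ini e), lab e, m (ter e))) ` EE"
  by (simp add: map_pgraph_def)

text \<open>A path of the relative Cayley graph is determined by its start and its label, so it coincides with
  the image of a walk that has the same label.\<close>

lemma read_image:
  assumes m: "coset_map \<Gamma> m"
  shows "walk (fst \<Gamma>) u (label q) v \<Longrightarrow> path cay (m u) q c \<Longrightarrow>
    c = m v \<and> set q \<subseteq> edges (fst (map_pgraph m \<Gamma>))"
proof (induction q arbitrary: u)
  case (Cons e q)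
  obtain c0 a c1 where e: "e = (c0, a, c1)"
    by (cases e) auto
  obtain t where t: "(u, a, t) \<in> EE" "walk (fst \<Gamma>) t (label q) v"
    using Cons.prems(1) e by auto
  have "(m u, a, c1) \<in> edges cay" "c0 = m u" "path cay c1 q c"
    using Cons.prems(2) e by auto
  moreover from this have "c1 = m t"
    using coset_map_edge[OF m t(1)] by (simp add: cay_edge)
  moreover have "(m u, a, m t) \<in> edges (fst (map_pgraph m \<Gamma>))"
    using t(1) by (rule map_edgeI)
  ultimately show ?case
    using Cons.IH[OF t(2)] e by auto
qed simp

lemma reads_image:
  assumes m: "coset_map \<Gamma> m"
  shows "P.reads v i (map label ps) \<Longrightarrow> alternating i (map label ps) \<Longrightarrow> path cay (m v) (concat ps) c \<Longrightarrow>
    set (concat ps) \<subseteq> edges (fst (map_pgraph m \<Gamma>))"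
proof (induction ps arbitrary: v i)
  case (Cons q ps)
  obtain t where t: "path cay (m v) q t" "path cay t (concat ps) c"
    using Cons.prems(3) path_append[OF cay_wf] by auto
  have v: "v \<in> C i" "label q \<in> words (X i)"
    using Cons.prems by auto
  have "t = m (act i v (fcl i (label q))) \<and> set q \<subseteq> edges (fst (map_pgraph m \<Gamma>))"
    using read_image[OF m act_walk[OF v] t(1)] .
  then show ?case
    using Cons.IH[of "act i v (fcl i (label q))" "other i"] Cons.prems t(2) by auto
qed simp

text \<open>A normal loop represents an element of \<open>H\<close>, so in the extended action it returns to the base point
  with an empty stack. It has therefore never left the pre-cover.\<close>

lemma alternating_loop_image:
  assumes m: "coset_map \<Gamma> m" and k: "v0 \<in> C k"
    and ps: "alternating i (map label ps)" "path cay H (concat ps) H"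
  shows "set (concat ps) \<subseteq> edges (fst (map_pgraph m \<Gamma>))"
proof (rule reads_image[OF m _ ps(1)])
  have lc: "label (concat ps) = concat (map label ps)"
    by (induction ps) auto
  have "P.run (concat (map label ps)) (v0, []) = (v0, [])"
    using run_H[OF k] loop_elt[OF ps(2)] by (simp add: lc)
  then show "P.reads v0 i (map label ps)"
    by (intro P.run_alternating_reads[OF k ps(1)]) simp
  show "path cay (m v0) (concat ps) H"
    using ps(2) m by (simp add: coset_map_def)
qed

text \<open>If the element were not in \<open>A\<close>, its transversal part would be left on the stack.\<close>

lemma state_act_outside:
  assumes "v0 \<notin> C i" "v0 \<in> C (other i)" "g \<in> carrier (F i)" "P.state_act i (v0, []) g = (v, [])"
  obtains a where "a \<in> carrier AA" "g = \<phi> i a" "v = act (other i) v0 (\<phi> (other i) a)"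
proof -
  have eq: "P.push i (tr i g) (P.aact v0 (ap i g), []) = (v, [])"
    using assms by simp
  then have "tr i g = \<one>\<^bsub>F i\<^esub>"
    by (auto simp: P.push_def split: if_splits)
  then have "g \<in> AF i" "P.aact v0 (ap i g) = v"
    using eq assms(3) tr_one_iff by (auto simp: P.push_def)
  then obtain a where a: "a \<in> carrier AA" "g = \<phi> i a"
    by (auto simp: AF_image)
  then show ?thesis
    using that[of a] \<open>P.aact v0 (ap i g) = v\<close> P.aact_eq[OF assms(2)] by simp
qed

text \<open>A single syllable can leave the image only in the situation that is repaired by step 6: the base
  point is monochromatic and fixed by a nontrivial element of \<open>A\<close>.\<close>

lemma single_loop_image:
  assumes m: "coset_map \<Gamma> m" and k: "v0 \<in> C k"
    and q: "label q \<in> words (X i)" "path cay H q H" "el (label q) \<noteq> \<one>\<^bsub>G\<^esub>"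
    and out: "\<And>a. a \<in> carrier AA \<Longrightarrow> a \<noteq> \<one>\<^bsub>AA\<^esub> \<Longrightarrow> v0 \<notin> C i \<Longrightarrow> v0 \<in> C (other i) \<Longrightarrow>
      act (other i) v0 (\<phi> (other i) a) \<noteq> v0"
  shows "set q \<subseteq> edges (fst (map_pgraph m \<Gamma>))"
proof (cases "v0 \<in> C i")
  case True
  then show ?thesis
    using read_image[OF m act_walk[OF True q(1)]] q(2) m by (auto simp: coset_map_def)
next
  case False
  then have o: "v0 \<in> C (other i)"
    using k factor_exhaust_other[of k i] by auto
  have valid: "P.valid (v0, [])"
    using o by auto
  have "P.state_act i (v0, []) (fcl i (label q)) = P.run (label q) (v0, [])"
    by (rule P.run_factor[OF q(1) valid, symmetric])
  also have "\<dots> = (v0, [])"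
    using run_H[OF k] loop_elt[OF q(2)] by blast
  finally have "P.state_act i (v0, []) (fcl i (label q)) = (v0, [])" .
  then obtain a where a: "a \<in> carrier AA" "fcl i (label q) = \<phi> i a"
    "v0 = act (other i) v0 (\<phi> (other i) a)"
    by (rule state_act_outside[OF False o fcl_closed[OF q(1)]])
  have "a \<noteq> \<one>\<^bsub>AA\<^esub>"
    using a(2) q elt_one_iff[OF q(1)] by auto
  then show ?thesis
    using out[OF a(1) _ False o] a(3) by simp
qed

lemma run_coset_eq:
  assumes "v0 \<in> C k" "x \<in> words XX" "w \<in> words XX" "H #>\<^bsub>G\<^esub> el x = H #>\<^bsub>G\<^esub> el w"
  shows "P.run x (v0, []) = P.run w (v0, [])"
proof -
  have valid: "P.valid (v0, [])"
    using assms(1) by auto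
  have "el (x @ winv w) \<in> H"
    using assms by (simp add: coset_eq_iff elt_mult[symmetric] elt_inv)
  then have "P.run (x @ winv w) (v0, []) = (v0, [])"
    using run_H[OF assms(1), of "x @ winv w"] assms by simp
  then have "P.run ((x @ winv w) @ w) (v0, []) = P.run w (v0, [])"
    by simp
  moreover have "P.run ((x @ winv w) @ w) (v0, []) = P.run x (v0, [])"
  proof (rule P.run_eqI)
    show "el ((x @ winv w) @ w) = el x"
      using assms(2,3) elt_winv_cancel[of "winv w"]
      by (simp add: elt_mult[of x "winv w @ w", symmetric])
  qed (use assms valid in auto)
  ultimately show ?thesis by simp
qed

subsection \<open>Normal loops through the edges of essential components\<close>

text \<open>Any syllable in a component can be made to run through a prescribed edge of the component, by a
  detour that goes there and back.\<close>

lemma through_edge: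
  assumes b: "b \<in> C i" and g: "g \<in> carrier (F i)" and g1: "g1 \<in> carrier (F i)"
    and e: "(act i b g1, a, y) \<in> EE" "a \<in> letters (X i)"
  obtains q where "path (fst \<Gamma>) b q (act i b g)" "(act i b g1, a, y) \<in> set q"
    "label q \<in> words (X i)" "fcl i (label q) = g"
proof -
  let ?x = "act i b g1"
  obtain w1 w where w: "w1 \<in> words (X i)" "g1 = fcl i w1" "w \<in> words (X i)" "g = fcl i w"
    using ex_fword g g1 by metis
  have walk1: "walk (fst \<Gamma>) b w1 ?x"
    using act_walk[OF b w(1)] w(2) by simp
  obtain p1 where p1: "path (fst \<Gamma>) b p1 ?x" "label p1 = w1"
    using walk_obtain_path[OF walk1] .
  obtain p1' where p1': "path (fst \<Gamma>) ?x p1' b" "label p1' = winv w1"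
    using walk_obtain_path[OF walk_inv[OF wf walk1]] .
  have "walk (fst \<Gamma>) b w (act i b g)"
    using act_walk[OF b w(3)] w(4) by simp
  then obtain p2 where p2: "path (fst \<Gamma>) b p2 (act i b g)" "label p2 = w"
    by (rule walk_obtain_path)
  define q where "q = p1 @ (?x, a, y) # (y, linv a, ?x) # p1' @ p2"
  have "path (fst \<Gamma>) b q (act i b g)"
    unfolding q_def using p1 p1' p2 e wf_edge(3)[OF wf e(1)] by (auto simp: path_append[OF wf])
  moreover have lab: "label q = (w1 @ [a]) @ winv (w1 @ [a]) @ w"
    using p1 p1' p2 by (simp add: q_def)
  then have "label q \<in> words (X i)"
    using w e by simp
  moreover have "fcl i (label q) = g"
  proof -
    have "fcl i (label q) = fcl i ((w1 @ [a]) @ winv (w1 @ [a])) \<otimes>\<^bsub>F i\<^esub> fcl i w"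
      unfolding lab using w e by (simp add: fmult)
    also have "fcl i ((w1 @ [a]) @ winv (w1 @ [a])) = \<one>\<^bsub>F i\<^esub>"
      unfolding fone using w e by (intro fp.cl_eqI fp.pres_rel_winv) auto
    finally show ?thesis
      using w by simp
  qed
  moreover have "(?x, a, y) \<in> set q"
    by (simp add: q_def)
  ultimately show ?thesis
    using that by blast
qed

text \<open>The sequence of syllables is recovered as a list of paths; the parity of its length determines
  the last factor.\<close>

lemma syl_path:
  assumes "(p, q) \<in> syl\<^sup>*" "fst p \<in> VV"
  shows "\<exists>ps. path (fst \<Gamma>) (fst p) (concat ps) (fst q) \<and>
    alternating (other (snd p)) (map label ps) \<and> snd q = shift (snd p) (length ps)"
  using assms
proof (induction rule: rtrancl_induct)
  case base
  then show ?case
    by (intro exI[of _ "[]"]) auto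
next
  case (step q r)
  obtain ps where ps: "path (fst \<Gamma>) (fst p) (concat ps) (fst q)"
    "alternating (other (snd p)) (map label ps)" "snd q = shift (snd p) (length ps)"
    using step by blast
  obtain u i v k where qr: "q = (u, i)" "r = (v, k)"
    by (cases q; cases r) auto
  obtain g where g: "k = other i" "u \<in> C k" "g \<in> carrier (F k)" "g \<notin> AF k" "v = act k u g"
    using step(2) unfolding qr syl_iff by blast
  obtain w where w: "w \<in> words (X k)" "g = fcl k w"
    using ex_fword[OF g(3)] by blast
  then have "walk (fst \<Gamma>) u w v"
    using act_walk[OF g(2)] g(5) by simp
  then obtain s where s: "path (fst \<Gamma>) u s v" "label s = w"
    by (rule walk_obtain_path)
  have "path (fst \<Gamma>) (fst p) (concat (ps @ [s])) (fst r)"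
    using ps(1) s(1) qr by (auto simp: path_append[OF wf])
  moreover have "alternating (other (snd p)) (map label (ps @ [s]))"
    using ps(2,3) s(2) w g qr by (auto simp: alternating_append)
  moreover have "snd r = shift (snd p) (length (ps @ [s]))"
    using ps(3) qr g(1) by simp
  ultimately show ?case by blast
qed

lemma essential_loop:
  assumes "essential i x" "x \<in> C i" and e: "(x, a, y) \<in> EE" "a \<in> letters (X i)"
  shows "\<exists>ps. path (fst \<Gamma>) v0 (concat ps) v0 \<and> (x, a, y) \<in> set (concat ps) \<and>
    (alternating First (map label ps) \<or> alternating Second (map label ps) \<or>
     (\<exists>q. ps = [q] \<and> label q \<in> words (X i) \<and> el (label q) \<noteq> \<one>\<^bsub>G\<^esub>))"
  using assms(1) unfolding essential_def
proof (elim disjE exE conjE bexE)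
  fix b b' g1
  assume b: "(b, other i) \<in> reached" and b': "(b', other i) \<in> reached"
    and s: "((b, other i), (b', i)) \<in> syl" and g1: "g1 \<in> carrier (F i)" "x = act i b g1"
  obtain g where g: "b \<in> C i" "g \<in> carrier (F i)" "g \<notin> AF i" "b' = act i b g"
    using s unfolding syl_iff by blast
  obtain q where q: "path (fst \<Gamma>) b q b'" "(x, a, y) \<in> set q" "label q \<in> words (X i)"
    "fcl i (label q) = g"
    using through_edge[OF g(1,2) g1(1)] e g1(2) g(4) by metis
  obtain k where k: "((v0, k), (b, other i)) \<in> syl\<^sup>*"
    using b unfolding reached_def by blast
  obtain ps1 where ps1: "path (fst \<Gamma>) v0 (concat ps1) b" "alternating (other k) (map label ps1)"
    "other i = shift k (length ps1)"
    using syl_path[OF k] v0_vert by auto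
  obtain k' where "((v0, k'), (b', other i)) \<in> syl\<^sup>*"
    using b' unfolding reached_def by blast
  then have k': "((b', i), (v0, other k')) \<in> syl\<^sup>*"
    using syl_rtrancl_flip[of "(v0, k')" "(b', other i)"] by simp
  have "b' \<in> VV"
    using g act_col col_vert by blast
  then obtain ps2 where ps2: "path (fst \<Gamma>) b' (concat ps2) v0" "alternating (other i) (map label ps2)"
    using syl_path[OF k'] by auto
  let ?ps = "ps1 @ [q] @ ps2"
  have "path (fst \<Gamma>) v0 (concat ?ps) v0"
    using ps1(1) q(1) ps2(1) by (auto simp: path_append[OF wf])
  moreover have "alternating (other k) (map label ?ps)"
    using ps1(2) ps1(3)[symmetric] q(3,4) g(3) ps2(2) by (simp add: alternating_append)
  then have "alternating First (map label ?ps) \<or> alternating Second (map label ?ps)"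
    by (cases k) auto
  moreover have "(x, a, y) \<in> set (concat ?ps)"
    using q(2) by auto
  ultimately show ?thesis by blast
next
  fix g1 g
  assume v0: "v0 \<in> C i" and g: "g1 \<in> carrier (F i)" "x = act i v0 g1" "g \<in> carrier (F i)"
    "g \<noteq> \<one>\<^bsub>F i\<^esub>" "act i v0 g = v0"
  obtain q where q: "path (fst \<Gamma>) v0 q v0" "(x, a, y) \<in> set q" "label q \<in> words (X i)"
    "fcl i (label q) = g"
    using through_edge[OF v0 g(3,1)] e g(2,5) by metis
  have "el (label q) \<noteq> \<one>\<^bsub>G\<^esub>"
    using q g(4) elt_one_iff by simp
  then show ?thesis
    using q by (intro exI[of _ "[q]"]) auto
qed

lemma core_contains_image:
  assumes m: "coset_map \<Gamma> m" and ess: "\<And>i v. v \<in> C i \<Longrightarrow> essential i v"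
    and e: "e \<in> edges (fst (map_pgraph m \<Gamma>))"
  shows "\<exists>p\<in>normal_loops \<A> H. e \<in> set p"
proof -
  let ?f = "\<lambda>e. (m (ini e), lab e, m (ter e))"
  obtain x a y where xay: "(x, a, y) \<in> EE" "e = ?f (x, a, y)"
    using e unfolding map_edges by force
  obtain i where i: "a \<in> letters (X i)" "x \<in> C i"
    using ex_col[OF xay(1)] by blast
  obtain ps where ps: "path (fst \<Gamma>) v0 (concat ps) v0" "(x, a, y) \<in> set (concat ps)"
    "alternating First (map label ps) \<or> alternating Second (map label ps) \<or>
     (\<exists>q. ps = [q] \<and> label q \<in> words (X i) \<and> el (label q) \<noteq> \<one>\<^bsub>G\<^esub>)"
    using essential_loop[OF ess[OF i(2)] i(2) xay(1) i(1)] by blast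
  define qs where "qs = map (map ?f) ps"
  have conc: "concat qs = map ?f (concat ps)"
    by (simp add: qs_def map_concat)
  have labs: "map label qs = map label ps"
    by (simp add: qs_def)
  have "path cay H (concat qs) H"
    using coset_map_path[OF m ps(1)] m by (simp add: conc coset_map_def)
  moreover have "normal_path \<A> (concat qs)"
    using ps(3)
  proof (elim disjE exE conjE)
    fix q assume "ps = [q]" "label q \<in> words (X i)" "el (label q) \<noteq> \<one>\<^bsub>G\<^esub>"
    then show ?thesis
      unfolding conc by (intro normal_path_single[of _ i]) auto
  qed (use normal_path_alternating labs in metis)+
  moreover have "e \<in> set (concat qs)"
    unfolding conc xay(2) set_map using ps(2) by (rule imageI)
  ultimately have "concat qs \<in> normal_loops \<A> H" "e \<in> set (concat qs)"
    unfolding loops_iff by blast+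
  then show ?thesis
    by blast
qed

lemma image_verts:
  assumes m: "coset_map \<Gamma> m"
  shows "m ` VV = {H} \<union> ini ` edges (fst (map_pgraph m \<Gamma>))"
proof (intro equalityI subsetI)
  fix c assume "c \<in> m ` VV"
  then obtain v where v: "v \<in> VV" "c = m v"
    by blast
  obtain w where w: "walk (fst \<Gamma>) v0 w v"
    using connected[OF v(1)] by blast
  show "c \<in> {H} \<union> ini ` edges (fst (map_pgraph m \<Gamma>))"
  proof (cases w rule: rev_cases)
    case Nil
    then show ?thesis
      using w v m by (simp add: coset_map_def)
  next
    case (snoc w' a)
    then obtain t where "(t, a, v) \<in> EE"
      using w by (auto simp: walk_snoc[OF wf])
    then have "(m v, linv a, m t) \<in> edges (fst (map_pgraph m \<Gamma>))"
      using wf_edge(3)[OF wf] map_edgeI by metis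
    then have "ini (m v, linv a, m t) \<in> ini ` edges (fst (map_pgraph m \<Gamma>))"
      by (rule imageI)
    then show ?thesis
      using v by simp
  qed
next
  fix c assume "c \<in> {H} \<union> ini ` edges (fst (map_pgraph m \<Gamma>))"
  then consider "c = H" | u a v where "(u, a, v) \<in> EE" "c = m u"
    unfolding map_edges by force
  then show "c \<in> m ` VV"
  proof cases
    case 1
    then show ?thesis
      using m v0_vert by (auto simp: coset_map_def)
  next
    case (2 u a v)
    then show ?thesis
      using wf_edge(1)[OF wf] by blast
  qed
qed

end

section \<open>The output of the algorithm\<close>

context precover_graph
begin

lemma mono_base:
  assumes "v0 \<in> C i"
  shows "v0 \<in> monochromatic \<A> i (fst \<Gamma>) \<longleftrightarrow> v0 \<notin> C (other i)"
proof
  assume "v0 \<in> monochromatic \<A> i (fst \<Gamma>)"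
  then have "a \<in> letters (X i)" if "(v0, a, u) \<in> EE" for a u
    using that unfolding monochromatic_def by force
  then show "v0 \<notin> C (other i)"
    using letters_disjoint by (auto simp: col_def)
next
  assume "v0 \<notin> C (other i)"
  then show "v0 \<in> monochromatic \<A> i (fst \<Gamma>)"
    using not_mono_bichromatic[OF assms] by (auto simp: bichromatic_iff)
qed

lemma needs_completionD:
  assumes "needs_completion \<A> \<Gamma> i C0 L"
  shows "v0 \<in> C i" "v0 \<notin> C (other i)" "C0 = comp i (fst \<Gamma>) v0"
    "L = {a \<in> carrier AA. act i v0 (\<phi> i a) = v0}" "L \<noteq> {\<one>\<^bsub>AA\<^esub>}"
proof -
  obtain K where mono: "v0 \<in> monochromatic \<A> i (fst \<Gamma>)" "mono_component (X i) (fst \<Gamma>) C0" "v0 \<in> verts C0"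
    and K: "subgroup K (F i)" "(C0, v0) \<cong>\<^sub>p factor_cayley \<A> i K" "L = {a \<in> carrier AA. \<phi> i a \<in> K}"
    and L: "L \<noteq> {\<one>\<^bsub>AA\<^esub>}"
    using assms unfolding needs_completion_def by blast
  show v0: "v0 \<in> C i" and C0: "C0 = comp i (fst \<Gamma>) v0"
    using mono_component_eq_comp[OF wf mono(2,3)] by auto
  show "v0 \<notin> C (other i)"
    using mono_base[OF v0] mono(1) by blast
  have "K = {g \<in> carrier (F i). act i v0 g = v0}"
    using iso_stabilizer[OF v0 K(1)] K(2) C0 by simp
  then show "L = {a \<in> carrier AA. act i v0 (\<phi> i a) = v0}"
    using K(3) by auto
  show "L \<noteq> {\<one>\<^bsub>AA\<^esub>}"
    using L .
qed

lemma needs_completionI: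
  assumes v0: "v0 \<in> C i" "v0 \<notin> C (other i)"
    and a: "a \<in> carrier AA" "a \<noteq> \<one>\<^bsub>AA\<^esub>" "act i v0 (\<phi> i a) = v0"
  shows "\<exists>C0 L. needs_completion \<A> \<Gamma> i C0 L"
proof -
  let ?K = "{g \<in> carrier (F i). act i v0 g = v0}"
  let ?L = "{a \<in> carrier AA. \<phi> i a \<in> ?K}"
  have "v0 \<in> monochromatic \<A> i (fst \<Gamma>)"
    using mono_base[OF v0(1)] v0(2) by blast
  moreover have "mono_component (X i) (fst \<Gamma>) (comp i (fst \<Gamma>) v0)" "v0 \<in> verts (comp i (fst \<Gamma>) v0)"
    using comp_mono_component[OF wf v0(1)] comp_self[OF v0_vert] by blast+
  moreover have "a \<in> ?L"
    using a by simp
  then have "?L \<noteq> {\<one>\<^bsub>AA\<^esub>}"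
    using a(2) by blast
  ultimately have "needs_completion \<A> \<Gamma> i (comp i (fst \<Gamma>) v0) ?L"
    unfolding needs_completion_def using stabilizer_subgroup[OF v0(1)] comp_iso[OF v0(1)] by blast
  then show ?thesis
    by blast
qed

lemma loop_image:
  assumes m: "coset_map \<Gamma> m" and k: "v0 \<in> C k" and p: "p \<in> normal_loops \<A> H"
    and single: "\<And>i. label p \<in> words (X i) \<Longrightarrow> el (label p) \<noteq> \<one>\<^bsub>G\<^esub> \<Longrightarrow> path cay H p H \<Longrightarrow> set p \<subseteq> E"
    and E: "edges (fst (map_pgraph m \<Gamma>)) \<subseteq> E"
  shows "set p \<subseteq> E"
proof -
  have np: "normal_path \<A> p" and loop: "path cay H p H"
    using p by (auto simp: loops_iff)
  from np show ?thesis
  proof (cases rule: normal_path_cases)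
    case (2 i)
    then show ?thesis
      using single loop by blast
  next
    case (3 i ps)
    then show ?thesis
      using alternating_loop_image[OF m k 3(2)] loop E by blast
  qed simp
qed

text \<open>If the base point needs no completion, it is bichromatic or no nontrivial element of \<open>A\<close> fixes it.
  In both cases a normal loop of one syllable stays in the image as well.\<close>

lemma core_eq_image:
  assumes m: "coset_map \<Gamma> m" and k: "v0 \<in> C k" and ess: "\<And>i v. v \<in> C i \<Longrightarrow> essential i v"
    and "\<nexists>i C0 L. needs_completion \<A> \<Gamma> i C0 L"
  shows "map_pgraph m \<Gamma> = core"
proof (rule core_eqI)
  show "snd (map_pgraph m \<Gamma>) = H"
    using m by (simp add: coset_map_def)
  show "edges (fst (map_pgraph m \<Gamma>)) = edges (fst core)"
  proof (rule core_edgesI)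
    show "(v, linv a, u) \<in> edges (fst (map_pgraph m \<Gamma>))" if "(u, a, v) \<in> edges (fst (map_pgraph m \<Gamma>))"
      for u a v
      using wf_edge(3)[OF wf_map[OF wf] that] .
    show "\<exists>p\<in>normal_loops \<A> H. e \<in> set p" if "e \<in> edges (fst (map_pgraph m \<Gamma>))" for e
      using core_contains_image[OF m ess that] .
    fix p assume p: "p \<in> normal_loops \<A> H"
    show "set p \<subseteq> edges (fst (map_pgraph m \<Gamma>))"
    proof (rule loop_image[OF m k p])
      fix i assume q: "label p \<in> words (X i)" "el (label p) \<noteq> \<one>\<^bsub>G\<^esub>" "path cay H p H"
      show "set p \<subseteq> edges (fst (map_pgraph m \<Gamma>))"
      proof (rule single_loop_image[OF m k q(1,3,2)])
        fix a assume "a \<in> carrier AA" "a \<noteq> \<one>\<^bsub>AA\<^esub>" "v0 \<notin> C i" "v0 \<in> C (other i)"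
        then show "act (other i) v0 (\<phi> (other i) a) \<noteq> v0"
          using needs_completionI[of "other i" a] assms(4) by auto
      qed
    qed simp
  qed
  show "verts (fst (map_pgraph m \<Gamma>)) = {H} \<union> ini ` edges (fst (map_pgraph m \<Gamma>))"
    using image_verts[OF m] by simp
qed

end

text \<open>The situation in which step 6 glues a component. The resulting graph is not shown to be a
  pre-cover; instead the coset map is extended to the glued copy, and the result is compared with its
  image directly.\<close>

locale completion = precover_graph \<A> ws \<Gamma>
  for \<A> :: "('a, 'x) amalgam" and ws and \<Gamma> :: "('v, 'x) pgraph" +
  fixes i :: factor and L :: "'a set" and m
  assumes m: "coset_map \<Gamma> m"
    and v0i: "v0 \<in> C i" and v0j: "v0 \<notin> C (other i)"
    and L: "L = {a \<in> carrier AA. act i v0 (\<phi> i a) = v0}" and L_ne: "L \<noteq> {\<one>\<^bsub>AA\<^esub>}"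
    and ess: "\<And>i v. v \<in> C i \<Longrightarrow> essential i v"
begin

abbreviation "j \<equiv> other i"
abbreviation "Lj \<equiv> \<phi> j ` L"
abbreviation "U \<equiv> disj_union \<Gamma> {j} (\<lambda>k. fst (factor_cayley \<A> k Lj))"

definition glue_pairs :: "('v + factor \<times> 'x word set set) rel" where
  "glue_pairs = {(Inl v0, Inr (j, Lj #>\<^bsub>F j\<^esub> \<one>\<^bsub>F j\<^esub>))} \<union>
    {(Inl t, Inr (j, Lj #>\<^bsub>F j\<^esub> \<phi> j a)) |a t p. a \<in> carrier AA - L \<and>
      path (comp i (fst \<Gamma>) v0) v0 p t \<and> label p \<in> \<phi> i a}"

definition M :: "'v + factor \<times> 'x word set set \<Rightarrow> 'x word set set" where
  "M z = (case z of Inl v \<Rightarrow> m v | Inr (k, D) \<Rightarrow> lift H k D)"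

lemma L_aact: "L = {a \<in> carrier AA. P.aact v0 a = v0}"
  unfolding L using P.aact_eq[OF v0i] by auto

lemma subgroup_L: "subgroup L AA"
proof (rule A.subgroupI)
  show "L \<subseteq> carrier AA"
    by (auto simp: L)
  have "\<one>\<^bsub>AA\<^esub> \<in> L"
    using P.aact_one[OF v0i] by (simp add: L_aact)
  then show "L \<noteq> {}"
    by blast
  show "inv\<^bsub>AA\<^esub> a \<in> L" if "a \<in> L" for a
    using that P.aact_mult[OF v0i, of a "inv\<^bsub>AA\<^esub> a"] P.aact_one[OF v0i] by (auto simp: L_aact)
  show "a \<otimes>\<^bsub>AA\<^esub> b \<in> L" if "a \<in> L" "b \<in> L" for a b
    using that P.aact_mult[OF v0i] by (auto simp: L_aact)
qed

lemma subgroup_Lj: "subgroup Lj (F j)"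
  using subgroup_L by (rule \<phi>.subgroup_img_is_subgroup)

lemma m_v0: "m v0 = H"
  using m by (simp add: coset_map_def)

lemma m_\<phi>:
  assumes "a \<in> carrier AA"
  shows "m (act i v0 (\<phi> i a)) = H #>\<^bsub>G\<^esub> gel j (\<phi> j a)"
proof -
  obtain w where w: "w \<in> \<phi> i a"
    using ex_\<phi>_word[OF assms] by blast
  then have "walk (fst \<Gamma>) v0 w (act i v0 (\<phi> i a))"
    using \<phi>_word[OF assms w] walk_act[OF v0i, of w] by simp
  then have "m (act i v0 (\<phi> i a)) = H #>\<^bsub>G\<^esub> el w"
    using coset_map_walk[OF ok m] m_v0 by metis
  also have "el w = gel i (\<phi> i a)"
    using gel_eq[of "\<phi> i a" i w] assms w by simp
  also have "\<dots> = gel j (\<phi> j a)"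
    using gel_\<phi>[OF assms] .
  finally show ?thesis .
qed

lemma Lj_stab: "s \<in> Lj \<Longrightarrow> H #>\<^bsub>G\<^esub> gel j s = H"
proof -
  assume "s \<in> Lj"
  then obtain a where "a \<in> carrier AA" "act i v0 (\<phi> i a) = v0" "s = \<phi> j a"
    by (auto simp: L)
  then show "H #>\<^bsub>G\<^esub> gel j s = H"
    using m_\<phi>[of a] m_v0 by metis
qed

lemma lift_j: "g \<in> carrier (F j) \<Longrightarrow> lift H j (Lj #>\<^bsub>F j\<^esub> g) = H #>\<^bsub>G\<^esub> gel j g"
  using lift_eq[OF subgroup_Lj H_coset Lj_stab] by blast

lemma lift_j_edge:
  "(D, a, D') \<in> edges (fst (factor_cayley \<A> j Lj)) \<Longrightarrow> lift H j D' = lift H j D #>\<^bsub>G\<^esub> el [a]"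
  using lift_coset_map(2)[OF subgroup_Lj H_coset Lj_stab] by blast

lemma M_simps [simp]: "M (Inl v) = m v" "M (Inr (k, D)) = lift H k D"
  by (simp_all add: M_def)

lemma M_pairs: "(x, y) \<in> glue_pairs \<Longrightarrow> M x = M y"
  unfolding glue_pairs_def
proof (elim UnE)
  assume "(x, y) \<in> {(Inl v0, Inr (j, Lj #>\<^bsub>F j\<^esub> \<one>\<^bsub>F j\<^esub>))}"
  then show "M x = M y"
    using lift_j[of "\<one>\<^bsub>F j\<^esub>"] m_v0 H_one by simp
next
  assume "(x, y) \<in> {(Inl t, Inr (j, Lj #>\<^bsub>F j\<^esub> \<phi> j a)) |a t p. a \<in> carrier AA - L \<and>
      path (comp i (fst \<Gamma>) v0) v0 p t \<and> label p \<in> \<phi> i a}"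
  then obtain a t p where a: "a \<in> carrier AA" "path (comp i (fst \<Gamma>) v0) v0 p t" "label p \<in> \<phi> i a"
    and xy: "x = Inl t" "y = Inr (j, Lj #>\<^bsub>F j\<^esub> \<phi> j a)"
    by blast
  have "walk (fst \<Gamma>) v0 (label p) t"
    using path_walk[OF a(2)] comp_subgraph[OF wf] walk_mono unfolding subgraph_def by metis
  then have "t = act i v0 (\<phi> i a)"
    using walk_act[OF v0i] \<phi>_word[OF a(1,3)] by auto
  then show "M x = M y"
    using lift_j[of "\<phi> j a"] a(1) m_\<phi> xy by simp
qed

lemma outside_AF:
  assumes g: "g \<in> carrier (F j)" and w: "walk (fst \<Gamma>) v0 w v" and eq: "H #>\<^bsub>G\<^esub> gel j g = H #>\<^bsub>G\<^esub> el w"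
  obtains a where "a \<in> carrier AA" "g = \<phi> j a" "v = act i v0 (\<phi> i a)"
proof -
  obtain x where x: "x \<in> words (X j)" "g = fcl j x"
    using ex_fword[OF g] by blast
  have "P.run x (v0, []) = P.run w (v0, [])"
    using run_coset_eq[OF v0i words_XX[OF x(1)] walk_words[OF ok w]] eq gel_fcl[OF x(1)] x(2) by simp
  also have "\<dots> = (v, [])"
    using run_walk[OF w v0i] .
  also have "P.run x (v0, []) = P.state_act j (v0, []) g"
    using P.run_factor[OF x(1), of "(v0, [])"] v0i x(2) by (auto simp del: P.state_act.simps)
  finally show ?thesis
    using state_act_outside[OF v0j _ g] v0i that by auto
qed

text \<open>No vertices other than those glued together lie over the same coset. In the copy, the stabilizer of
  \<open>H\<close> is the image of \<open>L\<close>, and the copy meets the old graph only in the orbit of the base point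
  under \<open>A\<close>; both follow from \<open>outside_AF\<close>.\<close>

lemma same_fibre:
  assumes "x \<in> verts (fst U)" "y \<in> verts (fst U)" "M x = M y"
  shows "(x, y) \<in> (glue_pairs \<union> glue_pairs\<inverse>)\<^sup>*"
proof -
  have mixed: "(Inl v, Inr (j, D)) \<in> glue_pairs"
    if v: "v \<in> VV" and D: "D \<in> rcosets\<^bsub>F j\<^esub> Lj" and eq: "m v = lift H j D" for v D
  proof -
    obtain g where g: "g \<in> carrier (F j)" "D = Lj #>\<^bsub>F j\<^esub> g"
      using D by (auto simp: rcosets_iff)
    obtain w where w: "walk (fst \<Gamma>) v0 w v"
      using connected[OF v] by blast
    have "H #>\<^bsub>G\<^esub> gel j g = H #>\<^bsub>G\<^esub> el w"
      using eq lift_j[OF g(1)] coset_map_walk[OF ok m w] m_v0 by (simp add: g(2))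
    then obtain a where a: "a \<in> carrier AA" "g = \<phi> j a" "v = act i v0 (\<phi> i a)"
      using outside_AF[OF g(1) w] by blast
    show ?thesis
    proof (cases "a \<in> L")
      case True
      then have "v = v0" "g \<in> Lj"
        using a by (auto simp: L)
      then have "D = Lj #>\<^bsub>F j\<^esub> \<one>\<^bsub>F j\<^esub>"
        using g F.coset_join2[OF g(1) subgroup_Lj] F.coset_mult_one[OF subgroup.subset[OF subgroup_Lj]]
        by simp
      then show ?thesis
        using \<open>v = v0\<close> by (simp add: glue_pairs_def)
    next
      case False
      obtain u where u: "u \<in> \<phi> i a"
        using ex_\<phi>_word[OF a(1)] by blast
      have uw: "u \<in> words (X i)" "fcl i u = \<phi> i a"
        using \<phi>_word[OF a(1) u] by auto
      have "walk (comp i (fst \<Gamma>) v0) v0 u v"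
        using comp_walk[OF wf comp_self[OF v0_vert] uw(1)] act_walk[OF v0i uw(1)] a(3) uw(2) by simp
      then obtain p where "path (comp i (fst \<Gamma>) v0) v0 p v" "label p = u"
        by (rule walk_obtain_path)
      then show ?thesis
        unfolding glue_pairs_def using a False u g(2) by blast
    qed
  qed
  show ?thesis
  proof (cases x)
    case x: (Inl u)
    show ?thesis
    proof (cases y)
      case (Inl v)
      then have "u = v"
        using coset_map_inj[OF m, of u v] assms x by simp
      then show ?thesis
        using x Inl by simp
    next
      case (Inr p)
      then have "(x, y) \<in> glue_pairs"
        using mixed assms x by (cases p) auto
      then show ?thesis by blast
    qed
  next
    case (Inr p)
    then obtain D where x: "x = Inr (j, D)" "D \<in> rcosets\<^bsub>F j\<^esub> Lj"
      using assms(1) by (cases p) auto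
    show ?thesis
    proof (cases y)
      case (Inl v)
      then have "(y, x) \<in> glue_pairs"
        using mixed[of v D] assms x by simp
      then show ?thesis by blast
    next
      case (Inr p)
      then obtain D' where y: "y = Inr (j, D')" "D' \<in> rcosets\<^bsub>F j\<^esub> Lj"
        using assms(2) by (cases p) auto
      obtain g h where g: "g \<in> carrier (F j)" "D = Lj #>\<^bsub>F j\<^esub> g"
        and h: "h \<in> carrier (F j)" "D' = Lj #>\<^bsub>F j\<^esub> h"
        using x y by (auto simp: rcosets_iff)
      have "H #>\<^bsub>G\<^esub> gel j g = H #>\<^bsub>G\<^esub> gel j h"
        using assms(3) lift_j g h x y by simp
      then have "gel j g \<otimes>\<^bsub>G\<^esub> inv\<^bsub>G\<^esub> gel j h \<in> H"
        using g h by (simp add: coset_eq_iff)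
      then have "gel j (g \<otimes>\<^bsub>F j\<^esub> inv\<^bsub>F j\<^esub> h) \<in> H"
        using g h by simp
      then have "H #>\<^bsub>G\<^esub> gel j (g \<otimes>\<^bsub>F j\<^esub> inv\<^bsub>F j\<^esub> h) = H #>\<^bsub>G\<^esub> el []"
        using g h H_one G.coset_join2[OF _ subgroup_H] by (simp add: elt_one)
      moreover have "walk (fst \<Gamma>) v0 [] v0"
        using v0_vert by simp
      ultimately obtain a where a: "a \<in> carrier AA" "g \<otimes>\<^bsub>F j\<^esub> inv\<^bsub>F j\<^esub> h = \<phi> j a"
        "v0 = act i v0 (\<phi> i a)"
        using outside_AF[of "g \<otimes>\<^bsub>F j\<^esub> inv\<^bsub>F j\<^esub> h" "[]" v0] g h by auto
      then have "g \<otimes>\<^bsub>F j\<^esub> inv\<^bsub>F j\<^esub> h \<in> Lj"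
        by (auto simp: L)
      then have "g \<in> Lj #>\<^bsub>F j\<^esub> h"
        using subgroup.rcos_module[OF subgroup_Lj F.is_group h(1) g(1)] by blast
      then have "D = D'"
        using g h F.repr_independence[OF _ _ subgroup_Lj] by metis
      then show ?thesis
        using x y by simp
    qed
  qed
qed

lemma U_wf: "wf_graph (fst U)"
  using wf factor_cayley_wf by (intro disj_union_wf) auto

lemma glue_iso_image: "glue glue_pairs \<Gamma> {j} (\<lambda>k. fst (factor_cayley \<A> k Lj)) \<cong>\<^sub>p map_pgraph M U"
  unfolding glue_eq
proof (rule iso_of_same_fibres[OF U_wf])
  show "snd U \<in> verts (fst U)"
    using v0_vert by simp
  fix x y assume "x \<in> verts (fst U)" "y \<in> verts (fst U)"
  then show "M x = M y \<longleftrightarrow> (glue_pairs \<union> glue_pairs\<inverse>)\<^sup>* `` {x} = (glue_pairs \<union> glue_pairs\<inverse>)\<^sup>* `` {y}"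
    unfolding quot_eq_iff using same_fibre quot_class_constant[of glue_pairs M x y] M_pairs by blast
qed

lemma image_edge:
  "(c, a, c') \<in> edges (fst (map_pgraph M U)) \<longleftrightarrow> (c, a, c') \<in> edges (fst (map_pgraph m \<Gamma>)) \<or>
    (\<exists>g\<in>carrier (F j). a \<in> letters (X j) \<and> c = H #>\<^bsub>G\<^esub> gel j g \<and> c' = c #>\<^bsub>G\<^esub> el [a])"
proof -
  have Inl: "(\<exists>v. c' = M v \<and> (Inl u, a, v) \<in> edges (fst U)) \<longleftrightarrow> (\<exists>v. c' = m v \<and> (u, a, v) \<in> EE)" for u
    unfolding disj_union_edges by (metis M_simps(1))
  have Inr: "(\<exists>D z. c = M (Inr (j, D)) \<and> c' = M z \<and> (Inr (j, D), a, z) \<in> edges (fst U)) \<longleftrightarrow>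
      (\<exists>g\<in>carrier (F j). a \<in> letters (X j) \<and> c = H #>\<^bsub>G\<^esub> gel j g \<and> c' = c #>\<^bsub>G\<^esub> el [a])"
  proof
    assume "\<exists>D z. c = M (Inr (j, D)) \<and> c' = M z \<and> (Inr (j, D), a, z) \<in> edges (fst U)"
    then obtain D D' where D: "c = lift H j D" "c' = lift H j D'"
      "(D, a, D') \<in> edges (fst (factor_cayley \<A> j Lj))"
      by auto
    then obtain g where "g \<in> carrier (F j)" "D = Lj #>\<^bsub>F j\<^esub> g" "a \<in> letters (X j)"
      unfolding factor_cayley_edge by blast
    then show "\<exists>g\<in>carrier (F j). a \<in> letters (X j) \<and> c = H #>\<^bsub>G\<^esub> gel j g \<and> c' = c #>\<^bsub>G\<^esub> el [a]"
      using lift_j lift_j_edge[OF D(3)] D(1,2) by auto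
  next
    assume "\<exists>g\<in>carrier (F j). a \<in> letters (X j) \<and> c = H #>\<^bsub>G\<^esub> gel j g \<and> c' = c #>\<^bsub>G\<^esub> el [a]"
    then obtain g where g: "g \<in> carrier (F j)" "a \<in> letters (X j)" "c = H #>\<^bsub>G\<^esub> gel j g"
      "c' = c #>\<^bsub>G\<^esub> el [a]"
      by blast
    have e: "(Lj #>\<^bsub>F j\<^esub> g, a, Lj #>\<^bsub>F j\<^esub> (g \<otimes>\<^bsub>F j\<^esub> fcl j [a])) \<in> edges (fst (factor_cayley \<A> j Lj))"
      unfolding factor_cayley_edge using g by blast
    have "c = M (Inr (j, Lj #>\<^bsub>F j\<^esub> g))"
      using lift_j g by simp
    moreover have "c' = M (Inr (j, Lj #>\<^bsub>F j\<^esub> (g \<otimes>\<^bsub>F j\<^esub> fcl j [a])))"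
      using lift_j_edge[OF e] lift_j g by simp
    moreover have "(Inr (j, Lj #>\<^bsub>F j\<^esub> g), a, Inr (j, Lj #>\<^bsub>F j\<^esub> (g \<otimes>\<^bsub>F j\<^esub> fcl j [a]))) \<in> edges (fst U)"
      using e by simp
    ultimately show "\<exists>D z. c = M (Inr (j, D)) \<and> c' = M z \<and> (Inr (j, D), a, z) \<in> edges (fst U)"
      by blast
  qed
  have "(c, a, c') \<in> edges (fst (map_pgraph M U)) \<longleftrightarrow>
      (\<exists>u. c = m u \<and> (\<exists>v. c' = M v \<and> (Inl u, a, v) \<in> edges (fst U))) \<or>
      (\<exists>D z. c = M (Inr (j, D)) \<and> c' = M z \<and> (Inr (j, D), a, z) \<in> edges (fst U))"
  proof
    assume "(c, a, c') \<in> edges (fst (map_pgraph M U))"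
    then obtain x z where xz: "c = M x" "c' = M z" "(x, a, z) \<in> edges (fst U)"
      unfolding map_edge_iff by blast
    show "(\<exists>u. c = m u \<and> (\<exists>v. c' = M v \<and> (Inl u, a, v) \<in> edges (fst U))) \<or>
      (\<exists>D z. c = M (Inr (j, D)) \<and> c' = M z \<and> (Inr (j, D), a, z) \<in> edges (fst U))"
    proof (cases x)
      case (Inl u)
      then show ?thesis
        using xz by auto
    next
      case (Inr p)
      obtain k D where p: "p = (k, D)"
        by (cases p)
      then have "k = j"
        using xz(3) Inr by auto
      then show ?thesis
        using xz Inr p by blast
    qed
  next
    assume "(\<exists>u. c = m u \<and> (\<exists>v. c' = M v \<and> (Inl u, a, v) \<in> edges (fst U))) \<or>
      (\<exists>D z. c = M (Inr (j, D)) \<and> c' = M z \<and> (Inr (j, D), a, z) \<in> edges (fst U))"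
    then show "(c, a, c') \<in> edges (fst (map_pgraph M U))"
      unfolding map_edge_iff using M_simps(1) by metis
  qed
  then show ?thesis
    unfolding Inl Inr map_edge_iff[of c a c' m \<Gamma>] by blast
qed

lemma nontrivial_L:
  obtains u where "u \<in> words (X j)" "fcl j u \<noteq> \<one>\<^bsub>F j\<^esub>" "H #>\<^bsub>G\<^esub> el u = H"
proof -
  have "\<one>\<^bsub>AA\<^esub> \<in> L"
    using subgroup.one_closed[OF subgroup_L] .
  then obtain d where d: "d \<in> L" "d \<noteq> \<one>\<^bsub>AA\<^esub>"
    using L_ne by blast
  then have dA: "d \<in> carrier AA"
    by (simp add: L)
  obtain u where u: "u \<in> \<phi> j d"
    using ex_\<phi>_word[OF dA] by blast
  have "\<phi> j d \<noteq> \<one>\<^bsub>F j\<^esub>"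
    using d(2) dA inj_\<phi>[of j] \<phi>.hom_one by (metis A.one_closed inj_onD)
  moreover have "H #>\<^bsub>G\<^esub> gel j (\<phi> j d) = H"
    using Lj_stab d(1) by blast
  ultimately show ?thesis
    using that[of u] \<phi>_word[OF dA u] gel_eq[of "\<phi> j d" j u] dA u by simp
qed

text \<open>The new component is essential: a nontrivial element \<open>u\<close> of \<open>H \<inter> A\<close> is read after a detour through
  the given edge.\<close>

lemma new_edge_loop:
  assumes g: "g \<in> carrier (F j)" and a: "a \<in> letters (X j)" and c: "c = H #>\<^bsub>G\<^esub> gel j g"
  shows "\<exists>p\<in>normal_loops \<A> H. (c, a, c #>\<^bsub>G\<^esub> el [a]) \<in> set p"
proof -
  obtain u where u: "u \<in> words (X j)" "fcl j u \<noteq> \<one>\<^bsub>F j\<^esub>" "H #>\<^bsub>G\<^esub> el u = H"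
    by (rule nontrivial_L)
  obtain w where w: "w \<in> words (X j)" "g = fcl j w"
    using ex_fword[OF g] by blast
  have "walk cay H w c"
    using cay_walk[OF H_coset] words_XX[OF w(1)] gel_fcl[OF w(1)] c w(2) by simp
  then obtain p1 p2 where p1: "path cay H p1 c" "label p1 = w"
    and p2: "path cay c p2 H" "label p2 = winv w"
    using walk_obtain_path walk_inv[OF cay_wf] by metis
  have "walk cay H u H"
    using cay_walk[OF H_coset] words_XX[OF u(1)] u(3) by simp
  then obtain p3 where p3: "path cay H p3 H" "label p3 = u"
    by (rule walk_obtain_path)
  define e where "e = (c, a, c #>\<^bsub>G\<^esub> el [a])"
  have e: "e \<in> edges cay"
    unfolding e_def cay_edge using rcosets_H_mult[OF H_coset] g c a words_XX[of "[a]" j] by simp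
  then have e': "(c #>\<^bsub>G\<^esub> el [a], linv a, c) \<in> edges cay"
    unfolding e_def by (rule wf_edge(3)[OF cay_wf])
  define p where "p = p1 @ e # (c #>\<^bsub>G\<^esub> el [a], linv a, c) # p2 @ p3"
  have loop: "path cay H p H"
    unfolding p_def using p1 p2 p3 e e' by (auto simp: path_append[OF cay_wf] e_def)
  have lab: "label p = (w @ [a]) @ winv (w @ [a]) @ u"
    using p1 p2 p3 by (simp add: p_def e_def)
  have "fcl j (label p) = fcl j ((w @ [a]) @ winv (w @ [a])) \<otimes>\<^bsub>F j\<^esub> fcl j u"
    unfolding lab using w u a by (simp add: fmult)
  also have "fcl j ((w @ [a]) @ winv (w @ [a])) = \<one>\<^bsub>F j\<^esub>"
    unfolding fone using w a by (intro fp.cl_eqI fp.pres_rel_winv) auto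
  finally have ne: "fcl j (label p) \<noteq> \<one>\<^bsub>F j\<^esub>"
    using u by simp
  have lw: "label p \<in> words (X j)"
    unfolding lab using w u a by simp
  have "p \<in> normal_loops \<A> H"
    unfolding loops_iff using normal_path_single[OF lw] elt_one_iff[OF lw] ne loop by blast
  moreover have "e \<in> set p"
    by (simp add: p_def)
  ultimately show ?thesis
    unfolding e_def by blast
qed

lemma new_component_image:
  assumes "path cay (H #>\<^bsub>G\<^esub> gel j g) q c" "label q \<in> words (X j)" "g \<in> carrier (F j)"
  shows "set q \<subseteq> edges (fst (map_pgraph M U))"
  using assms
proof (induction q arbitrary: g)
  case (Cons e q)
  obtain c0 a c1 where e: "e = (c0, a, c1)"
    by (cases e) auto
  have a: "a \<in> letters (X j)"
    using Cons.prems(2) e by simp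
  have c0: "c0 = H #>\<^bsub>G\<^esub> gel j g" "c1 = c0 #>\<^bsub>G\<^esub> el [a]" "path cay c1 q c"
    using Cons.prems(1) e by (auto simp: cay_edge)
  have "e \<in> edges (fst (map_pgraph M U))"
    unfolding e image_edge using c0(1,2) a Cons.prems(3) by blast
  moreover have "c1 = H #>\<^bsub>G\<^esub> gel j (g \<otimes>\<^bsub>F j\<^esub> fcl j [a])"
    using c0 a Cons.prems(3) gel_fcl[of "[a]" j] words_XX[of "[a]" j]
    by (simp add: coset_mult_assoc[OF H_coset])
  then have "set q \<subseteq> edges (fst (map_pgraph M U))"
    using Cons.IH[of "g \<otimes>\<^bsub>F j\<^esub> fcl j [a]"] Cons.prems(2,3) c0(3) a by auto
  ultimately show ?case
    by simp
qed simp

lemma completed_image_eq_core: "map_pgraph M U = core"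
proof (rule core_eqI)
  show "snd (map_pgraph M U) = H"
    using m_v0 by simp
  show edges: "edges (fst (map_pgraph M U)) = edges (fst core)"
  proof (rule core_edgesI)
    show "(v, linv a, u) \<in> edges (fst (map_pgraph M U))" if "(u, a, v) \<in> edges (fst (map_pgraph M U))"
      for u a v
      using wf_edge(3)[OF wf_map[OF U_wf] that] .
    show "\<exists>p\<in>normal_loops \<A> H. e \<in> set p" if e: "e \<in> edges (fst (map_pgraph M U))" for e
    proof -
      obtain c a c' where "e = (c, a, c')"
        by (cases e)
      then have "(c, a, c') \<in> edges (fst (map_pgraph m \<Gamma>)) \<or>
          (\<exists>g\<in>carrier (F j). a \<in> letters (X j) \<and> c = H #>\<^bsub>G\<^esub> gel j g \<and> c' = c #>\<^bsub>G\<^esub> el [a])"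
        using e unfolding image_edge[symmetric] by simp
      then show ?thesis
        unfolding \<open>e = (c, a, c')\<close> using core_contains_image[OF m ess] new_edge_loop by blast
    qed
    have sub: "edges (fst (map_pgraph m \<Gamma>)) \<subseteq> edges (fst (map_pgraph M U))"
    proof (rule subrelI)
      fix c z assume "(c, z) \<in> edges (fst (map_pgraph m \<Gamma>))"
      then show "(c, z) \<in> edges (fst (map_pgraph M U))"
        using image_edge[of c "fst z" "snd z"] by simp
    qed
    fix p assume p: "p \<in> normal_loops \<A> H"
    show "set p \<subseteq> edges (fst (map_pgraph M U))"
    proof (rule loop_image[OF m v0i p _ sub])
      fix k assume q: "label p \<in> words (X k)" "el (label p) \<noteq> \<one>\<^bsub>G\<^esub>" "path cay H p H"
      show "set p \<subseteq> edges (fst (map_pgraph M U))"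
      proof (cases "k = i")
        case True
        then show ?thesis
          using single_loop_image[OF m v0i q(1,3,2)] v0i sub by blast
      next
        case False
        then have "k = j"
          using factor_exhaust_other[of k i] by blast
        then show ?thesis
          using new_component_image[of "\<one>\<^bsub>F j\<^esub>" p H] q H_one by simp
      qed
    qed
  qed
  show "verts (fst (map_pgraph M U)) = {H} \<union> ini ` edges (fst (map_pgraph M U))"
  proof (intro equalityI subsetI)
    fix c assume "c \<in> verts (fst (map_pgraph M U))"
    then obtain z where z: "z \<in> verts (fst U)" "c = M z"
      by auto
    show "c \<in> {H} \<union> ini ` edges (fst (map_pgraph M U))"
    proof (cases z)
      case (Inl v)
      then have "c \<in> {H} \<union> ini ` edges (fst (map_pgraph m \<Gamma>))"
        using z image_verts[OF m] by auto
      then consider "c = H" | a c' where "(c, a, c') \<in> edges (fst (map_pgraph m \<Gamma>))"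
        by auto
      then show ?thesis
      proof cases
        case (2 a c')
        then have "(c, a, c') \<in> edges (fst (map_pgraph M U))"
          unfolding image_edge by blast
        then have "ini (c, a, c') \<in> ini ` edges (fst (map_pgraph M U))"
          by (rule imageI)
        then show ?thesis by simp
      qed simp
    next
      case (Inr p)
      then obtain D where "z = Inr (j, D)" "D \<in> rcosets\<^bsub>F j\<^esub> Lj"
        using z(1) by (cases p) auto
      then obtain g where g: "g \<in> carrier (F j)" "c = H #>\<^bsub>G\<^esub> gel j g"
        using z(2) lift_j by (auto simp: rcosets_iff)
      obtain u where u: "u \<in> words (X j)" "fcl j u \<noteq> \<one>\<^bsub>F j\<^esub>"
        by (rule nontrivial_L)
      then obtain a u' where "u = a # u'"
        by (cases u) (auto simp: fone)
      then have "a \<in> letters (X j)"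
        using u(1) by simp
      then have "(c, a, c #>\<^bsub>G\<^esub> el [a]) \<in> edges (fst (map_pgraph M U))"
        unfolding image_edge using g by blast
      then have "ini (c, a, c #>\<^bsub>G\<^esub> el [a]) \<in> ini ` edges (fst (map_pgraph M U))"
        by (rule imageI)
      then show ?thesis by simp
    qed
  next
    fix c assume c: "c \<in> {H} \<union> ini ` edges (fst (map_pgraph M U))"
    show "c \<in> verts (fst (map_pgraph M U))"
    proof (cases "c = H")
      case True
      have "M (Inl v0) \<in> M ` verts (fst U)"
        using v0_vert by (intro imageI) simp
      then show ?thesis
        using True m_v0 by simp
    next
      case False
      then obtain e where "e \<in> edges (fst (map_pgraph M U))" "c = ini e"
        using c by blast
      then show ?thesis
        using wf_map[OF U_wf, of M] unfolding wf_graph_def by blast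
    qed
  qed
qed

end

context stallings_input
begin

lemma step6_trivial:
  assumes "H = {\<one>\<^bsub>G\<^esub>}" "verts (fst \<Gamma>) = {snd \<Gamma>}" "edges (fst \<Gamma>) = {}" "step6 \<A> \<Gamma> \<Gamma>'"
  shows "\<Gamma>' \<cong>\<^sub>p core"
proof -
  have "\<not> needs_completion \<A> \<Gamma> i C0 L" for i C0 L
  proof
    assume "needs_completion \<A> \<Gamma> i C0 L"
    then have "mono_connected (X i) (fst \<Gamma>) C0"
      by (simp add: needs_completion_def mono_component_def)
    then show False
      using assms(3) by (auto simp: mono_connected_def subgraph_def)
  qed
  then have "\<Gamma>' = map_pgraph (\<lambda>v. {Inl v}) \<Gamma>"
    using assms(4) unfolding step6_def by blast
  then have \<Gamma>': "\<Gamma>' = (\<lparr>verts = {{Inl (snd \<Gamma>)}}, edges = {}\<rparr>, {Inl (snd \<Gamma>)})"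
    using assms(2,3) by (simp add: map_pgraph_def)
  show ?thesis
    unfolding core_trivial[OF assms(1)] \<Gamma>' pgraph_iso_def
    by (intro exI[of _ "\<lambda>_. H"]) (simp add: map_pgraph_def)
qed

lemma step6_core:
  assumes pre: "is_precover \<Gamma>" and irreducible: "\<nexists>\<Gamma>'. removal_step \<A> \<Gamma> \<Gamma>'"
    and nontrivial: "\<not> (bichromatic \<A> (fst \<Gamma>) = {} \<and> (\<exists>i. \<Gamma> \<cong>\<^sub>p factor_cayley \<A> i {\<one>\<^bsub>F i\<^esub>}))"
    and out: "step6 \<A> \<Gamma> \<Gamma>'"
  shows "\<Gamma>' \<cong>\<^sub>p core"
proof -
  interpret precover_graph \<A> ws \<Gamma>
    using pre by unfold_locales
  obtain m where m: "coset_map \<Gamma> m"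
    using good by (auto simp: good_def)
  have ess: "essential i v" if "v \<in> C i" for i v
    using all_essential[OF irreducible nontrivial that] .
  show ?thesis
  proof (cases "\<exists>k. v0 \<in> C k")
    case False
    then have triv: "VV = {v0}" "EE = {}"
      using v0_col_or_trivial by auto
    have "H = {\<one>\<^bsub>G\<^esub>}"
    proof (rule H_trivialI)
      fix y assume "y \<in> set ws"
      then obtain w where w: "walk (fst \<Gamma>) v0 w v0" "el w = el y"
        using good unfolding good_def reads_gens_def by blast
      then have "w = []"
        using triv by (cases w) auto
      then show "el y = \<one>\<^bsub>G\<^esub>"
        using w by (simp add: elt_one)
    qed
    then show ?thesis
      using step6_trivial[OF _ triv out] by blast
  next
    case True
    then obtain k where k: "v0 \<in> C k" by blast
    show ?thesis
    proof (cases "\<exists>i C0 L. needs_completion \<A> \<Gamma> i C0 L")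
      case False
      then have "\<Gamma>' = map_pgraph (\<lambda>v. {Inl v}) \<Gamma>"
        using out unfolding step6_def by blast
      moreover have "map_pgraph (\<lambda>v. {Inl v}) \<Gamma> \<cong>\<^sub>p map_pgraph m \<Gamma>"
        using coset_map_inj[OF m] by (intro iso_of_same_fibres[OF wf v0_vert]) auto
      ultimately show ?thesis
        using core_eq_image[OF m k ess False] by simp
    next
      case True
      then obtain i C0 L where nc: "needs_completion \<A> \<Gamma> i C0 L"
        and \<Gamma>': "let j = other i; Gj = F j; Lj = \<phi> j ` L in
        \<Gamma>' = glue
          ({(Inl v0, Inr (j, Lj #>\<^bsub>Gj\<^esub> \<one>\<^bsub>Gj\<^esub>))} \<union>
           {(Inl t, Inr (j, Lj #>\<^bsub>Gj\<^esub> \<phi> j a)) |a t p. a \<in> carrier AA - L \<and>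
             path C0 v0 p t \<and> label p \<in> \<phi> i a})
          \<Gamma> {j} (\<lambda>j. fst (factor_cayley \<A> j Lj))"
        using out unfolding step6_def by blast
      note nc = needs_completionD[OF nc]
      interpret completion \<A> ws \<Gamma> i L m
        using m nc ess by unfold_locales auto
      have "\<Gamma>' = glue glue_pairs \<Gamma> {j} (\<lambda>k. fst (factor_cayley \<A> k Lj))"
        using \<Gamma>' unfolding Let_def glue_pairs_def nc(3) .
      then show ?thesis
        using glue_iso_image completed_image_eq_core by simp
    qed
  qed
qed

lemma step6_exists: "\<exists>\<Gamma>'. step6 \<A> \<Gamma> \<Gamma>'"
  unfolding step6_def Let_def by blast

lemma factor_cayley_walk_words: "walk (fst (factor_cayley \<A> i K)) D w D' \<Longrightarrow> w \<in> words (X i)"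
  by (induction w arbitrary: D) (auto simp: factor_cayley_edge)

text \<open>In the exceptional case of step 5, all closed walks at the base point are relations of one factor,
  so \<open>H\<close> is trivial and the core is a single vertex.\<close>

lemma trivial_output_H:
  assumes "good \<Delta>" "\<Delta> \<cong>\<^sub>p factor_cayley \<A> i {\<one>\<^bsub>F i\<^esub>}"
  shows "H = {\<one>\<^bsub>G\<^esub>}"
proof (rule H_trivialI)
  fix y assume "y \<in> set ws"
  then obtain w where w: "walk (fst \<Delta>) (snd \<Delta>) w (snd \<Delta>)" "el w = el y"
    using assms(1) unfolding good_def reads_gens_def by blast
  let ?K = "{\<one>\<^bsub>F i\<^esub>}"
  obtain f where f: "map_pgraph f \<Delta> = factor_cayley \<A> i ?K"
    using assms(2) unfolding pgraph_iso_def by blast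
  have "f (snd \<Delta>) = ?K #>\<^bsub>F i\<^esub> \<one>\<^bsub>F i\<^esub>"
    by (metis f factor_cayley_snd map_simps(2))
  then have walk: "walk (fst (factor_cayley \<A> i ?K)) (?K #>\<^bsub>F i\<^esub> \<one>\<^bsub>F i\<^esub>) w (?K #>\<^bsub>F i\<^esub> \<one>\<^bsub>F i\<^esub>)"
    using walk_map[OF w(1), of f] f by simp
  then have words: "w \<in> words (X i)"
    by (rule factor_cayley_walk_words)
  have det: "det (fst (factor_cayley \<A> i ?K))"
    unfolding det_def factor_cayley_edge by (auto simp: r_coset_def)
  have "walk (fst (factor_cayley \<A> i ?K)) (?K #>\<^bsub>F i\<^esub> \<one>\<^bsub>F i\<^esub>) w (?K #>\<^bsub>F i\<^esub> fcl i w)"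
    using cover_walk_one[OF factor_cayley_cover[OF F.one_closed, of i ?K] words]
    by (simp only: F.l_one[OF fcl_closed[OF words]])
  then have "?K #>\<^bsub>F i\<^esub> fcl i w = ?K #>\<^bsub>F i\<^esub> \<one>\<^bsub>F i\<^esub>"
    using det_walk[OF det] walk by blast
  then have "fcl i w = \<one>\<^bsub>F i\<^esub>"
    using words by (simp add: r_coset_def)
  then show "el y = \<one>\<^bsub>G\<^esub>"
    using w(2) elt_one_iff[OF words] by simp
qed

lemma step5_6_core:
  assumes "is_precover \<Gamma>4" "step5 \<A> \<Gamma>4 \<Gamma>5" "step6 \<A> \<Gamma>5 \<Gamma>'"
  shows "\<Gamma>' \<cong>\<^sub>p core"
proof -
  obtain \<Delta> where ex: "exhausts (removal_step \<A>) \<Gamma>4 \<Delta>"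
    and \<Gamma>5: "\<Gamma>5 = (if bichromatic \<A> (fst \<Delta>) = {} \<and> (\<exists>i. \<Delta> \<cong>\<^sub>p factor_cayley \<A> i {\<one>\<^bsub>F i\<^esub>})
             then (\<lparr>verts = {snd \<Delta>}, edges = {}\<rparr>, snd \<Delta>) else \<Delta>)"
    using assms(2) unfolding step5_def by blast
  have \<Delta>: "is_precover \<Delta>"
    using removal_pre[OF assms(1) ex] .
  show ?thesis
  proof (cases "bichromatic \<A> (fst \<Delta>) = {} \<and> (\<exists>i. \<Delta> \<cong>\<^sub>p factor_cayley \<A> i {\<one>\<^bsub>F i\<^esub>})")
    case True
    then have "H = {\<one>\<^bsub>G\<^esub>}"
      using trivial_output_H \<Delta> unfolding is_precover_def by blast
    then show ?thesis
      using step6_trivial[OF _ _ _ assms(3)] True \<Gamma>5 by simp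
  next
    case False
    then have "\<Gamma>5 = \<Delta>"
      using \<Gamma>5 by argo
    then show ?thesis
      using step6_core[OF \<Delta> _ False] ex assms(3) unfolding exhausts_def by blast
  qed
qed

lemma stallings_output_core: "stallings_output \<A> ws \<Gamma> \<Longrightarrow> \<Gamma> \<cong>\<^sub>p core"
  unfolding stallings_output_def
  using step2_good step3_good step4_pre step5_6_core by blast

lemma stallings_output_exists: "\<exists>\<Gamma>. stallings_output \<A> ws \<Gamma>"
proof -
  obtain \<Gamma>2 where 2: "step2 (step1 ws) \<Gamma>2"
    using step2_exists by blast
  note g2 = step2_good[OF 2]
  obtain \<Gamma>3 where 3: "step3 \<A> \<Gamma>2 \<Gamma>3"
    using step3_exists[OF g2] by blast
  note g3 = step3_good[OF g2 3]
  obtain \<Gamma>4 where 4: "step4 \<A> \<Gamma>3 \<Gamma>4"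
    using step4_exists[OF g3] by blast
  obtain \<Delta> where "exhausts (removal_step \<A>) \<Gamma>4 \<Delta>"
    using removal_exists[OF step4_pre[OF g3 4]] by blast
  then obtain \<Gamma>5 where 5: "step5 \<A> \<Gamma>4 \<Gamma>5"
    unfolding step5_def by blast
  obtain \<Gamma> where "step6 \<A> \<Gamma>5 \<Gamma>"
    using step6_exists by blast
  then show ?thesis
    unfolding stallings_output_def using 2 3 4 5 by blast
qed

end

theorem theorem8p9:
  fixes \<A> :: "('a, 'x) amalgam"
    and Y :: "'x word set set"
    and ws :: "'x word list"
  assumes "finite_amalgam \<A>"
    and "Y \<subseteq> carrier (amalgam_group \<A>)" and "finite Y"
    and "set ws \<subseteq> words (all_gens \<A>)" and "elt \<A> ` set ws = Y"
  shows "(\<exists>\<Gamma>. stallings_output \<A> ws \<Gamma>) \<and>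
    (\<forall>\<Gamma>. stallings_output \<A> ws \<Gamma> \<longrightarrow> \<Gamma> \<cong>\<^sub>p normal_core \<A> (generate (amalgam_group \<A>) Y))"
proof -
  interpret stallings_input \<A> ws
    using assms by unfold_locales auto
  have "H = generate (amalgam_group \<A>) Y"
    using assms by (simp add: H_def)
  then show ?thesis
    using stallings_output_exists stallings_output_core by metis
qed

end
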